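(* Let $m,N\in\mathbf N$, $1<p<N/m$, and let $(u_n)$ be a bounded sequence in $\dot W^{m,p}(\mathbf R^N)$. Assume that on a subsequence, still denoted by $n$, $(u_n)$ has a profile decomposition (in the sense defined in the context) with profile elements $(w^l,y_{l,n},j_{l,n},\Lambda)\in\dot W^{m,p}(\mathbf R^N)\times\mathbf R^N\times\mathbf Z\times(\mathbf N\cup\{0,\infty\})$ ($l\in\mathbf Z_{\ge0}^{<\Lambda+1}$, $n\in\mathbf Z_{\ge l}$). Let $\alpha\in(\mathbf Z_{\ge0})^N$ be a multi-index with $|\alpha|<m$, and let $F_\alpha:\mathbf R\to\mathbf R$ be a locally Lipschitz continuous function such that $$F_\alpha\bigl(2^{jN/p^*_{m-|\alpha|}}s\bigr)=2^{jN}F_\alpha(s),\qquad s\in\mathbf R,\ j\in\mathbf Z.$$ Then $$\lim_{n\to\infty}\int_{\mathbf R^N}F_\alpha(\partial^\alpha u_n(x))\,dx=\sum_{l=0}^\Lambda\int_{\mathbf R^N}F_\alpha(\partial^\alpha w^l(x))\,dx.$$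
   Context: For $1\le p<N/m$, $\dot W^{m,p}(\mathbf R^N)$ is the completion (closure) of $C_c^\infty(\mathbf R^N)$ in the norm $\|u\|_{\dot W^{m,p}(\mathbf R^N)}=\bigl(\sum_{|\alpha|=m}\|\partial^\alpha u\|^p_{L^p(\mathbf R^N)}\bigr)^{1/p}$; for an open set $\Omega$, $\|u\|_{\dot W^{m,p}(\Omega)}=\bigl(\sum_{|\alpha|=m}\|\partial^\alpha u\|_{L^p(\Omega)}^p\bigr)^{1/p}$ (for $m=0$ this is the $L^p$ norm). The critical exponents are $p^*_s=pN/(N-sp)$ for integers $1\le s\le m$. $B(x,r)$ is the closed ball in $\mathbf R^N$. $\mathbf Z_{\ge a}$ is the set of integers $\ge a$. For $\Lambda\in\mathbf N\cup\{0,+\infty\}$, $\mathbf Z_{\ge0}^{<\Lambda+1}=\{0,\dots,\Lambda\}$ if $\Lambda<\infty$ and $\mathbf Z_{\ge0}$ if $\Lambda=\infty$. If $\Lambda<\infty$, $\lim_{L\to\Lambda}a_L$ and $\limsup_{L\to\Lambda}a_L$ mean $a_\Lambda$; if $\Lambda=\infty$ they are the usual limits as $L\to\infty$, and $\sum_{l=0}^\Lambda$ is the infinite series. Profile decomposition. A (sub)sequence $(u_n)$, bounded in $\dot W^{m,p}(\mathbf R^N)$, has a profile decomposition with profile elements $(w^l,y_{l,n},j_{l,n},\Lambda)$ if, with residual terms $r^L_n\in\dot W^{m,p}(\mathbf R^N)$ defined by $$u_n=\sum_{l=0}^L2^{j_{l,n}N/p^*_m}w^l(2^{j_{l,n}}(\cdot-y_{l,n}))+r^L_n,\quad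 L\in\mathbf Z_{\ge0}^{<\Lambda+1},\ n\in\mathbf Z_{\ge L},$$ the following hold: (1) $y_{0,n}=0$, $j_{0,n}=0$ for all $n$, and $w^l\ne0$ for $1\le l\in\mathbf Z_{\ge0}^{<\Lambda+1}$; (2) for $l\ne k$, $|j_{l,n}-j_{k,n}|+2^{j_{k,n}}|y_{l,n}-y_{k,n}|\to\infty$ as $n\to\infty$; moreover $j_{l,n}-j_{k,n}$ either tends to $+\infty$, or tends to $-\infty$, or converges, and either $2^{j_{k,n}}|y_{l,n}-y_{k,n}|\to\infty$ or $2^{j_{k,n}}(y_{l,n}-y_{k,n})$ converges; (3) $2^{-j_{l,n}N/p^*_m}u_n(2^{-j_{l,n}}\cdot+y_{l,n})\to w^l$ weakly in $\dot W^{m,p}(\mathbf R^N)$ and a.e. on $\mathbf R^N$ as $n\to\infty$, for each $l$; (4) $2^{-j_{k,n}N/p^*_m}r^L_n(2^{-j_{k,n}}\cdot+y_{k,n})$ converges, weakly in $\dot W^{m,p}(\mathbf R^N)$ and a.e., to $0$ if $k\le L$ and to $w^k$ if $k\ge L+1$, as $n\to\infty$; (5) $\limsup_n\|u_n\|^p_{\dot W^{m,p}(\mathbf R^N)}\ge\sum_{l=0}^\Lambda\|w^l\|^p_{\dot W^{m,p}(\mathbf R^N)}+\limsup_{L\to\Lambda}\limsup_{R\to\infty}\limsup_{n\to\infty}\|r^L_n\|^p_{\dot W^{m,p}(\mathbf R^N\setminus\mathcal B_{n,R,L})}$, where $\mathcal B_{n,R,L}=\bigcup_{l=0}^LB(y_{l,n},2^{-j_{l,n}}R)$;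 (6) $\lim_{L\to\Lambda}\sup_{\phi\in U}\limsup_{n\to\infty}\sup_{y\in\mathbf R^N,j\in\mathbf Z}|\langle\phi,2^{-jN/p^*_m}r^L_n(2^{-j}\cdot+y)\rangle|=0$, where $U$ is the closed unit ball of $[\dot W^{m,p}(\mathbf R^N)]^*$; (7) $\limsup_{L\to\Lambda}\limsup_{n\to\infty}\|r^L_n\|_{\dot W^{m,p}(\mathbf R^N)}\le2\limsup_{n\to\infty}\|u_n\|_{\dot W^{m,p}(\mathbf R^N)}<\infty$; (8) $\lim_{L\to\Lambda}\limsup_{n\to\infty}\|r^L_n\|_{L^{p^*_m}(\mathbf R^N)}=0$ and $\lim_{L\to\Lambda}\limsup_{n\to\infty}\|r^L_n\|_{\dot W^{k,p^*_{m-k}}(\mathbf R^N)}=0$ for all integers $0\le k<m$. *)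

theory Defs
  imports "HOL-Analysis.Analysis"
begin

definition partial :: "'n \<Rightarrow> (real ^ 'n \<Rightarrow> real) \<Rightarrow> real ^ 'n \<Rightarrow> real" where
  "partial i f x = frechet_derivative f (at x) (axis i 1)"

primrec partials :: "'n list \<Rightarrow> (real ^ 'n \<Rightarrow> real) \<Rightarrow> real ^ 'n \<Rightarrow> real" where
  "partials [] f = f"
| "partials (i # is) f = partial i (partials is f)"

definition smooth :: "(real ^ 'n \<Rightarrow> real) \<Rightarrow> bool" where
  "smooth f \<longleftrightarrow> (\<forall>is x. partials is f differentiable (at x))"

definition test_functions :: "(real ^ 'n \<Rightarrow> real) set" where
  "test_functions = {f. smooth f \<and> compact (closure (support_on UNIV f))}"

definition mi_order :: "('n::finite \<Rightarrow> nat) \<Rightarrow> nat" where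
  "mi_order \<alpha> = (\<Sum>i\<in>UNIV. \<alpha> i)"

text \<open>The order in which the partial derivatives are taken is irrelevant for smooth functions, the
  only functions to which \<^term>\<open>mi_partial\<close> is applied; an arbitrary order is chosen.\<close>

definition mi_partial :: "('n \<Rightarrow> nat) \<Rightarrow> (real ^ 'n \<Rightarrow> real) \<Rightarrow> real ^ 'n \<Rightarrow> real" where
  "mi_partial \<alpha> f = partials (SOME is. \<forall>i. count_list is i = \<alpha> i) f"

text \<open>Classes of functions modulo equality almost everywhere are represented by
  Borel-measurable functions; every class of Lebesgue-measurable functions contains one.\<close>

definition locally_integrable :: "(real ^ 'n \<Rightarrow> real) \<Rightarrow> bool" where
  "locally_integrable u \<longleftrightarrow>
     u \<in> borel_measurable borel \<and> (\<forall>K. compact K \<longrightarrow> set_integrable lborel K u)"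

definition has_weak_deriv ::
    "('n::finite \<Rightarrow> nat) \<Rightarrow> (real ^ 'n \<Rightarrow> real) \<Rightarrow> (real ^ 'n \<Rightarrow> real) \<Rightarrow> bool" where
  "has_weak_deriv \<alpha> u v \<longleftrightarrow> locally_integrable u \<and> locally_integrable v \<and>
     (\<forall>\<phi>\<in>test_functions.
        (LINT x|lborel. u x * mi_partial \<alpha> \<phi> x)
          = (- 1) ^ mi_order \<alpha> * (LINT x|lborel. v x * \<phi> x))"

text \<open>A representative of the weak derivative, unique only up to null sets; it is
  unspecified if no weak derivative exists.\<close>

definition weak_deriv :: "('n::finite \<Rightarrow> nat) \<Rightarrow> (real ^ 'n \<Rightarrow> real) \<Rightarrow> real ^ 'n \<Rightarrow> real" where
  "weak_deriv \<alpha> u = (SOME v. has_weak_deriv \<alpha> u v)"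

text \<open>Norms take values in \<^typ>\<open>ennreal\<close>, so that infinite norms and all suprema and upper
  limits have their usual meaning.  The power is only used with positive exponents.\<close>

definition enn_powr :: "ennreal \<Rightarrow> real \<Rightarrow> ennreal" where
  "enn_powr x a = (if x = top then top else ennreal (enn2real x powr a))"

definition Lp_norm :: "real \<Rightarrow> (real ^ 'n) set \<Rightarrow> (real ^ 'n \<Rightarrow> real) \<Rightarrow> ennreal" where
  "Lp_norm p \<Omega> f = enn_powr (\<integral>\<^sup>+x\<in>\<Omega>. ennreal (\<bar>f x\<bar> powr p) \<partial>lborel) (1 / p)"

text \<open>For a subset \<open>\<Omega>\<close> the weak derivative on the whole space is restricted to \<open>\<Omega>\<close>.\<close>

definition Wdot_norm :: "nat \<Rightarrow> real \<Rightarrow> (real ^ 'n) set \<Rightarrow> (real ^ 'n \<Rightarrow> real) \<Rightarrow> ennreal" where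
  "Wdot_norm m p \<Omega> u =
     enn_powr (\<Sum>\<alpha> | mi_order \<alpha> = m. enn_powr (Lp_norm p \<Omega> (weak_deriv \<alpha> u)) p) (1 / p)"

definition pstar :: "nat \<Rightarrow> real \<Rightarrow> nat \<Rightarrow> real" where
  "pstar N p s = p * real N / (real N - real s * p)"

text \<open>The completion of the test functions, for \<open>p < N / m\<close>, realised as a space of functions via
  the Sobolev embedding into \<open>L\<close> to the power \<^term>\<open>pstar N p m\<close>: the \<open>m\<close>-th order norm does not see
  polynomials of degree less than \<open>m\<close>, and the convergence in the critical Lebesgue space
  selects the representative vanishing at infinity.\<close>

definition Wdot :: "nat \<Rightarrow> real \<Rightarrow> (real ^ 'n \<Rightarrow> real) set" where
  "Wdot m p = {u. u \<in> borel_measurable borel \<and>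
     (\<forall>\<alpha>. mi_order \<alpha> = m \<longrightarrow> (\<exists>v. has_weak_deriv \<alpha> u v)) \<and>
     (\<exists>\<phi>::nat \<Rightarrow> real ^ 'n \<Rightarrow> real. range \<phi> \<subseteq> test_functions \<and>
        (\<lambda>k. Wdot_norm m p UNIV (\<lambda>x. u x - \<phi> k x)) \<longlonglongrightarrow> 0 \<and>
        (\<lambda>k. Lp_norm (pstar CARD('n) p m) UNIV (\<lambda>x. u x - \<phi> k x)) \<longlonglongrightarrow> 0)}"

text \<open>The values of a functional outside \<^term>\<open>Wdot m p\<close> are irrelevant.
  Boundedness implies that functionals respect equality almost everywhere.\<close>

definition Wdot_dual :: "nat \<Rightarrow> real \<Rightarrow> ((real ^ 'n \<Rightarrow> real) \<Rightarrow> real) set" where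
  "Wdot_dual m p = {\<Phi>.
     (\<forall>u\<in>Wdot m p. \<forall>v\<in>Wdot m p. \<Phi> (\<lambda>x. u x + v x) = \<Phi> u + \<Phi> v) \<and>
     (\<forall>u\<in>Wdot m p. \<forall>c. \<Phi> (\<lambda>x. c * u x) = c * \<Phi> u) \<and>
     (\<exists>C. \<forall>u\<in>Wdot m p. ennreal \<bar>\<Phi> u\<bar> \<le> ennreal C * Wdot_norm m p UNIV u)}"

definition Wdot_dual_ball :: "nat \<Rightarrow> real \<Rightarrow> ((real ^ 'n \<Rightarrow> real) \<Rightarrow> real) set" where
  "Wdot_dual_ball m p =
     {\<Phi> \<in> Wdot_dual m p. \<forall>u\<in>Wdot m p. ennreal \<bar>\<Phi> u\<bar> \<le> Wdot_norm m p UNIV u}"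

definition weak_and_ae_tendsto ::
    "nat \<Rightarrow> real \<Rightarrow> (nat \<Rightarrow> real ^ 'n \<Rightarrow> real) \<Rightarrow> (real ^ 'n \<Rightarrow> real) \<Rightarrow> bool" where
  "weak_and_ae_tendsto m p f g \<longleftrightarrow>
     (\<forall>\<Phi>\<in>Wdot_dual m p. (\<lambda>n. \<Phi> (f n)) \<longlonglongrightarrow> \<Phi> g) \<and>
     (AE x in lborel. (\<lambda>n. f n x) \<longlonglongrightarrow> g x)"

definition tendsto_upto :: "enat \<Rightarrow> (nat \<Rightarrow> 'a::topological_space) \<Rightarrow> 'a \<Rightarrow> bool" where
  "tendsto_upto \<Lambda> a s \<longleftrightarrow> (case \<Lambda> of enat K \<Rightarrow> a K = s | \<infinity> \<Rightarrow> a \<longlonglongrightarrow> s)"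

definition limsup_upto :: "enat \<Rightarrow> (nat \<Rightarrow> ennreal) \<Rightarrow> ennreal" where
  "limsup_upto \<Lambda> a = (case \<Lambda> of enat K \<Rightarrow> a K | \<infinity> \<Rightarrow> limsup a)"

definition dilate :: "nat \<Rightarrow> real \<Rightarrow> int \<Rightarrow> real ^ 'n \<Rightarrow> (real ^ 'n \<Rightarrow> real) \<Rightarrow> real ^ 'n \<Rightarrow> real" where
  "dilate m p j y w = (\<lambda>x. 2 powr (real_of_int j * real CARD('n) / pstar CARD('n) p m)
     * w ((2 powr real_of_int j) *\<^sub>R (x - y)))"

definition undilate :: "nat \<Rightarrow> real \<Rightarrow> int \<Rightarrow> real ^ 'n \<Rightarrow> (real ^ 'n \<Rightarrow> real) \<Rightarrow> real ^ 'n \<Rightarrow> real" where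
  "undilate m p j y u = (\<lambda>x. 2 powr (- real_of_int j * real CARD('n) / pstar CARD('n) p m)
     * u ((2 powr (- real_of_int j)) *\<^sub>R x + y))"

definition residual :: "nat \<Rightarrow> real \<Rightarrow> (nat \<Rightarrow> real ^ 'n \<Rightarrow> real) \<Rightarrow> (nat \<Rightarrow> real ^ 'n \<Rightarrow> real) \<Rightarrow>
    (nat \<Rightarrow> nat \<Rightarrow> real ^ 'n) \<Rightarrow> (nat \<Rightarrow> nat \<Rightarrow> int) \<Rightarrow> nat \<Rightarrow> nat \<Rightarrow> real ^ 'n \<Rightarrow> real" where
  "residual m p u w y j L n =
     (\<lambda>x. u n x - (\<Sum>l\<le>L. dilate m p (j l n) (y l n) (w l) x))"

text \<open>The values \<open>y l n\<close> and \<open>j l n\<close> are meant for \<open>n \<ge> l\<close>; all conditions below only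
  involve these or are asymptotic in \<open>n\<close>.\<close>

definition profile_decomposition ::
    "nat \<Rightarrow> real \<Rightarrow> (nat \<Rightarrow> real ^ 'n \<Rightarrow> real) \<Rightarrow> (nat \<Rightarrow> real ^ 'n \<Rightarrow> real) \<Rightarrow>
     (nat \<Rightarrow> nat \<Rightarrow> real ^ 'n) \<Rightarrow> (nat \<Rightarrow> nat \<Rightarrow> int) \<Rightarrow> enat \<Rightarrow> bool" where
  "profile_decomposition m p u w y j \<Lambda> \<longleftrightarrow>
    (let N = CARD('n); r = residual m p u w y j in
     (\<forall>l. enat l \<le> \<Lambda> \<longrightarrow> w l \<in> Wdot m p) \<and>
     (\<forall>L n. enat L \<le> \<Lambda> \<longrightarrow> L \<le> n \<longrightarrow> r L n \<in> Wdot m p) \<and>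
     (\<forall>n. y 0 n = 0 \<and> j 0 n = 0) \<and>
     (\<forall>l\<ge>1. enat l \<le> \<Lambda> \<longrightarrow> \<not> (AE x in lborel. w l x = 0)) \<and>
     (\<forall>l k. enat l \<le> \<Lambda> \<longrightarrow> enat k \<le> \<Lambda> \<longrightarrow> l \<noteq> k \<longrightarrow>
        filterlim (\<lambda>n. \<bar>real_of_int (j l n - j k n)\<bar>
            + 2 powr real_of_int (j k n) * norm (y l n - y k n)) at_top sequentially \<and>
        (filterlim (\<lambda>n. real_of_int (j l n - j k n)) at_top sequentially \<or>
         filterlim (\<lambda>n. real_of_int (j l n - j k n)) at_bot sequentially \<or>
         convergent (\<lambda>n. real_of_int (j l n - j k n))) \<and>
        (filterlim (\<lambda>n. 2 powr real_of_int (j k n) * norm (y l n - y k n)) at_top sequentially \<or>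
         convergent (\<lambda>n. (2 powr real_of_int (j k n)) *\<^sub>R (y l n - y k n)))) \<and>
     (\<forall>l. enat l \<le> \<Lambda> \<longrightarrow>
        weak_and_ae_tendsto m p (\<lambda>n. undilate m p (j l n) (y l n) (u n)) (w l)) \<and>
     (\<forall>L k. enat L \<le> \<Lambda> \<longrightarrow> enat k \<le> \<Lambda> \<longrightarrow>
        weak_and_ae_tendsto m p (\<lambda>n. undilate m p (j k n) (y k n) (r L n))
          (if k \<le> L then (\<lambda>x. 0) else w k)) \<and>
     limsup (\<lambda>n. enn_powr (Wdot_norm m p UNIV (u n)) p) \<ge>
       (\<Sum>l. if enat l \<le> \<Lambda> then enn_powr (Wdot_norm m p UNIV (w l)) p else 0)
       + limsup_upto \<Lambda> (\<lambda>L. Limsup at_top (\<lambda>R::real. limsup (\<lambda>n.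
           enn_powr (Wdot_norm m p
             (UNIV - (\<Union>l\<le>L. cball (y l n) (2 powr (- real_of_int (j l n)) * R))) (r L n)) p))) \<and>
     tendsto_upto \<Lambda> (\<lambda>L. SUP \<Phi>\<in>Wdot_dual_ball m p. limsup (\<lambda>n.
         SUP (z, i)\<in>UNIV. ennreal \<bar>\<Phi> (undilate m p i z (r L n))\<bar>)) 0 \<and>
     limsup_upto \<Lambda> (\<lambda>L. limsup (\<lambda>n. Wdot_norm m p UNIV (r L n)))
       \<le> 2 * limsup (\<lambda>n. Wdot_norm m p UNIV (u n)) \<and>
     2 * limsup (\<lambda>n. Wdot_norm m p UNIV (u n)) < \<infinity> \<and>
     tendsto_upto \<Lambda> (\<lambda>L. limsup (\<lambda>n. Lp_norm (pstar N p m) UNIV (r L n))) 0 \<and>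
     (\<forall>k<m. tendsto_upto \<Lambda>
        (\<lambda>L. limsup (\<lambda>n. Wdot_norm k (pstar N p (m - k)) UNIV (r L n))) 0))"

definition locally_lipschitz :: "(real \<Rightarrow> real) \<Rightarrow> bool" where
  "locally_lipschitz F \<longleftrightarrow> (\<forall>s. \<exists>e>0. \<exists>C. C-lipschitz_on (cball s e) F)"

end

theory Submission
  imports Defs
begin

text \<open>Write \<open>q\<close> for the critical exponent of the derivatives of order \<open>|\<alpha>|\<close>.  Homogeneity and
  continuity of \<open>F\<close> alone give \<open>|F (a + b) - F a| \<le> \<epsilon> |a|^q + C |b|^q\<close> for every \<open>\<epsilon> > 0\<close>, and
  hence \<open>|F (a + b) - F a - F b| \<le> \<epsilon> (|a|^q + |b|^q) + C (min |a| |b|)^q\<close>.  By condition (8) the first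
  inequality allows one to drop the residual term.  The second one splits the integral over the sum
  of the remaining profiles, because the overlap \<open>\<integral> (min |f| |g|)^q\<close> of two profiles that drift apart
  tends to zero, and the scaling of \<open>F\<close> identifies the integral of each rescaled profile.  That the
  \<open>\<alpha>\<close>-derivative of an element of the homogeneous Sobolev space exists and lies in \<open>L^q\<close> rests on the
  Gagliardo-Nirenberg-Sobolev inequality.\<close>

section \<open>The homogeneous nonlinearity\<close>

text \<open>The scaling law is available only for the discrete group of factors 2^(jN/q), so F need
  not be homogeneous in the usual sense. What survives is that every pair (a, b) can be moved into
  one fixed bounded range away from the origin, where uniform continuity yields the constants. The
  factor \<epsilon> multiplies a mass that must stay bounded while L grows. Estimating the sum of
  the first L profiles by finite subadditivity costs a factor depending on L. Hence the mass of the
  full derivatives is bounded once, through a single L with small residual, and the residual is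
  dropped by an increment that starts at the full derivative and not at the profile sum. In the
  splitting of the profile sum L is fixed, and the dependence on L does no harm. Absolute
  convergence of the series of integrals is not established. The integrals along the sequence are
  eventually close to every partial sum of large index, which makes the partial sums a Cauchy
  sequence with the same limit. Membership in \<open>Wdot\<close> supplies weak derivatives of order
  m only; those of order |\<alpha>| are constructed as limits of derivatives of test
  functions.\<close>

lemma powr_scale_exists:
  fixes M T :: real
  assumes "M > 0" "T > 0"
  obtains i :: int where "2 powr (of_int i * T) \<le> M" "M < 2 powr ((of_int i + 1) * T)"
proof
  define i where "i = \<lfloor>log 2 M / T\<rfloor>"
  have 1: "of_int i * T \<le> log 2 M"
    using assms by (simp add: i_def flip: pos_le_divide_eq)
  have "log 2 M / T < of_int i + 1" unfolding i_def by linarith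
  then have 2: "log 2 M < (of_int i + 1) * T"
    using assms by (simp add: pos_divide_less_eq)
  show "2 powr (of_int i * T) \<le> M" using 1 assms by (simp add: le_log_iff)
  show "M < 2 powr ((of_int i + 1) * T)" using 2 assms by (simp add: log_less_iff)
qed

text \<open>Separates the pointwise analysis of the nonlinearity from the function spaces:
  \<open>d\<close> will be the dimension and \<open>q\<close> the critical exponent.\<close>

locale homogeneous =
  fixes F :: "real \<Rightarrow> real" and d q :: real
  assumes cont: "continuous_on UNIV F"
    and d_pos: "d > 0" and q_pos: "q > 0"
    and hom: "\<And>s (i::int). F (2 powr (of_int i * d / q) * s) = 2 powr (of_int i * d) * F s"
begin

lemma F_0: "F 0 = 0"
proof -
  have "F 0 = 2 powr d * F 0" using hom[of 1 0] by simp
  moreover have "2 powr d > 1" using d_pos by simp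
  ultimately show ?thesis by (metis mult_cancel_right1 order_less_irrefl)
qed

text \<open>Both sides are multiplied by \<sigma>^q when (a, b) is multiplied by \<sigma> =
  2^(id/q), so only pairs with max |a| |b| in [1, \<theta>) matter. For such pairs either b is
  small, and uniform continuity gives \<epsilon>, which |a| >= 1 absorbs; or |b| exceeds \<delta>,
  and boundedness of F gives C.\<close>

lemma increment_bound:
  assumes "\<epsilon> > 0"
  obtains C where "C \<ge> 0" "\<And>a b. \<bar>F (a + b) - F a\<bar> \<le> \<epsilon> * \<bar>a\<bar> powr q + C * \<bar>b\<bar> powr q"
proof -
  define \<theta> where "\<theta> = 2 powr (d / q)"
  have \<theta>: "\<theta> > 1" using d_pos q_pos by (simp add: \<theta>_def)
  \<comment> \<open>Contains a, b and a + b for every normalised pair.\<close>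
  let ?K = "{-2*\<theta>..2*\<theta>}"
  have cK: "continuous_on ?K F" using cont continuous_on_subset by blast
  have "uniformly_continuous_on ?K F" by (rule compact_uniformly_continuous[OF cK]) simp
  then obtain \<delta>0 where \<delta>0: "\<delta>0 > 0"
    "\<And>x x'. x \<in> ?K \<Longrightarrow> x' \<in> ?K \<Longrightarrow> dist x' x < \<delta>0 \<Longrightarrow> dist (F x') (F x) < \<epsilon>"
    using assms unfolding uniformly_continuous_on_def by metis
  \<comment> \<open>The bound 1/2 ensures that |b| \<le> \<delta> forces |a| \<ge> 1 in a normalised
    pair.\<close>
  define \<delta> where "\<delta> = min (\<delta>0/2) (1/2)"
  have \<delta>: "\<delta> > 0" "\<delta> < \<delta>0" "\<delta> < 1" using \<delta>0 by (auto simp: \<delta>_def)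
  have "bounded (F ` ?K)" using compact_continuous_image[OF cK] compact_imp_bounded by blast
  then obtain B where B: "\<And>x. x \<in> ?K \<Longrightarrow> \<bar>F x\<bar> \<le> B" unfolding bounded_iff by (metis image_eqI real_norm_def)
  have "B \<ge> 0" using B[of 0] \<theta> by force
  define C where "C = 2 * B / \<delta> powr q"
  have C: "C \<ge> 0" using \<open>B \<ge> 0\<close> by (simp add: C_def)
  have normalised: "\<bar>F (a + b) - F a\<bar> \<le> \<epsilon> * \<bar>a\<bar> powr q + C * \<bar>b\<bar> powr q"
    if ab: "1 \<le> max \<bar>a\<bar> \<bar>b\<bar>" "max \<bar>a\<bar> \<bar>b\<bar> < \<theta>" for a b
  proof (cases "\<bar>b\<bar> \<le> \<delta>")
    case True
    then have a: "\<bar>a\<bar> \<ge> 1" using ab \<delta> by auto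
    have "\<bar>F (a + b) - F a\<bar> \<le> \<epsilon>"
      using \<delta>0(2)[of a "a + b"] ab True \<delta> by (force simp: dist_real_def)
    also have "\<dots> \<le> \<epsilon> * \<bar>a\<bar> powr q" using a assms q_pos by (simp add: ge_one_powr_ge_zero)
    also have "\<dots> \<le> \<epsilon> * \<bar>a\<bar> powr q + C * \<bar>b\<bar> powr q" using C by simp
    finally show ?thesis .
  next
    case False
    have "\<bar>F (a + b)\<bar> \<le> B" "\<bar>F a\<bar> \<le> B" using ab by (auto intro!: B)
    then have "\<bar>F (a + b) - F a\<bar> \<le> 2 * B" by linarith
    also have "\<dots> = C * \<delta> powr q" using \<delta> by (simp add: C_def)
    also have "\<dots> \<le> C * \<bar>b\<bar> powr q" using C False \<delta> q_pos
      by (intro mult_left_mono powr_mono2) auto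
    also have "\<dots> \<le> \<epsilon> * \<bar>a\<bar> powr q + C * \<bar>b\<bar> powr q" using assms by simp
    finally show ?thesis .
  qed
  have "\<bar>F (a + b) - F a\<bar> \<le> \<epsilon> * \<bar>a\<bar> powr q + C * \<bar>b\<bar> powr q" for a b
  proof (cases "max \<bar>a\<bar> \<bar>b\<bar> = 0")
    case True
    then have "a = 0" "b = 0" by (auto simp: max_def split: if_splits)
    then show ?thesis by simp
  next
    case False
    then have M: "max \<bar>a\<bar> \<bar>b\<bar> > 0" by (auto simp: max_def split: if_splits)
    obtain i :: int where i: "2 powr (of_int i * (d/q)) \<le> max \<bar>a\<bar> \<bar>b\<bar>"
       "max \<bar>a\<bar> \<bar>b\<bar> < 2 powr ((of_int i + 1) * (d/q))"
      using powr_scale_exists[OF M] d_pos q_pos by (metis divide_pos_pos)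
    define \<sigma> where "\<sigma> = 2 powr (of_int i * d / q)"
    have \<sigma>: "\<sigma> > 0" by (simp add: \<sigma>_def)
    have \<sigma>q: "\<sigma> powr q = 2 powr (of_int i * d)" using q_pos by (simp add: \<sigma>_def powr_powr)
    define a' b' where "a' = a / \<sigma>" and "b' = b / \<sigma>"
    have ab: "a = \<sigma> * a'" "b = \<sigma> * b'" using \<sigma> by (auto simp: a'_def b'_def)
    have Mx: "max \<bar>a\<bar> \<bar>b\<bar> = \<sigma> * max \<bar>a'\<bar> \<bar>b'\<bar>"
      using \<sigma> by (auto simp: ab abs_mult max_def)
    have "\<sigma> \<le> \<sigma> * max \<bar>a'\<bar> \<bar>b'\<bar>" using i(1) unfolding Mx[symmetric] by (simp add: \<sigma>_def)
    then have 1: "1 \<le> max \<bar>a'\<bar> \<bar>b'\<bar>" using \<sigma> by simp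
    have "\<sigma> * max \<bar>a'\<bar> \<bar>b'\<bar> < \<sigma> * \<theta>" using i(2) unfolding Mx[symmetric]
      by (simp add: \<sigma>_def \<theta>_def ring_distribs add_divide_distrib powr_add)
    then have 2: "max \<bar>a'\<bar> \<bar>b'\<bar> < \<theta>" using \<sigma> by simp
    have "\<bar>F (a + b) - F a\<bar> = \<bar>\<sigma> powr q * F (a' + b') - \<sigma> powr q * F a'\<bar>"
      unfolding \<sigma>q hom[symmetric] ab ring_distribs(1)[symmetric] \<sigma>_def[symmetric] ..
    also have "\<dots> = \<sigma> powr q * \<bar>F (a' + b') - F a'\<bar>"
      by (simp add: abs_mult flip: right_diff_distrib)
    also have "\<dots> \<le> \<sigma> powr q * (\<epsilon> * \<bar>a'\<bar> powr q + C * \<bar>b'\<bar> powr q)"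
      by (intro mult_left_mono normalised 1 2) simp
    also have "\<dots> = \<epsilon> * \<bar>a\<bar> powr q + C * \<bar>b\<bar> powr q"
      using \<sigma> by (simp add: ab abs_mult powr_mult algebra_simps)
    finally show ?thesis .
  qed
  then show ?thesis using C that by blast
qed

lemma growth_bound:
  obtains C where "C \<ge> 0" "\<And>a. \<bar>F a\<bar> \<le> C * \<bar>a\<bar> powr q"
proof -
  obtain C where "C \<ge> 0" "\<And>a b. \<bar>F (a + b) - F a\<bar> \<le> 1 * \<bar>a\<bar> powr q + C * \<bar>b\<bar> powr q"
    using increment_bound[of 1] by auto
  from this(1) this(2)[of 0] show ?thesis using that[of C] F_0 q_pos by simp
qed

text \<open>If |b| \<le> |a|, the increment bound at a controls F (a + b) - F a, and F b is of size
  |b|^q by itself; both errors then involve the smaller argument. The other case follows by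
  symmetry.\<close>

lemma superposition_bound:
  assumes "\<epsilon> > 0"
  obtains C where "C \<ge> 0" "\<And>a b. \<bar>F (a + b) - F a - F b\<bar>
    \<le> \<epsilon> * (\<bar>a\<bar> powr q + \<bar>b\<bar> powr q) + C * (min \<bar>a\<bar> \<bar>b\<bar>) powr q"
proof -
  obtain C1 where C1: "C1 \<ge> 0" "\<And>a b. \<bar>F (a + b) - F a\<bar> \<le> \<epsilon> * \<bar>a\<bar> powr q + C1 * \<bar>b\<bar> powr q"
    using increment_bound[OF assms] by blast
  obtain C2 where C2: "C2 \<ge> 0" "\<And>a. \<bar>F a\<bar> \<le> C2 * \<bar>a\<bar> powr q"
    using growth_bound by blast
  have *: "\<bar>F (a + b) - F a - F b\<bar> \<le> \<epsilon> * (\<bar>a\<bar> powr q + \<bar>b\<bar> powr q) + (C1 + C2) * (min \<bar>a\<bar> \<bar>b\<bar>) powr q"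
    if "\<bar>b\<bar> \<le> \<bar>a\<bar>" for a b
  proof -
    have "\<bar>F (a + b) - F a - F b\<bar> \<le> \<epsilon> * \<bar>a\<bar> powr q + C1 * \<bar>b\<bar> powr q + C2 * \<bar>b\<bar> powr q"
      using C1(2)[of a b] C2(2)[of b] by linarith
    moreover have "0 \<le> \<epsilon> * \<bar>b\<bar> powr q" using assms by simp
    ultimately show ?thesis using that by (simp add: algebra_simps)
  qed
  have "\<bar>F (a + b) - F a - F b\<bar> \<le> \<epsilon> * (\<bar>a\<bar> powr q + \<bar>b\<bar> powr q) + (C1 + C2) * (min \<bar>a\<bar> \<bar>b\<bar>) powr q"
    for a b
  proof (cases "\<bar>b\<bar> \<le> \<bar>a\<bar>")
    case False
    then show ?thesis using *[of a b] by (simp add: add.commute min.commute diff_diff_eq)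
  qed (rule *)
  then show ?thesis using that[of "C1 + C2"] C1 C2 by auto
qed

end

section \<open>Gagliardo's inequality\<close>

lemma enn_powr_ennreal [simp]: "0 \<le> x \<Longrightarrow> enn_powr (ennreal x) a = ennreal (x powr a)"
  by (simp add: enn_powr_def)

lemma enn_powr_top [simp]: "enn_powr top a = top"
  by (simp add: enn_powr_def)

lemma enn_powr_0 [simp]: "enn_powr 0 a = 0"
  by (simp add: enn_powr_def)

lemma enn_powr_mono:
  assumes "x \<le> y" "a \<ge> 0"
  shows "enn_powr x a \<le> enn_powr y a"
proof (cases "y = top")
  case False
  then show ?thesis using assms
    by (cases x; cases y) (auto simp: ennreal_le_iff powr_mono2 neq_top_trans)
qed simp

lemma enn_powr_eq_0_iff: "enn_powr x a = 0 \<longleftrightarrow> x = 0"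
  by (cases x) (auto simp: enn_powr_def)

lemma enn_powr_eq_top_iff: "enn_powr x a = top \<longleftrightarrow> x = top"
  by (auto simp: enn_powr_def)

lemma enn_powr_powr: "enn_powr (enn_powr x a) b = enn_powr x (a * b)"
  by (cases x) (auto simp: powr_powr)

lemma enn_powr_1 [simp]: "enn_powr x 1 = x"
  by (cases x) auto

lemma measurable_enn_powr [measurable]:
  assumes [measurable]: "f \<in> borel_measurable M"
  shows "(\<lambda>x. enn_powr (f x) a) \<in> borel_measurable M"
  unfolding enn_powr_def by measurable

text \<open>After division of each h i by its integral, the arithmetic-geometric mean inequality
  bounds the product by an average of functions with integral 1. The normalisation divides by the
  integrals, so the cases 0 and infinity are treated apart.\<close>

lemma nn_integral_prod_root_le:
  assumes S: "finite S" "S \<noteq> {}"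
    and [measurable]: "\<And>i. i \<in> S \<Longrightarrow> h i \<in> borel_measurable M"
  shows "(\<integral>\<^sup>+t. (\<Prod>i\<in>S. enn_powr (h i t) (1 / real (card S))) \<partial>M)
    \<le> (\<Prod>i\<in>S. enn_powr (\<integral>\<^sup>+t. h i t \<partial>M) (1 / real (card S)))"
proof -
  define s where "s = real (card S)"
  have s: "s > 0" using S by (simp add: s_def card_gt_0_iff)
  define c where "c i = (\<integral>\<^sup>+t. h i t \<partial>M)" for i
  \<comment> \<open>A vanishing integral has to be handled before an infinite one, since 0 *
    \<open>top\<close> = 0 in \<open>ennreal\<close>.\<close>
  consider (zero) i where "i \<in> S" "c i = 0" | (top) i where "i \<in> S" "c i = top" "\<forall>k\<in>S. c k \<noteq> 0"
    | (fin) "\<forall>i\<in>S. c i \<noteq> 0 \<and> c i \<noteq> top" by blast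
  then show ?thesis
  proof cases
    case zero
    then have "AE t in M. h i t = 0" by (subst nn_integral_0_iff_AE[symmetric]) (auto simp: c_def)
    then have "AE t in M. (\<Prod>i\<in>S. enn_powr (h i t) (1 / real (card S))) = 0"
      by eventually_elim (use S zero in \<open>auto simp: enn_powr_eq_0_iff\<close>)
    then have "(\<integral>\<^sup>+t. (\<Prod>i\<in>S. enn_powr (h i t) (1 / real (card S))) \<partial>M) = 0"
      by (subst nn_integral_0_iff_AE) auto
    then show ?thesis by simp
  next
    case top
    have "(\<Prod>i\<in>S. enn_powr (c i) (1 / s)) = top"
      using S top by (auto simp: ennreal_prod_eq_top enn_powr_eq_0_iff enn_powr_eq_top_iff)
    then show ?thesis by (simp add: c_def s_def)
  next
    case fin
    define r where "r i = enn2real (c i)" for i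
    have cr: "c i = ennreal (r i)" "r i > 0" if "i \<in> S" for i
      using fin that by (auto simp: r_def enn2real_positive_iff less_top zero_less_iff_neq_zero)
    define K where "K = (\<Prod>i\<in>S. r i powr (1/s))"
    have K: "K > 0" unfolding K_def by (rule prod_pos) (use cr in fastforce)
    \<comment> \<open>The coefficient of \<open>h i t\<close> is chosen so that every summand
      integrates to \<open>K / s\<close>; the \<open>card S\<close> summands then add up to
      \<open>K\<close>.\<close>
    have pw: "(\<Prod>i\<in>S. enn_powr (h i t) (1/s)) \<le> (\<Sum>i\<in>S. ennreal (K / (r i * s)) * h i t)" for t
    proof (cases "\<exists>i\<in>S. h i t = top")
      case True
      then obtain i where i: "i \<in> S" "h i t = top" by auto
      have "ennreal (K / (r i * s)) * h i t = top"
        using i K cr[of i] s by (simp add: ennreal_mult_top)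
      then have "(\<Sum>i\<in>S. ennreal (K / (r i * s)) * h i t) = top"
        using i S by (simp add: sum.remove[of S i])
      then show ?thesis by simp
    next
      case False
      define x where "x i = enn2real (h i t)" for i
      have hx: "h i t = ennreal (x i)" "x i \<ge> 0" if "i \<in> S" for i
        using False that by (auto simp: x_def less_top)
      have "(\<Prod>i\<in>S. enn_powr (h i t) (1/s)) = (\<Prod>i\<in>S. ennreal (x i powr (1/s)))"
        by (intro prod.cong) (auto simp: hx)
      also have "\<dots> = ennreal (\<Prod>i\<in>S. x i powr (1/s))"
        by (subst prod_ennreal) auto
      also have "(\<Prod>i\<in>S. x i powr (1/s)) = (\<Prod>i\<in>S. (r i powr (1/s)) * (x i / r i) powr (1/s))"
        using cr hx by (intro prod.cong) (force simp: less_imp_le simp flip: powr_mult)+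
      also have "\<dots> = K * (\<Prod>i\<in>S. x i / r i) powr (1/s)"
        using cr hx by (simp add: prod.distrib K_def prod_powr_distrib less_imp_le)
      also have "\<dots> \<le> K * (\<Sum>i\<in>S. x i / r i / s)"
        unfolding s_def using K S hx cr
        by (intro mult_left_mono arith_geom_mean) (auto simp: less_imp_le)
      also have "ennreal (K * (\<Sum>i\<in>S. x i / r i / s)) = ennreal (\<Sum>i\<in>S. K / (r i * s) * x i)"
        by (simp add: sum_distrib_left field_simps)
      also have "\<dots> = (\<Sum>i\<in>S. ennreal (K / (r i * s) * x i))"
        using K cr s hx by (subst sum_ennreal) (auto simp: less_imp_le)
      also have "\<dots> = (\<Sum>i\<in>S. ennreal (K / (r i * s)) * h i t)"
        using K cr s hx by (intro sum.cong) (simp_all add: less_imp_le flip: ennreal_mult)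
      finally show ?thesis by (simp add: ennreal_leI)
    qed
    have "(\<integral>\<^sup>+t. (\<Prod>i\<in>S. enn_powr (h i t) (1/s)) \<partial>M)
        \<le> (\<integral>\<^sup>+t. (\<Sum>i\<in>S. ennreal (K / (r i * s)) * h i t) \<partial>M)"
      by (intro nn_integral_mono pw)
    also have "\<dots> = (\<Sum>i\<in>S. ennreal (K / (r i * s)) * c i)"
      by (simp add: nn_integral_sum nn_integral_cmult c_def)
    also have "\<dots> = (\<Sum>i\<in>S. ennreal (K / s))"
      using cr K s by (intro sum.cong) (fastforce simp: less_imp_le simp flip: ennreal_mult)+
    also have "\<dots> = ennreal K" using s K by (simp add: s_def ennreal_of_nat_eq_real_of_nat flip: ennreal_mult)
    also have "\<dots> = (\<Prod>i\<in>S. enn_powr (c i) (1/s))"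
      unfolding K_def by (subst prod_ennreal[symmetric]) (auto intro!: prod.cong simp: cr less_imp_le)
    finally show ?thesis by (simp add: s_def c_def)
  qed
qed

section \<open>Integration over a subset of the coordinates\<close>

text \<open>The coordinates in \<open>J\<close> are integrated and the others frozen at
  \<open>x\<close>. The result remains a function of all coordinates, so functions belonging to
  different sets \<open>J\<close> can be multiplied without a change of domain.\<close>

definition partial_nn_integral ::
    "'n set \<Rightarrow> (('n::finite \<Rightarrow> real) \<Rightarrow> ennreal) \<Rightarrow> ('n \<Rightarrow> real) \<Rightarrow> ennreal" where
  "partial_nn_integral J f x =
     (\<integral>\<^sup>+z. f (\<lambda>i. if i \<in> J then z i else x i) \<partial>(PiM J (\<lambda>_. lborel)))"

abbreviation lborel_fun :: "('n::finite \<Rightarrow> real) measure" where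
  "lborel_fun \<equiv> PiM UNIV (\<lambda>_. lborel)"

interpretation lborel_product: product_sigma_finite "\<lambda>_::'n::finite. lborel::real measure"
  by standard

lemma measurable_override [measurable]:
  "(\<lambda>(z, x). \<lambda>i. if i \<in> J then z i else x i)
     \<in> (PiM J (\<lambda>_. lborel) \<Otimes>\<^sub>M lborel_fun) \<rightarrow>\<^sub>M (lborel_fun :: ('n::finite \<Rightarrow> real) measure)"
proof (rule measurable_PiM_single')
  fix i :: 'n
  show "(\<lambda>\<omega>. (case \<omega> of (z, x) \<Rightarrow> \<lambda>i. if i \<in> J then z i else x i) i)
      \<in> (PiM J (\<lambda>_. lborel) \<Otimes>\<^sub>M lborel_fun) \<rightarrow>\<^sub>M lborel"
    by (cases "i \<in> J") (simp_all add: case_prod_beta')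
qed auto

lemma measurable_partial_nn_integral [measurable]:
  assumes [measurable]: "f \<in> borel_measurable lborel_fun"
  shows "partial_nn_integral J f \<in> borel_measurable lborel_fun"
proof -
  interpret sigma_finite_measure "PiM J (\<lambda>_. lborel::real measure)"
    by (rule lborel_product.sigma_finite) simp
  have "(\<lambda>(x, z). f ((\<lambda>(z, x). \<lambda>i. if i \<in> J then z i else x i) (z, x)))
     \<in> borel_measurable (lborel_fun \<Otimes>\<^sub>M PiM J (\<lambda>_. lborel))"
    by measurable
  then show ?thesis
    unfolding partial_nn_integral_def[abs_def]
    by (intro borel_measurable_nn_integral) (simp add: case_prod_beta')
qed

lemma partial_nn_integral_empty: "partial_nn_integral {} f x = f x"
  by (simp add: partial_nn_integral_def space_PiM)

lemma partial_nn_integral_UNIV: "partial_nn_integral UNIV f x = (\<integral>\<^sup>+z. f z \<partial>lborel_fun)"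
  by (simp add: partial_nn_integral_def)

lemma partial_nn_integral_insert:
  assumes [measurable]: "f \<in> borel_measurable lborel_fun" and "k \<notin> J"
  shows "partial_nn_integral (insert k J) f x = (\<integral>\<^sup>+t. partial_nn_integral J f (x(k := t)) \<partial>lborel)"
proof -
  have "(\<lambda>z. f ((\<lambda>(z, x). \<lambda>i. if i \<in> insert k J then z i else x i) (z, x)))
      \<in> borel_measurable (PiM (insert k J) (\<lambda>_. lborel))"
    by measurable (simp add: space_PiM)
  then have "partial_nn_integral (insert k J) f x
     = (\<integral>\<^sup>+t. (\<integral>\<^sup>+z. f (\<lambda>i. if i \<in> insert k J then (z(k := t)) i else x i)
          \<partial>(PiM J (\<lambda>_. lborel))) \<partial>lborel)"
    unfolding partial_nn_integral_def
    by (subst lborel_product.product_nn_integral_insert_rev) (use assms in auto)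
  also have "(\<lambda>t z i. if i \<in> insert k J then (z(k := t)) i else x i)
      = (\<lambda>t z i. if i \<in> J then z i else (x(k := t)) i)"
    using assms(2) by (auto simp: fun_eq_iff)
  then have "(\<integral>\<^sup>+t. (\<integral>\<^sup>+z. f (\<lambda>i. if i \<in> insert k J then (z(k := t)) i else x i)
          \<partial>(PiM J (\<lambda>_. lborel))) \<partial>lborel)
     = (\<integral>\<^sup>+t. partial_nn_integral J f (x(k := t)) \<partial>lborel)"
    unfolding partial_nn_integral_def by (simp only: fun_eq_iff)
  finally show ?thesis .
qed

lemma partial_nn_integral_update:
  "k \<in> J \<Longrightarrow> partial_nn_integral J f (x(k := t)) = partial_nn_integral J f x"
  unfolding partial_nn_integral_def by (intro nn_integral_cong arg_cong[of _ _ f]) auto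

text \<open>Integrating over a further coordinate \<open>k\<close>, the factor with index \<open>k\<close> is constant, and the
  generalised Hoelder inequality applies to the remaining \<open>CARD('n) - 1\<close> factors.\<close>

lemma gagliardo_partial:
  fixes f :: "'n::finite \<Rightarrow> ('n \<Rightarrow> real) \<Rightarrow> ennreal"
  assumes card: "CARD('n) \<ge> 2"
    and [measurable]: "\<And>i. f i \<in> borel_measurable lborel_fun"
  defines "s \<equiv> real CARD('n) - 1"
  shows "partial_nn_integral J (\<lambda>x. \<Prod>i\<in>UNIV. enn_powr (partial_nn_integral {i} (f i) x) (1/s)) x
    \<le> (\<Prod>i\<in>UNIV. enn_powr (partial_nn_integral (insert i J) (f i) x) (1/s))"
proof -
  have "finite J" by simp
  then show ?thesis
  proof (induction J arbitrary: x rule: finite_induct)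
    case empty
    then show ?case by (simp add: partial_nn_integral_empty)
  next
    case (insert k J)
    let ?P = partial_nn_integral
    let ?G = "\<lambda>x. \<Prod>i\<in>UNIV. enn_powr (?P {i} (f i) x) (1/s)"
    let ?S = "UNIV - {k} :: 'n set"
    have S: "finite ?S" "?S \<noteq> {}" "s = real (card ?S)"
      using card by (auto simp: s_def card_Diff_singleton)
        (metis card_Diff_insert card_Diff_singleton Diff_eq_empty_iff UNIV_I card.empty card_mono diff_is_0_eq finite not_less_eq_eq numeral_2_eq_2 One_nat_def insert_absorb)
    have meas: "(\<lambda>t. ?P A (f i) (x(k := t))) \<in> borel_measurable lborel" for A i
    proof -
      have "(\<lambda>t. x(k := t)) \<in> lborel \<rightarrow>\<^sub>M lborel_fun"
        by (rule measurable_PiM_single') auto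
      then show ?thesis by measurable
    qed
    have "?P (insert k J) ?G x = (\<integral>\<^sup>+t. ?P J ?G (x(k := t)) \<partial>lborel)"
      by (rule partial_nn_integral_insert) (use insert in auto)
    also have "\<dots> \<le> (\<integral>\<^sup>+t. (\<Prod>i\<in>UNIV. enn_powr (?P (insert i J) (f i) (x(k := t))) (1/s)) \<partial>lborel)"
      by (intro nn_integral_mono insert.IH)
    also have "\<dots> = (\<integral>\<^sup>+t. enn_powr (?P (insert k J) (f k) x) (1/s)
        * (\<Prod>i\<in>?S. enn_powr (?P (insert i J) (f i) (x(k := t))) (1/s)) \<partial>lborel)"
      by (subst prod.remove[of UNIV k]) (auto simp: partial_nn_integral_update)
    also have "\<dots> = enn_powr (?P (insert k J) (f k) x) (1/s)
        * (\<integral>\<^sup>+t. (\<Prod>i\<in>?S. enn_powr (?P (insert i J) (f i) (x(k := t))) (1/s)) \<partial>lborel)"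
      by (intro nn_integral_cmult borel_measurable_prod_ennreal measurable_enn_powr meas)
    also have "\<dots> \<le> enn_powr (?P (insert k J) (f k) x) (1/s)
        * (\<Prod>i\<in>?S. enn_powr (\<integral>\<^sup>+t. ?P (insert i J) (f i) (x(k := t)) \<partial>lborel) (1/s))"
      unfolding S(3) by (intro mult_left_mono nn_integral_prod_root_le S meas) simp
    \<comment> \<open>Tonelli in the coordinate \<open>k\<close>, which lies in no
      \<open>insert i J\<close> with \<open>i\<close> in \<open>?S\<close>.\<close>
    also have "(\<Prod>i\<in>?S. enn_powr (\<integral>\<^sup>+t. ?P (insert i J) (f i) (x(k := t)) \<partial>lborel) (1/s))
        = (\<Prod>i\<in>?S. enn_powr (?P (insert i (insert k J)) (f i) x) (1/s))"
      using insert(2) by (intro prod.cong refl) (subst insert_commute, subst partial_nn_integral_insert, auto)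
    also have "enn_powr (?P (insert k J) (f k) x) (1/s) * \<dots>
        = (\<Prod>i\<in>UNIV. enn_powr (?P (insert i (insert k J)) (f i) x) (1/s))"
      by (simp add: prod.remove[of UNIV k])
    finally show ?case .
  qed
qed

section \<open>Transfer from the product measure to Lebesgue measure on
  \<open>real ^ 'n\<close>\<close>

lemma borel_measurable_vec_lambda:
  assumes [measurable]: "\<And>i. (\<lambda>x. f x i) \<in> borel_measurable M"
  shows "(\<lambda>x. (\<chi> i. f x i) :: real ^ 'n::finite) \<in> borel_measurable M"
proof (subst borel_measurable_euclidean_space, intro ballI)
  fix b :: "real ^ 'n" assume "b \<in> Basis"
  then obtain i where "b = axis i 1" by (auto simp: Basis_vec_def)
  then show "(\<lambda>x. (\<chi> i. f x i) \<bullet> b) \<in> borel_measurable M"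
    by (simp add: inner_axis)
qed

text \<open>Lebesgue measure is determined by the volumes of boxes, which the product measure
  computes coordinate by coordinate. This makes Tonelli for single coordinates available on
  vectors.\<close>

lemma lborel_vec_eq_distr: "(lborel :: (real ^ 'n::finite) measure) = distr lborel_fun borel (\<lambda>z. \<chi> i. z i)"
proof (rule lborel_eqI)
  have [measurable]: "(\<lambda>z. \<chi> i. z i) \<in> lborel_fun \<rightarrow>\<^sub>M (borel :: (real ^ 'n) measure)"
    by (rule borel_measurable_vec_lambda) simp
  fix l u :: "real ^ 'n"
  assume le: "\<And>b. b \<in> Basis \<Longrightarrow> l \<bullet> b \<le> u \<bullet> b"
  then have le': "l $ i \<le> u $ i" for i by (metis axis_in_Basis_iff cart_eq_inner_axis real_inner_1_right insertI1 Basis_real_def)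
  have "emeasure (distr lborel_fun borel (\<lambda>z. \<chi> i. z i)) (box l u)
      = emeasure lborel_fun (PiE UNIV (\<lambda>i. {l $ i<..<u $ i}))"
    by (subst emeasure_distr) (auto simp: mem_box_cart space_PiM PiE_iff intro!: arg_cong2[of _ _ _ _ emeasure])
  also have "\<dots> = (\<Prod>i\<in>UNIV. ennreal (u $ i - l $ i))"
    using le' by (subst lborel_product.emeasure_PiM) auto
  also have "\<dots> = ennreal (\<Prod>i\<in>UNIV. (u - l) $ i)"
    using le' by (subst prod_ennreal) auto
  also have "(\<Prod>i\<in>UNIV. (u - l) $ i) = (\<Prod>b\<in>Basis. (u - l) \<bullet> b)"
    by (subst Basis_vec_def) (simp add: prod.UNION_disjoint UNION_singleton_eq_range prod.reindex inj_on_def axis_eq_axis cart_eq_inner_axis)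
  finally show "emeasure (distr lborel_fun borel (\<lambda>z. \<chi> i. z i)) (box l u) = (\<Prod>b\<in>Basis. (u - l) \<bullet> b)" .
qed simp

text \<open>An estimate of Loomis-Whitney type: each factor of the bound for \<open>h\<close> is
  constant along one coordinate direction. It is \<open>gagliardo_partial\<close> with all
  coordinates integrated.\<close>

lemma gagliardo:
  fixes g :: "'n::finite \<Rightarrow> real ^ 'n \<Rightarrow> ennreal"
  assumes card: "CARD('n) \<ge> 2"
    and [measurable]: "\<And>i. g i \<in> borel_measurable borel"
    and h: "\<And>x. h x \<le> (\<Prod>i\<in>UNIV. enn_powr (\<integral>\<^sup>+t. g i (x + t *\<^sub>R axis i 1) \<partial>lborel) (1 / (real CARD('n) - 1)))"
    and [measurable]: "h \<in> borel_measurable borel"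
  shows "(\<integral>\<^sup>+x. h x \<partial>lborel) \<le> (\<Prod>i\<in>UNIV. enn_powr (\<integral>\<^sup>+x. g i x \<partial>lborel) (1 / (real CARD('n) - 1)))"
proof -
  let ?v = "\<lambda>z::'n \<Rightarrow> real. (\<chi> i. z i) :: real ^ 'n"
  let ?s = "1 / (real CARD('n) - 1)"
  have [measurable]: "?v \<in> lborel_fun \<rightarrow>\<^sub>M borel" by (rule borel_measurable_vec_lambda) simp
  define f where "f i z = g i (?v z)" for i z
  have f [measurable]: "f i \<in> borel_measurable lborel_fun" for i unfolding f_def[abs_def] by measurable
  have line: "partial_nn_integral {i} (f i) z = (\<integral>\<^sup>+t. g i (?v z + t *\<^sub>R axis i 1) \<partial>lborel)" for i z
  proof -
    have [measurable]: "(\<lambda>t. ?v (z(i := t))) \<in> borel_measurable borel"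
      by (rule borel_measurable_vec_lambda) simp
    have "partial_nn_integral {i} (f i) z = (\<integral>\<^sup>+t. f i (z(i := t)) \<partial>lborel)"
      using partial_nn_integral_insert[of "f i" i "{}" z] by (simp add: partial_nn_integral_empty)
    \<comment> \<open>A translation in t, so that the line is parametrised from the point itself and
      not from the hyperplane where its i-th coordinate vanishes.\<close>
    also have "\<dots> = (\<integral>\<^sup>+t. f i (z(i := z i + 1 * t)) \<partial>lborel)"
      unfolding f_def by (subst nn_integral_real_affine[where c=1 and t="z i"]) auto
    also have "\<dots> = (\<integral>\<^sup>+t. g i (?v z + t *\<^sub>R axis i 1) \<partial>lborel)"
      unfolding f_def by (intro nn_integral_cong arg_cong[of _ _ "g i"]) (auto simp: vec_eq_iff axis_def)
    finally show ?thesis .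
  qed
  have "(\<integral>\<^sup>+x. h x \<partial>lborel) = (\<integral>\<^sup>+z. h (?v z) \<partial>lborel_fun)"
    by (subst lborel_vec_eq_distr) (simp add: nn_integral_distr)
  also have "\<dots> \<le> (\<integral>\<^sup>+z. (\<Prod>i\<in>UNIV. enn_powr (partial_nn_integral {i} (f i) z) ?s) \<partial>lborel_fun)"
    unfolding line by (intro nn_integral_mono h)
  also have "\<dots> \<le> (\<Prod>i\<in>UNIV. enn_powr (\<integral>\<^sup>+z. f i z \<partial>lborel_fun) ?s)"
    using gagliardo_partial[where f=f and J=UNIV and x=undefined, OF card f] by (simp add: partial_nn_integral_UNIV)
  also have "(\<lambda>i. \<integral>\<^sup>+z. f i z \<partial>lborel_fun) = (\<lambda>i. \<integral>\<^sup>+x. g i x \<partial>lborel)"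
    by (subst lborel_vec_eq_distr) (simp add: nn_integral_distr f_def[abs_def])
  finally show ?thesis .
qed

section \<open>Test functions\<close>

lemma lborel_affine_density:
  fixes t :: "'a::euclidean_space" and c :: real
  assumes "c > 0"
  shows "lborel = density (distr lborel borel (\<lambda>x. t + c *\<^sub>R x)) (\<lambda>_. ennreal (c ^ DIM('a)))"
  using lborel_affine[of c t] assms by simp

lemma nn_integral_lborel_affine:
  fixes t :: "'a::euclidean_space" and c :: real
  assumes c: "c > 0" and [measurable]: "f \<in> borel_measurable borel"
  shows "(\<integral>\<^sup>+x. f (t + c *\<^sub>R x) \<partial>lborel) = ennreal (1 / c ^ DIM('a)) * (\<integral>\<^sup>+x. f x \<partial>lborel)"
proof -
  have "(\<integral>\<^sup>+x. f x \<partial>lborel) = ennreal (c ^ DIM('a)) * (\<integral>\<^sup>+x. f (t + c *\<^sub>R x) \<partial>lborel)"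
    by (subst lborel_affine_density[OF c, of t])
       (simp add: nn_integral_density nn_integral_distr nn_integral_cmult)
  then show ?thesis using c
    by (simp add: mult.assoc[symmetric] flip: ennreal_mult')
qed

lemma
  fixes t :: "'a::euclidean_space" and c :: real and f :: "'a \<Rightarrow> real"
  assumes c: "c > 0" and [measurable]: "f \<in> borel_measurable borel"
  shows integral_lborel_affine: "(LINT x|lborel. f (t + c *\<^sub>R x)) = (LINT x|lborel. f x) / c ^ DIM('a)"
    and integrable_lborel_affine: "integrable lborel (\<lambda>x. f (t + c *\<^sub>R x)) \<longleftrightarrow> integrable lborel f"
proof -
  have "(LINT x|lborel. f x) = c ^ DIM('a) * (LINT x|lborel. f (t + c *\<^sub>R x))"
    by (subst lborel_affine_density[OF c, of t])
       (use c in \<open>simp add: integral_density integral_distr\<close>)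
  then show "(LINT x|lborel. f (t + c *\<^sub>R x)) = (LINT x|lborel. f x) / c ^ DIM('a)"
    using c by simp
  have "integrable lborel f \<longleftrightarrow> integrable lborel (\<lambda>x. c ^ DIM('a) * f (t + c *\<^sub>R x))"
    by (subst lborel_affine_density[OF c, of t])
       (use c in \<open>simp add: integrable_density integrable_distr_eq\<close>)
  then show "integrable lborel (\<lambda>x. f (t + c *\<^sub>R x)) \<longleftrightarrow> integrable lborel f"
    using c by simp
qed

lemma integrable_continuous_bounded_support:
  fixes f :: "'a::euclidean_space \<Rightarrow> real"
  assumes "continuous_on UNIV f" "\<And>x. norm x > R \<Longrightarrow> f x = 0"
  shows "integrable lborel f"
proof -
  have "integrable lborel (\<lambda>x. indicator (cball 0 R) x *\<^sub>R f x)"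
    by (rule borel_integrable_compact) (auto intro: continuous_on_subset[OF assms(1)])
  also have "(\<lambda>x. indicator (cball 0 R) x *\<^sub>R f x) = f"
    using assms(2) by (auto simp: indicator_def fun_eq_iff not_le)
  finally show ?thesis .
qed

section \<open>Partial derivatives, smoothness and the symmetry of mixed derivatives\<close>

text \<open>A derivative in one real variable along every coordinate line. In this form the rules
  for real derivatives, the mean value theorem and the fundamental theorem of calculus apply
  directly; for differentiable functions it agrees with \<open>partial\<close>.\<close>

definition has_partial :: "'n::finite \<Rightarrow> (real ^ 'n \<Rightarrow> real) \<Rightarrow> (real ^ 'n \<Rightarrow> real) \<Rightarrow> bool" where
  "has_partial i f f' \<longleftrightarrow>
     (\<forall>x. ((\<lambda>t. f (x + t *\<^sub>R axis i 1)) has_real_derivative f' x) (at 0))"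

lemma has_partial_line:
  assumes "has_partial i f f'"
  shows "((\<lambda>t. f (x + t *\<^sub>R axis i 1)) has_real_derivative f' (x + t *\<^sub>R axis i 1)) (at t)"
proof -
  have "((\<lambda>s. f (x + t *\<^sub>R axis i 1 + s *\<^sub>R axis i 1)) has_real_derivative f' (x + t *\<^sub>R axis i 1)) (at 0)"
    using assms by (auto simp: has_partial_def)
  moreover have "(\<lambda>s. f (x + t *\<^sub>R axis i 1 + s *\<^sub>R axis i 1)) = (\<lambda>s. f (x + (t + s) *\<^sub>R axis i 1))"
    by (simp add: algebra_simps)
  ultimately show ?thesis
    using DERIV_shift[of "\<lambda>t. f (x + t *\<^sub>R axis i 1)" _ 0 t] by (simp add: add.commute)
qed

lemma has_partial_unique: "has_partial i f f' \<Longrightarrow> has_partial i f f'' \<Longrightarrow> f' = f''"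
  using DERIV_unique by (fastforce simp: has_partial_def)

lemma has_partial_partial:
  assumes "\<And>x. f differentiable (at x)"
  shows "has_partial i f (partial i f)"
  unfolding has_partial_def
proof
  fix x
  have "(f has_derivative frechet_derivative f (at x)) (at (x + 0 *\<^sub>R axis i 1))"
    using assms frechet_derivative_works by auto
  then have "((\<lambda>t. f (x + t *\<^sub>R axis i 1)) has_derivative
      (\<lambda>t. frechet_derivative f (at x) (t *\<^sub>R axis i 1))) (at 0)"
    by (rule has_derivative_compose[rotated]) (auto intro!: derivative_eq_intros)
  moreover have "frechet_derivative f (at x) (t *\<^sub>R axis i 1) = partial i f x * t" for t
    using linear_scale[OF linear_frechet_derivative[OF assms]] by (simp add: partial_def mult.commute)
  ultimately show "((\<lambda>t. f (x + t *\<^sub>R axis i 1)) has_real_derivative partial i f x) (at 0)"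
    by (simp add: has_field_derivative_def)
qed

lemma partial_eqI:
  assumes "\<And>x. f differentiable (at x)" "has_partial i f f'"
  shows "partial i f = f'"
  using has_partial_partial[OF assms(1)] assms(2) has_partial_unique by blast

lemma partials_append: "partials (is @ js) f = partials is (partials js f)"
  by (induction "is") auto

lemma smooth_differentiable: "smooth f \<Longrightarrow> f differentiable (at x)"
  unfolding smooth_def by (metis partials.simps(1))

lemma smooth_partials: "smooth f \<Longrightarrow> smooth (partials is f)"
  unfolding smooth_def by (simp flip: partials_append)

lemma smooth_partial: "smooth f \<Longrightarrow> smooth (partial i f)"
  using smooth_partials[of f "[i]"] by simp

lemma smooth_continuous_on: "smooth f \<Longrightarrow> continuous_on S f"
  by (meson continuous_at_imp_continuous_on differentiable_imp_continuous_within smooth_differentiable)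

lemma smooth_measurable: "smooth f \<Longrightarrow> f \<in> borel_measurable borel"
  by (intro borel_measurable_continuous_onI smooth_continuous_on)

lemma smooth_has_partial: "smooth f \<Longrightarrow> has_partial i f (partial i f)"
  by (intro has_partial_partial smooth_differentiable)

text \<open>An invariant class of differentiable functions contains all iterated partial derivatives
  of its members. Smoothness proofs thereby reduce to one differentiation and need no formula for
  iterated derivatives.\<close>

lemma smooth_coinduct:
  assumes "P f" "\<And>f. P f \<Longrightarrow> (\<forall>x. f differentiable (at x)) \<and> (\<forall>i. P (partial i f))"
  shows "smooth f"
proof -
  have "P (partials is f)" for "is" by (induction "is") (use assms in auto)
  then show ?thesis using assms(2) by (auto simp: smooth_def)
qed

lemma partial_lincomb:
  assumes "\<And>x. f differentiable (at x)" "\<And>x. g differentiable (at x)"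
  shows "partial i (\<lambda>x. a * f x + b * g x) = (\<lambda>x. a * partial i f x + b * partial i g x)"
proof (rule partial_eqI)
  show "(\<lambda>x. a * f x + b * g x) differentiable (at x)" for x using assms by (intro derivative_intros)
  show "has_partial i (\<lambda>x. a * f x + b * g x) (\<lambda>x. a * partial i f x + b * partial i g x)"
    using assms[THEN has_partial_partial, of i] unfolding has_partial_def
    by (auto intro!: derivative_eq_intros)
qed

lemma smooth_lincomb:
  assumes "smooth f" "smooth g"
  shows "smooth (\<lambda>x. a * f x + b * g x)"
proof -
  have "\<exists>f' g'. (\<lambda>x. a * f x + b * g x) = (\<lambda>x. a * f' x + b * g' x) \<and> smooth f' \<and> smooth g'"
    using assms by blast
  then show ?thesis
  proof (rule smooth_coinduct[where P="\<lambda>h. \<exists>f' g'. h = (\<lambda>x. a * f' x + b * g' x) \<and> smooth f' \<and> smooth g'"], elim exE conjE, intro conjI allI)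
    fix h f' g' x assume h: "h = (\<lambda>x. a * f' x + b * g' x)" "smooth f'" "smooth g'"
    show "h differentiable (at x)"
      unfolding h(1) by (intro derivative_intros smooth_differentiable h)
    fix i
    show "\<exists>f' g'. partial i h = (\<lambda>x. a * f' x + b * g' x) \<and> smooth f' \<and> smooth g'"
      unfolding h(1) using h by (subst partial_lincomb) (auto intro: smooth_differentiable smooth_partial)
  qed
qed

lemma partials_lincomb:
  assumes "smooth f" "smooth g"
  shows "partials is (\<lambda>x. a * f x + b * g x) = (\<lambda>x. a * partials is f x + b * partials is g x)"
  using assms
  by (induction "is") (auto intro!: partial_lincomb smooth_differentiable smooth_partials)

text \<open>The mixed second difference of f over a square of side h is symmetric in i and j. Two
  uses of the mean value theorem turn it into h^2 times a mixed derivative at a point near x, in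
  either order of differentiation; the continuity of both mixed derivatives allows h to tend to
  0.\<close>

lemma partial_partial_commute:
  fixes f :: "real ^ 'n::finite \<Rightarrow> real"
  assumes "smooth f"
  shows "partial i (partial j f) = partial j (partial i f)"
proof
  fix x
  have quot: "\<exists>s t. 0 < s \<and> s < h \<and> 0 < t \<and> t < h \<and>
      f (x + h *\<^sub>R axis i 1 + h *\<^sub>R axis j 1) - f (x + h *\<^sub>R axis i 1) - f (x + h *\<^sub>R axis j 1) + f x
      = h * (h * partial j (partial i f) (x + s *\<^sub>R axis i 1 + t *\<^sub>R axis j 1))" if h: "h > 0" for h i j
  proof -
    let ?\<phi> = "\<lambda>s. f (x + h *\<^sub>R axis j 1 + s *\<^sub>R axis i 1) - f (x + s *\<^sub>R axis i 1)"
    have "DERIV ?\<phi> s :> partial i f (x + h *\<^sub>R axis j 1 + s *\<^sub>R axis i 1) - partial i f (x + s *\<^sub>R axis i 1)" for s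
      by (intro DERIV_diff has_partial_line smooth_has_partial assms)
    from MVT2[OF h this] obtain s where s: "0 < s" "s < h"
      "?\<phi> h - ?\<phi> 0 = h * (partial i f (x + h *\<^sub>R axis j 1 + s *\<^sub>R axis i 1) - partial i f (x + s *\<^sub>R axis i 1))"
      by auto
    have "DERIV (\<lambda>t. partial i f (x + s *\<^sub>R axis i 1 + t *\<^sub>R axis j 1)) t
        :> partial j (partial i f) (x + s *\<^sub>R axis i 1 + t *\<^sub>R axis j 1)" for t
      by (intro has_partial_line smooth_has_partial smooth_partial assms)
    from MVT2[OF h this] obtain t where t: "0 < t" "t < h"
      "partial i f (x + s *\<^sub>R axis i 1 + h *\<^sub>R axis j 1) - partial i f (x + s *\<^sub>R axis i 1)
        = h * partial j (partial i f) (x + s *\<^sub>R axis i 1 + t *\<^sub>R axis j 1)"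
      by auto
    show ?thesis using s t by (intro exI[of _ s] exI[of _ t]) (simp add: add_ac)
  qed
  have *: "\<exists>s t s' t'. 0 < s \<and> s < h \<and> 0 < t \<and> t < h \<and> 0 < s' \<and> s' < h \<and> 0 < t' \<and> t' < h \<and>
      partial j (partial i f) (x + s *\<^sub>R axis i 1 + t *\<^sub>R axis j 1)
      = partial i (partial j f) (x + s' *\<^sub>R axis j 1 + t' *\<^sub>R axis i 1)" if h: "h > 0" for h
  proof -
    obtain s t where st: "0 < s" "s < h" "0 < t" "t < h"
      "f (x + h *\<^sub>R axis i 1 + h *\<^sub>R axis j 1) - f (x + h *\<^sub>R axis i 1) - f (x + h *\<^sub>R axis j 1) + f x
      = h * (h * partial j (partial i f) (x + s *\<^sub>R axis i 1 + t *\<^sub>R axis j 1))"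
      using quot[OF h, of i j] by blast
    obtain s' t' where st': "0 < s'" "s' < h" "0 < t'" "t' < h"
      "f (x + h *\<^sub>R axis j 1 + h *\<^sub>R axis i 1) - f (x + h *\<^sub>R axis j 1) - f (x + h *\<^sub>R axis i 1) + f x
      = h * (h * partial i (partial j f) (x + s' *\<^sub>R axis j 1 + t' *\<^sub>R axis i 1))"
      using quot[OF h, of j i] by blast
    have "h * (h * partial j (partial i f) (x + s *\<^sub>R axis i 1 + t *\<^sub>R axis j 1))
        = h * (h * partial i (partial j f) (x + s' *\<^sub>R axis j 1 + t' *\<^sub>R axis i 1))"
      unfolding st(5)[symmetric] st'(5)[symmetric] by (simp add: add_ac)
    then show ?thesis using h st st' by auto
  qed
  define h where "h n = 1 / real (Suc n)" for n
  have "\<forall>n. \<exists>s t s' t'. 0 < s \<and> s < h n \<and> 0 < t \<and> t < h n \<and> 0 < s' \<and> s' < h n \<and> 0 < t' \<and> t' < h n \<and>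
      partial j (partial i f) (x + s *\<^sub>R axis i 1 + t *\<^sub>R axis j 1)
      = partial i (partial j f) (x + s' *\<^sub>R axis j 1 + t' *\<^sub>R axis i 1)"
    using * by (simp add: h_def)
  then obtain s t s' t' where st: "\<And>n. 0 < s n \<and> s n < h n \<and> 0 < t n \<and> t n < h n \<and> 0 < s' n \<and> s' n < h n
      \<and> 0 < t' n \<and> t' n < h n \<and> partial j (partial i f) (x + s n *\<^sub>R axis i 1 + t n *\<^sub>R axis j 1)
      = partial i (partial j f) (x + s' n *\<^sub>R axis j 1 + t' n *\<^sub>R axis i 1)"
    by metis
  have st_bd: "0 < s n" "s n < h n" "0 < t n" "t n < h n" "0 < s' n" "s' n < h n" "0 < t' n" "t' n < h n" for n
    using st by blast+
  have st_eq: "partial j (partial i f) (x + s n *\<^sub>R axis i 1 + t n *\<^sub>R axis j 1)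
      = partial i (partial j f) (x + s' n *\<^sub>R axis j 1 + t' n *\<^sub>R axis i 1)" for n
    using st by blast
  have h0: "h \<longlonglongrightarrow> 0" using LIMSEQ_inverse_real_of_nat by (simp add: h_def[abs_def] inverse_eq_divide)
  have lim: "(\<lambda>n. g (x + a n *\<^sub>R axis k 1 + b n *\<^sub>R axis l 1)) \<longlonglongrightarrow> g x"
    if "smooth g" "\<And>n. 0 < a n \<and> a n < h n" "\<And>n. 0 < b n \<and> b n < h n" for g :: "real ^ 'n \<Rightarrow> real" and a b k l
  proof -
    have "a \<longlonglongrightarrow> 0" "b \<longlonglongrightarrow> 0"
      using that by (auto intro!: tendsto_sandwich[OF _ _ tendsto_const h0] always_eventually less_imp_le)
    then have "(\<lambda>n. x + a n *\<^sub>R axis k 1 + b n *\<^sub>R axis l 1) \<longlonglongrightarrow> x + 0 *\<^sub>R axis k 1 + 0 *\<^sub>R axis l 1"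
      by (intro tendsto_intros)
    moreover have "isCont g x"
      using smooth_continuous_on[OF that(1), of UNIV] by (simp add: continuous_on_eq_continuous_at)
    ultimately show ?thesis using isCont_tendsto_compose[of x g] by simp
  qed
  have "(\<lambda>n. partial j (partial i f) (x + s n *\<^sub>R axis i 1 + t n *\<^sub>R axis j 1)) \<longlonglongrightarrow> partial j (partial i f) x"
    by (rule lim) (simp_all add: smooth_partial assms st_bd)
  moreover have "(\<lambda>n. partial i (partial j f) (x + s' n *\<^sub>R axis j 1 + t' n *\<^sub>R axis i 1)) \<longlonglongrightarrow> partial i (partial j f) x"
    by (rule lim) (simp_all add: smooth_partial assms st_bd)
  ultimately show "partial i (partial j f) x = partial j (partial i f) x"
    unfolding st_eq[symmetric] using LIMSEQ_unique by blast
qed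

text \<open>The head of \<open>is\<close> occurs somewhere in \<open>js\<close> and is moved to the
  front by commuting it past its predecessors; the tails then have equal multisets.\<close>

lemma partials_mset_cong:
  assumes "smooth f" "mset is = mset js"
  shows "partials is f = partials js f"
  using assms(2)
proof (induction "is" arbitrary: js)
  case (Cons i "is")
  have move: "partials (as @ i # bs) f = partials (i # as @ bs) f" for as bs
  proof (induction as)
    case (Cons a as)
    then show ?case
      by (simp add: partial_partial_commute smooth_partials assms)
  qed simp
  have "i \<in> set js" using Cons.prems by (metis list.set_intros(1) set_mset_mset)
  then obtain as bs where js: "js = as @ i # bs" by (meson split_list)
  then have "mset is = mset (as @ bs)" using Cons.prems by simp
  then have "partials is f = partials (as @ bs) f" by (rule Cons.IH)
  then show ?case using move js by simp
qed simp

section \<open>Multi-indices\<close>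

text \<open>Names the choice hidden in \<open>mi_partial\<close>. Through it a derivative of
  multi-index order becomes an iterated partial derivative whose list has a known multiset.\<close>

definition mi_list :: "('n::finite \<Rightarrow> nat) \<Rightarrow> 'n list" where
  "mi_list \<alpha> = (SOME is. \<forall>i. count_list is i = \<alpha> i)"

lemma count_mi_list: "count (mset (mi_list \<alpha>)) i = \<alpha> i"
proof -
  obtain xs where "mset xs = Abs_multiset \<alpha>" using ex_mset by blast
  then have "\<forall>i. count_list xs i = \<alpha> i"
    by (metis Abs_multiset_inverse count_mset finite mem_Collect_eq)
  then have "\<forall>i. count_list (mi_list \<alpha>) i = \<alpha> i" unfolding mi_list_def by (rule someI)
  then show ?thesis by (simp add: count_mset)
qed

lemma mi_partial_eq: "mi_partial \<alpha> f = partials (mi_list \<alpha>) f"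
  by (simp add: mi_partial_def mi_list_def)

lemma length_mi_list: "length (mi_list \<alpha>) = mi_order \<alpha>"
proof -
  have "size (mset (mi_list \<alpha>)) = (\<Sum>i\<in>UNIV. count (mset (mi_list \<alpha>)) i)"
    by (simp add: size_multiset_overloaded_eq) (intro sum.mono_neutral_left, auto simp: not_in_iff simp flip: count_mset)
  then show ?thesis by (simp add: count_mi_list mi_order_def)
qed

lemma partial_mi_partial:
  assumes "smooth f"
  shows "partial i (mi_partial \<alpha> f) = mi_partial (\<alpha>(i := Suc (\<alpha> i))) f"
proof -
  have "partials (i # mi_list \<alpha>) f = partials (mi_list (\<alpha>(i := Suc (\<alpha> i)))) f"
    by (rule partials_mset_cong[OF assms], rule multiset_eqI) (simp add: count_mi_list)
  then show ?thesis by (simp add: mi_partial_eq)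
qed

lemma mi_order_upd_Suc: "mi_order (\<alpha>(i := Suc (\<alpha> i))) = Suc (mi_order \<alpha>)"
  by (simp add: mi_order_def sum.remove[of UNIV i])

lemma finite_mi_order: "finite {\<alpha> :: 'n::finite \<Rightarrow> nat. mi_order \<alpha> = k}"
proof (rule finite_subset)
  show "{\<alpha> :: 'n \<Rightarrow> nat. mi_order \<alpha> = k} \<subseteq> PiE UNIV (\<lambda>_. {..k})"
    using member_le_sum[of _ "UNIV :: 'n set"] by (fastforce simp: mi_order_def)
  show "finite (PiE (UNIV :: 'n set) (\<lambda>_. {..k}))" by (intro finite_PiE) auto
qed

section \<open>Compact support and integration by parts\<close>

lemma test_functions_iff:
  "f \<in> test_functions \<longleftrightarrow> smooth f \<and> (\<exists>R. \<forall>x. norm x > R \<longrightarrow> f x = 0)"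
proof -
  have "compact (closure (support_on UNIV f)) \<longleftrightarrow> bounded (support_on UNIV f)" by simp
  also have "\<dots> \<longleftrightarrow> (\<exists>R. \<forall>x. norm x > R \<longrightarrow> f x = 0)"
    unfolding bounded_iff support_on_def by (auto simp: not_le[symmetric])
  finally show ?thesis by (simp add: test_functions_def)
qed

lemma partial_support:
  assumes "smooth f" "\<And>x. norm x > R \<Longrightarrow> f x = 0" "norm x > R"
  shows "partial i f x = 0"
proof -
  have "eventually (\<lambda>t. norm (x + t *\<^sub>R axis i (1::real)) > R) (nhds 0)"
  proof (rule order_tendstoD)
    have "isCont (\<lambda>t. norm (x + t *\<^sub>R axis i (1::real))) 0" by (intro continuous_intros)
    then show "((\<lambda>t. norm (x + t *\<^sub>R axis i (1::real))) \<longlongrightarrow> norm x) (nhds 0)"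
      by (simp add: tendsto_nhds_iff isCont_def)
  qed (use assms in auto)
  then have "eventually (\<lambda>t. f (x + t *\<^sub>R axis i 1) = 0) (nhds 0)"
    by eventually_elim (use assms in auto)
  then have "((\<lambda>t. f (x + t *\<^sub>R axis i 1)) has_real_derivative 0) (at 0)"
    by (subst DERIV_cong_ev[OF refl _ refl, of _ "\<lambda>_. 0"]) auto
  then show ?thesis
    using smooth_has_partial[OF assms(1), of i] DERIV_unique unfolding has_partial_def by blast
qed

lemma test_functions_partial: "f \<in> test_functions \<Longrightarrow> partial i f \<in> test_functions"
  unfolding test_functions_iff using partial_support smooth_partial by metis

lemma test_functions_partials: "f \<in> test_functions \<Longrightarrow> partials is f \<in> test_functions"
  by (induction "is") (auto intro: test_functions_partial)

lemma test_functions_mi_partial: "f \<in> test_functions \<Longrightarrow> mi_partial \<alpha> f \<in> test_functions"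
  by (simp add: mi_partial_eq test_functions_partials)

lemma test_functions_lincomb:
  assumes "f \<in> test_functions" "g \<in> test_functions"
  shows "(\<lambda>x. a * f x + b * g x) \<in> test_functions"
proof -
  obtain R R' where "\<forall>x. norm x > R \<longrightarrow> f x = 0" "\<forall>x. norm x > R' \<longrightarrow> g x = 0"
    using assms by (auto simp: test_functions_iff)
  then have "\<forall>x. norm x > max R R' \<longrightarrow> a * f x + b * g x = 0" by auto
  then show ?thesis using assms smooth_lincomb unfolding test_functions_iff by blast
qed

lemma test_functions_smooth: "f \<in> test_functions \<Longrightarrow> smooth f"
  by (simp add: test_functions_iff)

lemma test_functions_bounded:
  assumes "f \<in> test_functions"
  obtains B where "B \<ge> 0" "\<And>x. \<bar>f x\<bar> \<le> B"
proof -
  obtain R where R: "\<And>x. norm x > R \<Longrightarrow> f x = 0" using assms by (auto simp: test_functions_iff)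
  have "bounded (f ` cball 0 R)"
    by (intro compact_imp_bounded compact_continuous_image smooth_continuous_on test_functions_smooth assms) simp
  then obtain B where B: "\<And>x. x \<in> cball 0 R \<Longrightarrow> \<bar>f x\<bar> \<le> B"
    unfolding bounded_iff by (metis image_eqI real_norm_def)
  then have "\<bar>f x\<bar> \<le> max B 0" for x using R[of x] B[of x] by (cases "norm x > R") (auto simp: not_less le_max_iff_disj)
  then show ?thesis using that[of "max B 0"] by auto
qed

text \<open>Translation invariance gives every difference quotient in direction i the integral 0,
  and dominated convergence passes to the derivative. The mean value theorem bounds the quotients by
  a bound of g'.\<close>

lemma integral_partial_eq_0:
  fixes g g' :: "real ^ 'n::finite \<Rightarrow> real"
  assumes g: "has_partial i g g'" "continuous_on UNIV g" "continuous_on UNIV g'"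
    and supp: "\<And>x. norm x > R \<Longrightarrow> g x = 0" "\<And>x. norm x > R \<Longrightarrow> g' x = 0"
  shows "(LINT x|lborel. g' x) = 0"
proof -
  let ?e = "axis i 1 :: real ^ 'n"
  define h where "h n = 1 / real (Suc n)" for n
  have h: "h n > 0" "h n \<le> 1" for n by (auto simp: h_def)
  have h0: "h \<longlonglongrightarrow> 0" using LIMSEQ_inverse_real_of_nat by (simp add: h_def[abs_def] inverse_eq_divide)
  have [measurable]: "g \<in> borel_measurable borel" "g' \<in> borel_measurable borel"
    using g by (auto intro: borel_measurable_continuous_onI)
  have "bounded (g' ` cball 0 R)"
    by (intro compact_imp_bounded compact_continuous_image continuous_on_subset[OF g(3)]) auto
  then obtain B0 where B0: "\<And>x. x \<in> cball 0 R \<Longrightarrow> \<bar>g' x\<bar> \<le> B0"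
    unfolding bounded_iff by (metis image_eqI real_norm_def)
  define B where "B = max B0 0"
  have B: "\<bar>g' x\<bar> \<le> B" for x using B0[of x] supp(2)[of x] by (cases "norm x > R") (force simp: B_def)+
  \<comment> \<open>The radius grows by 1 because the steps \<open>h n\<close> are at most
    1.\<close>
  have quot: "\<bar>(g (x + h n *\<^sub>R ?e) - g x) / h n\<bar> \<le> indicator (cball 0 (R + 1)) x * B" for n x
  proof (cases "norm x \<le> R + 1")
    case True
    obtain z where "g (x + h n *\<^sub>R ?e) - g (x + 0 *\<^sub>R ?e) = (h n - 0) * g' (x + z *\<^sub>R ?e)"
      using MVT2[OF h(1) has_partial_line[OF g(1)], of n x] by auto
    then have "(g (x + h n *\<^sub>R ?e) - g x) / h n = g' (x + z *\<^sub>R ?e)" using h(1)[of n] by (simp add: field_simps)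
    then show ?thesis using B True by simp
  next
    case False
    have "norm x \<le> norm (x + h n *\<^sub>R ?e) + norm (h n *\<^sub>R ?e)"
      by (metis add_diff_cancel_right' norm_triangle_ineq4)
    then have "norm (x + h n *\<^sub>R ?e) > R" using False h[of n] by simp
    then show ?thesis using supp(1) False by simp
  qed
  have "(\<lambda>n. LINT x|lborel. (g (x + h n *\<^sub>R ?e) - g x) / h n) \<longlonglongrightarrow> (LINT x|lborel. g' x)"
  proof (rule integral_dominated_convergence)
    show "integrable lborel (\<lambda>x::real^'n. indicator (cball 0 (R + 1)) x * B)"
      by (intro integrable_mult_left integrable_real_indicator) (simp_all add: emeasure_lborel_cball_finite flip: infinity_ennreal_def)
    show "AE x in lborel. (\<lambda>n. (g (x + h n *\<^sub>R ?e) - g x) / h n) \<longlonglongrightarrow> g' x"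
    proof (intro AE_I2)
      fix x
      have "((\<lambda>t. (g (x + t *\<^sub>R ?e) - g x) / t) \<longlongrightarrow> g' x) (at 0)"
        using g(1) by (auto simp: has_partial_def DERIV_def)
      moreover have "filterlim h (at 0) sequentially"
        using h0 h(1) by (auto simp: filterlim_at intro!: always_eventually less_imp_neq[symmetric])
      ultimately show "(\<lambda>n. (g (x + h n *\<^sub>R ?e) - g x) / h n) \<longlonglongrightarrow> g' x"
        by (rule filterlim_compose)
    qed
  qed (use quot in auto)
  moreover have "(LINT x|lborel. (g (x + h n *\<^sub>R ?e) - g x) / h n) = 0" for n
  proof -
    have int: "integrable lborel g" using g(2) supp(1) by (rule integrable_continuous_bounded_support)
    have "integrable lborel (\<lambda>x. g (x + h n *\<^sub>R ?e))" "(LINT x|lborel. g (x + h n *\<^sub>R ?e)) = (LINT x|lborel. g x)"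
      using integrable_lborel_affine[of 1 g "h n *\<^sub>R ?e"] integral_lborel_affine[of 1 g "h n *\<^sub>R ?e"] int
      by (auto simp: add.commute)
    then show ?thesis using int by simp
  qed
  ultimately show ?thesis by (simp only: LIMSEQ_const_iff)
qed

lemma integral_by_parts_partial:
  assumes f: "smooth f" and g: "g \<in> test_functions"
  shows "(LINT x|lborel. f x * partial i g x) = - (LINT x|lborel. partial i f x * g x)"
proof -
  obtain R where R: "\<And>x. norm x > R \<Longrightarrow> g x = 0" using g by (auto simp: test_functions_iff)
  have gs: "smooth g" using g by (rule test_functions_smooth)
  have R': "\<And>x. norm x > R \<Longrightarrow> partial i g x = 0" using partial_support[OF gs R] by simp
  have cont: "continuous_on UNIV f" "continuous_on UNIV g" "continuous_on UNIV (partial i f)" "continuous_on UNIV (partial i g)"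
    using f gs by (auto intro: smooth_continuous_on smooth_partial)
  have "has_partial i (\<lambda>x. f x * g x) (\<lambda>x. f x * partial i g x + partial i f x * g x)"
    using smooth_has_partial[OF f, of i] smooth_has_partial[OF gs, of i] unfolding has_partial_def
    by (auto intro!: derivative_eq_intros)
  then have "(LINT x|lborel. f x * partial i g x + partial i f x * g x) = 0"
    by (rule integral_partial_eq_0[where R=R]) (auto intro!: continuous_intros cont simp: R R')
  moreover have "integrable lborel (\<lambda>x. f x * partial i g x)" "integrable lborel (\<lambda>x. partial i f x * g x)"
    by (rule integrable_continuous_bounded_support[where R=R]; auto intro!: continuous_intros cont simp: R R')+
  ultimately show ?thesis by simp
qed

text \<open>The outermost derivative of g is moved first and becomes the innermost one on f, which
  reverses the list. For smooth f the order of the list is irrelevant, so the reversal disappears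
  for multi-indices.\<close>

lemma integral_by_parts_partials:
  assumes f: "smooth f" and g: "g \<in> test_functions"
  shows "(LINT x|lborel. f x * partials is g x) = (-1) ^ length is * (LINT x|lborel. partials (rev is) f x * g x)"
  using f
proof (induction "is" arbitrary: f)
  case (Cons i "is")
  have "(LINT x|lborel. f x * partials (i # is) g x) = - (LINT x|lborel. partial i f x * partials is g x)"
    using integral_by_parts_partial[OF Cons.prems test_functions_partials[OF g]] by simp
  also have "\<dots> = - ((-1) ^ length is * (LINT x|lborel. partials (rev is) (partial i f) x * g x))"
    using Cons.IH[OF smooth_partial[OF Cons.prems]] by simp
  finally show ?case by (simp add: partials_append)
qed simp

lemma integral_by_parts_mi_partial:
  assumes f: "smooth f" and g: "g \<in> test_functions"
  shows "(LINT x|lborel. f x * mi_partial \<alpha> g x) = (-1) ^ mi_order \<alpha> * (LINT x|lborel. mi_partial \<alpha> f x * g x)"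
  using integral_by_parts_partials[OF assms, of "mi_list \<alpha>"] partials_mset_cong[OF f, of "mi_list \<alpha>" "rev (mi_list \<alpha>)"]
  by (simp add: mi_partial_eq length_mi_list)

section \<open>The Gagliardo-Nirenberg-Sobolev inequality\<close>

text \<open>The q-th power of the norm in L^q. Working with it avoids roots: pointwise inequalities
  integrate directly, and crude inequalities with constants such as 2^q take the place of
  Minkowski's inequality.\<close>

definition Lp_mass :: "real \<Rightarrow> (real ^ 'n \<Rightarrow> real) \<Rightarrow> ennreal" where
  "Lp_mass q f = (\<integral>\<^sup>+x. ennreal (\<bar>f x\<bar> powr q) \<partial>lborel)"

lemma continuous_abs_powr_sgn:
  fixes a :: real
  assumes "a > 0"
  shows "continuous_on UNIV (\<lambda>s::real. \<bar>s\<bar> powr a * sgn s)"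
proof -
  have "continuous_on UNIV (\<lambda>s::real. (max s 0) powr a - (max (-s) 0) powr a)"
    using assms by (intro continuous_intros continuous_on_powr') auto
  also have "(\<lambda>s::real. (max s 0) powr a - (max (-s) 0) powr a) = (\<lambda>s. \<bar>s\<bar> powr a * sgn s)"
    using assms by (auto simp: fun_eq_iff sgn_if max_def)
  finally show ?thesis .
qed

text \<open>At s = 0 the difference quotient equals |h|^(a - 1) sgn h, which tends to 0 because a >
  1. Thus |f|^a is differentiable along lines even across the zeros of f.\<close>

lemma has_real_derivative_abs_powr:
  fixes a s :: real
  assumes "a > 1"
  shows "((\<lambda>s. \<bar>s\<bar> powr a) has_real_derivative a * (\<bar>s\<bar> powr (a - 1) * sgn s)) (at s)"
proof (cases s "0::real" rule: linorder_cases)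
  case greater
  have "((\<lambda>s. s powr a) has_real_derivative a * s powr (a - 1)) (at s)"
    using greater by (auto intro!: derivative_eq_intros)
  moreover have "eventually (\<lambda>s. s powr a = \<bar>s\<bar> powr a) (nhds s)"
    using eventually_gt_at_top greater
    by (intro eventually_mono[OF order_tendstoD(1)[OF filterlim_ident greater]]) auto
  ultimately show ?thesis using greater
    by (subst DERIV_cong_ev[OF refl _ refl, of _ "\<lambda>s. s powr a"]) (auto elim: eventually_mono)
next
  case less
  have "((\<lambda>s. (- s) powr a) has_real_derivative - (a * (- s) powr (a - 1))) (at s)"
    using less by (auto intro!: derivative_eq_intros)
  moreover have "eventually (\<lambda>s. (- s) powr a = \<bar>s\<bar> powr a) (nhds s)"
    by (intro eventually_mono[OF order_tendstoD(2)[OF filterlim_ident less]]) auto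
  ultimately show ?thesis using less
    by (subst DERIV_cong_ev[OF refl _ refl, of _ "\<lambda>s. (- s) powr a"]) (auto elim: eventually_mono)
next
  case equal
  have "((\<lambda>h::real. \<bar>h\<bar> powr (a - 1) * sgn h) \<longlongrightarrow> \<bar>0\<bar> powr (a - 1) * sgn 0) (at 0)"
    using continuous_abs_powr_sgn[of "a - 1"] assms
    by (intro isContD) (simp add: continuous_on_eq_continuous_at)
  moreover have "(\<bar>0 + h\<bar> powr a - \<bar>0\<bar> powr a) / h = \<bar>h\<bar> powr (a - 1) * sgn h" for h :: real
    by (auto simp: powr_diff sgn_if field_simps)
  ultimately have "((\<lambda>h::real. (\<bar>0 + h\<bar> powr a - \<bar>0\<bar> powr a) / h) \<longlongrightarrow> 0) (at 0)"
    by simp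
  then show ?thesis using equal by (simp add: DERIV_def)
qed

text \<open>The fundamental theorem of calculus for |f|^a on the line through x, started at a point
  outside the support of f.\<close>

lemma abs_powr_le_line_integral:
  assumes f: "f \<in> test_functions" and a: "a > 1"
  shows "ennreal (\<bar>f x\<bar> powr a)
    \<le> (\<integral>\<^sup>+t. ennreal (a * \<bar>f (x + t *\<^sub>R axis i 1)\<bar> powr (a - 1) * \<bar>partial i f (x + t *\<^sub>R axis i 1)\<bar>) \<partial>lborel)"
proof -
  let ?h = "\<lambda>t. f (x + t *\<^sub>R axis i 1)" and ?h' = "\<lambda>t. partial i f (x + t *\<^sub>R axis i 1)"
  obtain R where R: "\<And>x. norm x > R \<Longrightarrow> f x = 0" using f by (auto simp: test_functions_iff)
  have fs: "smooth f" using f by (rule test_functions_smooth)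
  \<comment> \<open>Large enough for x - T e_i to have norm greater than R, so that f vanishes
    there.\<close>
  define T where "T = \<bar>R\<bar> + norm x + 1"
  have T: "T \<ge> 0" by (simp add: T_def add_nonneg_nonneg)
  have "norm (x + (-T) *\<^sub>R axis i 1) \<ge> norm ((-T) *\<^sub>R axis i (1::real)) - norm x"
    by (metis add.commute norm_diff_ineq)
  then have "norm (x + (-T) *\<^sub>R axis i 1) > R" using T by (simp add: T_def)
  then have hT: "?h (-T) = 0" using R by blast
  define H' where "H' t = a * (\<bar>?h t\<bar> powr (a - 1) * sgn (?h t)) * ?h' t" for t
  have der: "((\<lambda>t. \<bar>?h t\<bar> powr a) has_real_derivative H' t) (at t)" for t
    unfolding H'_def
    by (rule DERIV_chain2[OF has_real_derivative_abs_powr[OF a]])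
       (rule has_partial_line[OF smooth_has_partial[OF fs]])
  have conth: "continuous_on UNIV ?h" "continuous_on UNIV ?h'"
    by (rule continuous_on_compose2[OF smooth_continuous_on, of _ UNIV]; auto intro!: continuous_intros fs smooth_partial)+
  have contH: "continuous_on UNIV H'" unfolding H'_def
    by (intro continuous_intros conth continuous_on_compose2[OF continuous_abs_powr_sgn conth(1)]) (use a in auto)
  have "integral\<^sup>L lborel (\<lambda>t. indicator {-T..0} t *\<^sub>R H' t) = \<bar>?h 0\<bar> powr a - \<bar>?h (-T)\<bar> powr a"
    using T der continuous_on_subset[OF contH]
    by (intro integral_FTC_atLeastAtMost)
       (auto intro: DERIV_subset simp flip: has_real_derivative_iff_has_vector_derivative)
  then have eq: "integral\<^sup>L lborel (\<lambda>t. indicator {-T..0} t *\<^sub>R H' t) = \<bar>f x\<bar> powr a"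
    using hT by simp
  have "integrable lborel (\<lambda>t. indicator {-T..0} t *\<^sub>R H' t)"
    by (rule borel_integrable_compact) (auto intro: continuous_on_subset[OF contH])
  from integral_norm_bound_ennreal[OF this]
  have "ennreal (\<bar>f x\<bar> powr a) \<le> (\<integral>\<^sup>+t. ennreal (norm (indicator {-T..0} t *\<^sub>R H' t)) \<partial>lborel)"
    unfolding eq by simp
  also have "\<dots> \<le> (\<integral>\<^sup>+t. ennreal (a * \<bar>?h t\<bar> powr (a - 1) * \<bar>?h' t\<bar>) \<partial>lborel)"
    using a by (intro nn_integral_mono ennreal_leI)
      (auto simp: H'_def abs_mult indicator_def sgn_if)
  finally show ?thesis .
qed

text \<open>A form of Young's inequality with a free parameter c, proved by comparing b with c A: if
  b \<le> c A the first term dominates, otherwise A < b / c and the second one does. A small c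
  permits the absorption of the first term.\<close>

lemma powr_mult_le_add:
  fixes A b c r :: real
  assumes "A \<ge> 0" "b \<ge> 0" "c > 0" "r > 1"
  shows "A powr (r - 1) * b \<le> c * A powr r + c powr (1 - r) * b powr r"
proof (cases "b \<le> c * A")
  case True
  then have "A powr (r - 1) * b \<le> A powr (r - 1) * (c * A)" by (intro mult_left_mono) auto
  also have "\<dots> = c * A powr r" using assms by (cases "A = 0") (auto simp: powr_diff)
  finally show ?thesis by (simp add: add_increasing2)
next
  case False
  then have b: "b > 0" "A \<le> b / c" using assms by (auto simp: field_simps not_le intro: order_le_less_trans[of 0 "A*c"])
  have "A powr (r - 1) * b \<le> (b / c) powr (r - 1) * b"
    using assms b by (intro mult_right_mono powr_mono2) auto
  also have "\<dots> = c powr (1 - r) * b powr r" using assms b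
    by (simp add: powr_divide powr_diff field_simps)
  finally show ?thesis using assms by (simp add: add_increasing)
qed

lemma Lp_mass_cmult:
  assumes [measurable]: "f \<in> borel_measurable borel"
  shows "Lp_mass q (\<lambda>x. c * f x) = ennreal (\<bar>c\<bar> powr q) * Lp_mass q f"
  unfolding Lp_mass_def by (simp add: abs_mult powr_mult ennreal_mult nn_integral_cmult)

lemma Lp_mass_test_functions_finite:
  assumes f: "f \<in> test_functions" and q: "q > 0"
  shows "Lp_mass q f < \<infinity>"
proof -
  obtain R where R: "\<And>x. norm x > R \<Longrightarrow> f x = 0" using f by (auto simp: test_functions_iff)
  have "continuous_on UNIV f" by (rule smooth_continuous_on[OF test_functions_smooth[OF f]])
  then have "continuous_on UNIV (\<lambda>x. \<bar>f x\<bar> powr q)"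
    by (intro continuous_on_powr' continuous_on_rabs continuous_on_const) (use q in auto)
  then have "integrable lborel (\<lambda>x. \<bar>f x\<bar> powr q)"
    by (rule integrable_continuous_bounded_support[where R=R]) (simp add: R)
  then show ?thesis unfolding Lp_mass_def by (subst nn_integral_eq_integral) auto
qed

text \<open>For functions of unit mass, absorbing a small multiple of the mass replaces the use of
  Hoelder's inequality with a scale-dependent constant.\<close>

lemma gagliardo_nirenberg_normalised:
  fixes r :: real
  assumes r: "1 < r" "r < real CARD('n::finite)"
  obtains \<delta> where "\<delta> > 0" "\<And>f::real^'n \<Rightarrow> real. f \<in> test_functions \<Longrightarrow>
      Lp_mass (r * real CARD('n) / (real CARD('n) - r)) f = 1 \<Longrightarrow> \<exists>i. Lp_mass r (partial i f) > ennreal \<delta>"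
proof -
  define N where "N = real CARD('n)"
  define q where "q = r * N / (N - r)"
  \<comment> \<open>The exponent for which |f|^g has two properties: the product of N factors
    |f|^(g/(N-1)) is |f|^q, and |f|^(g-1) = (|f|^(q/r))^(r-1), so the inequality above splits the
    derivative of |f|^g into |f|^q and the r-th power of the partial derivative.\<close>
  define g where "g = r * (N - 1) / (N - r)"
  have N: "N > 1" "CARD('n) \<ge> 2" "r < N" using r by (auto simp: N_def)
  have g: "g > 1" using N r by (simp add: g_def field_simps)
  have "g / (N - 1) = r / (N - r)" using N by (simp add: g_def)
  moreover have "g - 1 = N * (r - 1) / (N - r)" using N by (simp add: g_def field_simps)
  ultimately have gq: "g / (N - 1) * N = q" "g - 1 = q / r * (r - 1)" "q > 0"
    using N r by (auto simp: q_def)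
  \<comment> \<open>The choices of c and \<delta> make each of the two terms in the bound for a line
    derivative equal to 1/4. Every factor in Gagliardo's inequality is then a power of 1/2, and 1
    \<le> (1/2)^(N/(N-1)) is the contradiction.\<close>
  define c where "c = 1 / (4 * g)"
  define \<delta> where "\<delta> = c powr (r - 1) / (4 * g)"
  have c: "c > 0" and \<delta>: "\<delta> > 0" using g by (auto simp: c_def \<delta>_def)
  have "\<exists>i. Lp_mass r (partial i f) > ennreal \<delta>"
    if f: "f \<in> test_functions" and X: "Lp_mass q f = 1" for f :: "real^'n \<Rightarrow> real"
  proof (rule ccontr)
    assume "\<not> ?thesis"
    then have Y: "Lp_mass r (partial i f) \<le> ennreal \<delta>" for i by (auto simp: not_less)
    have [measurable]: "f \<in> borel_measurable borel" "partial i f \<in> borel_measurable borel" for i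
      using f by (auto intro: smooth_measurable test_functions_smooth test_functions_partial)
    have half: "(\<integral>\<^sup>+x. ennreal (g * \<bar>f x\<bar> powr (g - 1) * \<bar>partial i f x\<bar>) \<partial>lborel) \<le> ennreal (1/2)" for i
    proof -
      have "(\<integral>\<^sup>+x. ennreal (g * \<bar>f x\<bar> powr (g - 1) * \<bar>partial i f x\<bar>) \<partial>lborel)
        \<le> (\<integral>\<^sup>+x. ennreal (g * c) * ennreal (\<bar>f x\<bar> powr q) + ennreal (g * c powr (1 - r)) * ennreal (\<bar>partial i f x\<bar> powr r) \<partial>lborel)"
      proof (rule nn_integral_mono)
        fix x
        have "g * \<bar>f x\<bar> powr (g - 1) * \<bar>partial i f x\<bar> = g * ((\<bar>f x\<bar> powr (q / r)) powr (r - 1) * \<bar>partial i f x\<bar>)"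
          by (simp add: powr_powr gq(2))
        also have "\<dots> \<le> g * (c * (\<bar>f x\<bar> powr (q / r)) powr r + c powr (1 - r) * \<bar>partial i f x\<bar> powr r)"
          using g c r by (intro mult_left_mono powr_mult_le_add) auto
        also have "\<dots> = g * c * \<bar>f x\<bar> powr q + g * c powr (1 - r) * \<bar>partial i f x\<bar> powr r"
          using r by (simp add: powr_powr algebra_simps)
        finally show "ennreal (g * \<bar>f x\<bar> powr (g - 1) * \<bar>partial i f x\<bar>)
          \<le> ennreal (g * c) * ennreal (\<bar>f x\<bar> powr q) + ennreal (g * c powr (1 - r)) * ennreal (\<bar>partial i f x\<bar> powr r)"
          using g c by (simp add: ennreal_leI flip: ennreal_mult ennreal_plus)
      qed
      also have "\<dots> = ennreal (g * c) * Lp_mass q f + ennreal (g * c powr (1 - r)) * Lp_mass r (partial i f)"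
        by (simp add: nn_integral_add nn_integral_cmult Lp_mass_def)
      also have "\<dots> \<le> ennreal (g * c) * 1 + ennreal (g * c powr (1 - r)) * ennreal \<delta>"
        unfolding X by (intro add_mono mult_left_mono Y) auto
      also have "\<dots> = ennreal (g * c + g * c powr (1 - r) * \<delta>)"
        using g c \<delta> by (simp flip: ennreal_mult ennreal_plus)
      also have "g * c + g * c powr (1 - r) * \<delta> = 1/2"
      proof -
        have "c powr (1 - r) * c powr (r - 1) = 1" using c by (simp flip: powr_add)
        then show ?thesis using g by (simp add: \<delta>_def) (simp add: c_def)
      qed
      finally show ?thesis .
    qed
    have "1 = Lp_mass q f" using X by simp
    also have "\<dots> \<le> (\<Prod>i\<in>UNIV. enn_powr (\<integral>\<^sup>+x. ennreal (g * \<bar>f x\<bar> powr (g - 1) * \<bar>partial i f x\<bar>) \<partial>lborel)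
        (1 / (real CARD('n) - 1)))"
      unfolding Lp_mass_def
    proof (rule gagliardo[OF N(2)])
      fix x
      have "ennreal (\<bar>f x\<bar> powr q) = ennreal (\<Prod>i\<in>(UNIV::'n set). \<bar>f x\<bar> powr (g / (N - 1)))"
        by (cases "f x = 0") (simp_all add: gq(1)[symmetric] N_def powr_power mult.commute)
      also have "\<dots> = (\<Prod>i\<in>(UNIV::'n set). enn_powr (ennreal (\<bar>f x\<bar> powr g)) (1 / (N - 1)))"
        by (subst prod_ennreal[symmetric]) (auto simp: powr_powr)
      also have "\<dots> \<le> (\<Prod>i\<in>UNIV. enn_powr (\<integral>\<^sup>+t. ennreal (g * \<bar>f (x + t *\<^sub>R axis i 1)\<bar> powr (g - 1)
          * \<bar>partial i f (x + t *\<^sub>R axis i 1)\<bar>) \<partial>lborel) (1 / (N - 1)))"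
        using N by (intro prod_mono_ennreal enn_powr_mono abs_powr_le_line_integral f g) auto
      finally show "ennreal (\<bar>f x\<bar> powr q) \<le> (\<Prod>i\<in>UNIV. enn_powr (\<integral>\<^sup>+t. ennreal (g * \<bar>f (x + t *\<^sub>R axis i 1)\<bar> powr (g - 1)
          * \<bar>partial i f (x + t *\<^sub>R axis i 1)\<bar>) \<partial>lborel) (1 / (real CARD('n) - 1)))"
        by (simp add: N_def)
    qed measurable
    also have "\<dots> \<le> (\<Prod>i\<in>(UNIV::'n set). enn_powr (ennreal (1/2)) (1 / (real CARD('n) - 1)))"
      using N by (intro prod_mono_ennreal enn_powr_mono half) auto
    also have "\<dots> = ennreal ((1/2) powr (N / (N - 1)))"
      by (simp add: ennreal_power powr_power N_def del: ennreal_half)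
    also have "\<dots> < ennreal 1"
      using N powr_less_mono2[of "N / (N - 1)" "1/2" 1] by (intro ennreal_lessI) auto
    finally show False by simp
  qed
  then show ?thesis using that \<delta> by (auto simp: q_def N_def)
qed

text \<open>Stated as continuity at 0 and not with a constant: in this form it can be iterated over
  the orders without tracking constants, and it shows that sequences are Cauchy. A function of mass
  X > \<epsilon> is multiplied by X^(-1/q) to reach unit mass; this multiplies the masses of its
  derivatives by X^(-r/q) \<le> \<epsilon>^(-r/q), whence the choice of \<delta>.\<close>

lemma gagliardo_nirenberg:
  fixes r \<epsilon> :: real
  assumes r: "1 < r" "r < real CARD('n::finite)" and "\<epsilon> > 0"
  obtains \<delta> where "\<delta> > 0" "\<And>f::real^'n \<Rightarrow> real. f \<in> test_functions \<Longrightarrow>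
      (\<And>i. Lp_mass r (partial i f) \<le> ennreal \<delta>) \<Longrightarrow>
      Lp_mass (r * real CARD('n) / (real CARD('n) - r)) f \<le> ennreal \<epsilon>"
proof -
  define q where "q = r * real CARD('n) / (real CARD('n) - r)"
  have q: "q > 0" using r by (simp add: q_def)
  obtain \<delta>0 where \<delta>0: "\<delta>0 > 0" "\<And>f::real^'n \<Rightarrow> real. f \<in> test_functions \<Longrightarrow>
      Lp_mass q f = 1 \<Longrightarrow> \<exists>i. Lp_mass r (partial i f) > ennreal \<delta>0"
    using gagliardo_nirenberg_normalised[OF r] unfolding q_def by blast
  have "Lp_mass q f \<le> ennreal \<epsilon>" if f: "f \<in> test_functions"
      and *: "\<And>i. Lp_mass r (partial i f) \<le> ennreal (\<delta>0 * \<epsilon> powr (r / q))" for f :: "real^'n \<Rightarrow> real"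
  proof (rule ccontr)
    assume "\<not> ?thesis"
    then obtain X where X: "Lp_mass q f = ennreal X" "X > \<epsilon>"
      using Lp_mass_test_functions_finite[OF f q] by (cases "Lp_mass q f") (auto simp: ennreal_le_iff2)
    have Xpos: "X > 0" using X assms by simp
    define c where "c = X powr (- 1 / q)"
    have c: "c > 0" using Xpos by (simp add: c_def)
    have cq: "c powr q = 1 / X" unfolding c_def powr_powr using q Xpos by (simp add: powr_minus_divide)
    have meas: "f \<in> borel_measurable borel" "partial i f \<in> borel_measurable borel" for i
      using f by (auto intro: smooth_measurable test_functions_smooth test_functions_partial)
    have "Lp_mass q (\<lambda>x. c * f x) = 1"
      using X Xpos q c by (simp add: Lp_mass_cmult meas cq flip: ennreal_mult)
    moreover have "(\<lambda>x. c * f x) \<in> test_functions" using test_functions_lincomb[OF f f, of c 0] by simp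
    ultimately obtain i where i: "Lp_mass r (partial i (\<lambda>x. c * f x)) > ennreal \<delta>0" using \<delta>0 by blast
    have "partial i (\<lambda>x. c * f x) = (\<lambda>x. c * partial i f x)"
      using partial_lincomb[of f f i c 0] smooth_differentiable[OF test_functions_smooth[OF f]] by simp
    then have "Lp_mass r (partial i (\<lambda>x. c * f x)) = ennreal (c powr r) * Lp_mass r (partial i f)"
      using c by (simp add: Lp_mass_cmult meas)
    also have "\<dots> \<le> ennreal (c powr r) * ennreal (\<delta>0 * \<epsilon> powr (r / q))"
      by (intro mult_left_mono *) simp
    also have "\<dots> = ennreal (\<delta>0 * (X powr (- r / q) * \<epsilon> powr (r / q)))"
      using \<delta>0 Xpos by (simp add: c_def powr_powr mult_ac flip: ennreal_mult)
    also have "\<dots> \<le> ennreal (\<delta>0 * (X powr (- r / q) * X powr (r / q)))"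
      using \<delta>0 X assms q by (intro ennreal_leI mult_left_mono powr_mono2) auto
    also have "\<dots> = ennreal \<delta>0" using Xpos by (simp flip: powr_add)
    finally show False using i by simp
  qed
  then show ?thesis using that[of "\<delta>0 * \<epsilon> powr (r / q)"] \<delta>0 assms by (auto simp: q_def)
qed

section \<open>Weak derivatives\<close>

text \<open>The powers of \<open>x\<close> in the denominator make the family closed under differentiation up to linear
  combinations.\<close>

definition exp_bump :: "nat \<Rightarrow> real \<Rightarrow> real" where
  "exp_bump k x = (if x > 0 then exp (- 1 / x) / x ^ k else 0)"

lemma exp_bump_tendsto_0: "(exp_bump k \<longlongrightarrow> 0) (at 0)"
proof -
  have "((\<lambda>x::real. inverse x ^ k / exp (inverse x)) \<longlongrightarrow> 0) (at_right 0)"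
    using filterlim_compose[OF tendsto_power_div_exp_0[of k] filterlim_inverse_at_top_right] .
  moreover have "eventually (\<lambda>x::real. inverse x ^ k / exp (inverse x) = exp_bump k x) (at_right 0)"
    using eventually_at_right_less[of 0]
    by eventually_elim (auto simp: exp_bump_def exp_minus field_simps)
  ultimately have "(exp_bump k \<longlongrightarrow> 0) (at_right 0)" by (rule Lim_transform_eventually)
  moreover have "(exp_bump k \<longlongrightarrow> 0) (at_left 0)"
    by (rule tendsto_eventually) (auto simp: eventually_at_filter exp_bump_def)
  ultimately show ?thesis by (simp add: filterlim_split_at)
qed

lemma exp_bump_derivative:
  "(exp_bump k has_real_derivative exp_bump (k + 2) x - real k * exp_bump (k + 1) x) (at x)"
proof (cases x "0::real" rule: linorder_cases)
  case greater
  have "((\<lambda>x. exp (- 1 / x) / x ^ k) has_real_derivative exp_bump (k + 2) x - real k * exp_bump (k + 1) x) (at x)"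
    using greater
    by (auto intro!: derivative_eq_intros simp: exp_bump_def)
       (cases k; simp add: field_simps power2_eq_square)
  moreover have "eventually (\<lambda>x. exp (- 1 / x) / x ^ k = exp_bump k x) (nhds x)"
    by (intro eventually_mono[OF order_tendstoD(1)[OF filterlim_ident greater]]) (auto simp: exp_bump_def)
  ultimately show ?thesis
    by (subst DERIV_cong_ev[OF refl _ refl, of _ "\<lambda>x. exp (- 1 / x) / x ^ k"]) (auto elim: eventually_mono)
next
  case less
  have "eventually (\<lambda>x. exp_bump k x = 0) (nhds x)"
    by (intro eventually_mono[OF order_tendstoD(2)[OF filterlim_ident less]]) (auto simp: exp_bump_def)
  then show ?thesis using less
    by (subst DERIV_cong_ev[OF refl _ refl, of _ "\<lambda>x. 0"]) (auto simp: exp_bump_def)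
next
  case equal
  \<comment> \<open>Since \<open>exp_bump k 0\<close> is 0, dividing by h just raises the power in
    the denominator by one, and the limit at 0 is known for every power.\<close>
  have "(\<lambda>h. (exp_bump k (0 + h) - exp_bump k 0) / h) = exp_bump (k + 1)"
    by (auto simp: fun_eq_iff exp_bump_def)
  then show ?thesis using exp_bump_tendsto_0[of "k + 1"] equal
    by (simp add: DERIV_def) (simp add: exp_bump_def)
qed

text \<open>Bumps of affine functions of one coordinate suffice for products that vanish outside a
  box, and the generated algebra is closed under partial derivatives. Hence its members are
  smooth.\<close>

inductive_set bump_algebra :: "(real ^ 'n::finite \<Rightarrow> real) set" where
  bump: "(\<lambda>x. exp_bump k (a * x $ i + b)) \<in> bump_algebra"
| const: "(\<lambda>x. c) \<in> bump_algebra"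
| add: "f \<in> bump_algebra \<Longrightarrow> g \<in> bump_algebra \<Longrightarrow> (\<lambda>x. f x + g x) \<in> bump_algebra"
| mult: "f \<in> bump_algebra \<Longrightarrow> g \<in> bump_algebra \<Longrightarrow> (\<lambda>x. f x * g x) \<in> bump_algebra"

lemma bump_algebra_partial:
  fixes f :: "real ^ 'n::finite \<Rightarrow> real"
  assumes "f \<in> bump_algebra"
  shows "(\<forall>x. f differentiable (at x)) \<and> (\<forall>i. partial i f \<in> bump_algebra)"
proof -
  have "(\<forall>x. f differentiable (at x)) \<and> (\<forall>i. \<exists>f'\<in>bump_algebra. has_partial i f f')"
    using assms
  proof induction
    case (bump k a i b)
    have "(\<lambda>x. exp_bump k (a * x $ i + b)) differentiable (at x)" for x
    proof (rule differentiable_compose[where f="exp_bump k"])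
      show "exp_bump k differentiable at (a * x $ i + b)"
        using exp_bump_derivative real_differentiable_def by blast
      show "(\<lambda>x. a * x $ i + b) differentiable (at x)"
        by (intro differentiable_add differentiable_mult differentiable_const
            bounded_linear_imp_differentiable bounded_linear_vec_nth)
    qed
    moreover have "has_partial l (\<lambda>x. exp_bump k (a * x $ i + b))
        (\<lambda>x. (exp_bump (k + 2) (a * x $ i + b) + (- real k) * exp_bump (k + 1) (a * x $ i + b)) * (a * axis l 1 $ i))" for l
      unfolding has_partial_def
    proof
      fix x :: "real ^ 'n"
      have D: "((\<lambda>t. a * (x + t *\<^sub>R axis l 1) $ i + b) has_real_derivative a * axis l 1 $ i) (at 0)"
        by (auto intro!: derivative_eq_intros)
      from DERIV_chain2[OF exp_bump_derivative D, of k]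
      show "((\<lambda>t. exp_bump k (a * (x + t *\<^sub>R axis l 1) $ i + b)) has_real_derivative
        (exp_bump (k + 2) (a * x $ i + b) + (- real k) * exp_bump (k + 1) (a * x $ i + b)) * (a * axis l 1 $ i)) (at 0)"
        by simp
    qed
    moreover have "(\<lambda>x. (exp_bump (k + 2) (a * x $ i + b) + (- real k) * exp_bump (k + 1) (a * x $ i + b)) * (a * axis l 1 $ i))
       \<in> bump_algebra" for l
      by (intro bump_algebra.intros)
    ultimately show ?case by blast
  next
    case (const c)
    have "has_partial i (\<lambda>x. c) (\<lambda>x. 0)" for i by (simp add: has_partial_def)
    then show ?case using bump_algebra.const by fastforce
  next
    case (add f g)
    have "\<exists>h\<in>bump_algebra. has_partial i (\<lambda>x. f x + g x) h" for i
    proof -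
      obtain f' g' where *: "f' \<in> bump_algebra" "g' \<in> bump_algebra" "has_partial i f f'" "has_partial i g g'"
        using add.IH by blast
      then have "has_partial i (\<lambda>x. f x + g x) (\<lambda>x. f' x + g' x)"
        unfolding has_partial_def by (auto intro!: derivative_eq_intros)
      then show ?thesis using * bump_algebra.add by blast
    qed
    then show ?case using add.IH by (auto intro: differentiable_add)
  next
    case (mult f g)
    have "\<exists>h\<in>bump_algebra. has_partial i (\<lambda>x. f x * g x) h" for i
    proof -
      obtain f' g' where *: "f' \<in> bump_algebra" "g' \<in> bump_algebra" "has_partial i f f'" "has_partial i g g'"
        using mult.IH by blast
      then have "has_partial i (\<lambda>x. f x * g x) (\<lambda>x. f' x * g x + f x * g' x)"
        unfolding has_partial_def by (auto intro!: derivative_eq_intros)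
      moreover have "(\<lambda>x. f' x * g x + f x * g' x) \<in> bump_algebra"
        by (intro bump_algebra.add bump_algebra.mult * mult.hyps)
      ultimately show ?thesis by blast
    qed
    then show ?case using mult.IH by (auto intro: differentiable_mult)
  qed
  then show ?thesis using partial_eqI by metis
qed

lemma bump_algebra_smooth: "f \<in> bump_algebra \<Longrightarrow> smooth f"
  by (rule smooth_coinduct[where P="\<lambda>f. f \<in> bump_algebra"]) (use bump_algebra_partial in auto)

lemma bump_algebra_prod:
  "finite I \<Longrightarrow> (\<And>i. i \<in> I \<Longrightarrow> f i \<in> bump_algebra) \<Longrightarrow> (\<lambda>x. \<Prod>i\<in>I. f i x) \<in> bump_algebra"
  by (induction I rule: finite_induct) (auto intro: bump_algebra.intros)

text \<open>\<open>exp_bump 0\<close> vanishes on the nonpositive reals and tends to 1 at infinity.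
  Applied to n + 1 times the signed distances to the faces and multiplied over all faces, it tends
  to 1 inside the box and is 0 elsewhere.\<close>

lemma test_functions_approx_box:
  fixes a b :: "real ^ 'n::finite"
  obtains \<phi> where "\<And>n. \<phi> n \<in> test_functions" "\<And>n x. \<bar>\<phi> n x\<bar> \<le> indicator (cbox a b) x"
    "\<And>x. (\<lambda>n. \<phi> n x) \<longlonglongrightarrow> indicator (box a b) x"
proof
  define \<phi> where "\<phi> n x = (\<Prod>i\<in>UNIV. exp_bump 0 (real (Suc n) * x $ i + (- real (Suc n) * a $ i))
      * exp_bump 0 (- real (Suc n) * x $ i + real (Suc n) * b $ i))" for n x
  have \<phi>_eq: "\<phi> n x = (\<Prod>i\<in>UNIV. exp_bump 0 (real (Suc n) * (x $ i - a $ i)) * exp_bump 0 (real (Suc n) * (b $ i - x $ i)))" for n x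
    by (simp add: \<phi>_def algebra_simps)
  have bd: "0 \<le> exp_bump 0 s" "exp_bump 0 s \<le> 1" for s by (auto simp: exp_bump_def)
  have z: "exp_bump 0 (real (Suc n) * s) = 0" if "s \<le> 0" for n s
    using that by (simp add: exp_bump_def mult_le_0_iff not_less)
  show *: "\<bar>\<phi> n x\<bar> \<le> indicator (cbox a b) x" for n x
  proof (cases "x \<in> cbox a b")
    case True
    then show ?thesis
      by (auto simp: \<phi>_eq abs_prod abs_mult bd intro!: prod_le_1 mult_le_one)
  next
    case False
    then obtain i where "\<not> (a $ i \<le> x $ i \<and> x $ i \<le> b $ i)" by (auto simp only: mem_box_cart)
    then have "x $ i - a $ i \<le> 0 \<or> b $ i - x $ i \<le> 0" by linarith
    then have "exp_bump 0 (real (Suc n) * (x $ i - a $ i)) * exp_bump 0 (real (Suc n) * (b $ i - x $ i)) = 0"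
      using z by (auto simp del: of_nat_Suc)
    then have "\<phi> n x = 0" unfolding \<phi>_eq by (intro prod_zero[OF finite] bexI[of _ i] UNIV_I)
    then show ?thesis by simp
  qed
  show "\<phi> n \<in> test_functions" for n
  proof -
    have "\<phi> n \<in> bump_algebra" unfolding \<phi>_def[abs_def]
      by (intro bump_algebra_prod bump_algebra.mult bump_algebra.bump) auto
    moreover obtain R where "\<And>x. x \<in> cbox a b \<Longrightarrow> norm x \<le> R"
      using bounded_cbox[of a b] by (auto simp: bounded_iff)
    then have "\<forall>x. norm x > R \<longrightarrow> \<phi> n x = 0"
      using *[of n] by (metis abs_le_zero_iff indicator_simps(2) not_le)
    ultimately show ?thesis using bump_algebra_smooth by (auto simp: test_functions_iff)
  qed
  have lim: "(\<lambda>n. exp_bump 0 (real (Suc n) * s)) \<longlonglongrightarrow> 1" if "s > 0" for s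
  proof -
    have "(\<lambda>n. exp (- (1 / s) * inverse (real (Suc n)))) \<longlonglongrightarrow> exp (- (1 / s) * 0)"
      by (intro tendsto_intros LIMSEQ_inverse_real_of_nat)
    moreover have "exp_bump 0 (real (Suc n) * s) = exp (- (1 / s) * inverse (real (Suc n)))" for n
    proof -
      have "real (Suc n) * s > 0" using that by (simp del: of_nat_Suc)
      then show ?thesis by (simp add: exp_bump_def divide_inverse mult.commute del: of_nat_Suc)
    qed
    ultimately show ?thesis by simp
  qed
  show "(\<lambda>n. \<phi> n x) \<longlonglongrightarrow> indicator (box a b) x" for x
  proof (cases "x \<in> box a b")
    case True
    then have "(\<lambda>n. \<phi> n x) \<longlonglongrightarrow> (\<Prod>i\<in>(UNIV::'n set). 1 * 1)"
      unfolding \<phi>_eq by (intro tendsto_prod tendsto_mult lim) (auto simp: mem_box_cart)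
    then show ?thesis using True by simp
  next
    case False
    then obtain i where "\<not> (a $ i < x $ i \<and> x $ i < b $ i)" by (auto simp only: mem_box_cart)
    then have "x $ i - a $ i \<le> 0 \<or> b $ i - x $ i \<le> 0" by linarith
    then have "exp_bump 0 (real (Suc n) * (x $ i - a $ i)) * exp_bump 0 (real (Suc n) * (b $ i - x $ i)) = 0" for n
      using z by (auto simp del: of_nat_Suc)
    then have "\<phi> n x = 0" for n unfolding \<phi>_eq by (intro prod_zero[OF finite] bexI[of _ i] UNIV_I)
    then show ?thesis using False by simp
  qed
qed

section \<open>Local integrability and the fundamental lemma of the calculus of variations\<close>

lemma locally_integrable_measurable: "locally_integrable u \<Longrightarrow> u \<in> borel_measurable borel"
  by (simp add: locally_integrable_def)

lemma integrable_mult_bounded_support: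
  assumes u: "locally_integrable u" and [measurable]: "\<phi> \<in> borel_measurable borel"
    and \<phi>: "\<And>x. \<bar>\<phi> x\<bar> \<le> B" "\<And>x. norm x > R \<Longrightarrow> \<phi> x = 0"
  shows "integrable lborel (\<lambda>x. u x * \<phi> x)"
proof -
  have [measurable]: "u \<in> borel_measurable borel" using u by (rule locally_integrable_measurable)
  have "set_integrable lborel (cball 0 R) u" using u by (simp add: locally_integrable_def)
  then have int: "integrable lborel (\<lambda>x. B * (indicator (cball 0 R) x *\<^sub>R u x))"
    unfolding set_integrable_def by (rule integrable_mult_right)
  have "B \<ge> 0" using \<phi>(1)[of 0] by linarith
  then have ae: "AE x in lborel. norm (u x * \<phi> x) \<le> norm (B * (indicator (cball 0 R) x *\<^sub>R u x))"
    using \<phi> by (intro AE_I2) (auto simp: abs_mult indicator_def not_le mult.commute intro!: mult_right_mono)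
  show ?thesis by (rule Bochner_Integration.integrable_bound[OF int _ ae]) measurable
qed

lemma integrable_mult_test_function:
  assumes "locally_integrable u" "\<phi> \<in> test_functions"
  shows "integrable lborel (\<lambda>x. u x * \<phi> x)"
proof -
  obtain B where "\<And>x. \<bar>\<phi> x\<bar> \<le> B" using test_functions_bounded[OF assms(2)] by blast
  moreover obtain R where "\<And>x. norm x > R \<Longrightarrow> \<phi> x = 0" using assms by (auto simp: test_functions_iff)
  ultimately show ?thesis
    using assms by (intro integrable_mult_bounded_support) (auto intro: smooth_measurable test_functions_smooth)
qed

lemma locally_integrable_lincomb:
  assumes "locally_integrable u" "locally_integrable v"
  shows "locally_integrable (\<lambda>x. a * u x + b * v x)"
proof -
  have "set_integrable lborel K (\<lambda>x. a * u x + b * v x)" if "compact K" for K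
    using assms that unfolding locally_integrable_def by (intro set_integral_add set_integrable_mult_right) auto
  then show ?thesis using assms by (auto simp: locally_integrable_def)
qed

lemma locally_integrable_affine:
  fixes u :: "real ^ 'n::finite \<Rightarrow> real"
  assumes u: "locally_integrable u" and c: "c > 0"
  shows "locally_integrable (\<lambda>x. u (t + c *\<^sub>R x))"
  unfolding locally_integrable_def
proof (intro conjI allI impI)
  have [measurable]: "u \<in> borel_measurable borel" using u by (rule locally_integrable_measurable)
  show "(\<lambda>x. u (t + c *\<^sub>R x)) \<in> borel_measurable borel" by measurable
  fix K :: "(real ^ 'n) set" assume K: "compact K"
  let ?T = "\<lambda>x. t + c *\<^sub>R x"
  have TK: "compact (?T ` K)" by (intro compact_continuous_image continuous_intros K)
  have "inj ?T" using c by (auto intro: injI)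
  then have "indicator (?T ` K) (?T x) = (indicator K x :: real)" for x
    using inj_image_mem_iff[of ?T x K] by (simp add: indicator_def)
  moreover have [measurable]: "?T ` K \<in> sets borel" using TK by (rule borel_compact)
  have "integrable lborel (\<lambda>x. indicator (?T ` K) x *\<^sub>R u x)"
    using u TK by (auto simp: locally_integrable_def set_integrable_def)
  then have "integrable lborel (\<lambda>x. indicator (?T ` K) (?T x) *\<^sub>R u (?T x))"
    by (subst integrable_lborel_affine[OF c, of "\<lambda>x. indicator (?T ` K) x *\<^sub>R u x"]) auto
  ultimately show "set_integrable lborel K (\<lambda>x. u (?T x))" by (simp add: set_integrable_def)
qed

lemma locally_integrable_continuous:
  fixes u :: "real ^ 'n::finite \<Rightarrow> real"
  assumes "continuous_on UNIV u"
  shows "locally_integrable u"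
  unfolding locally_integrable_def set_integrable_def
  by (intro conjI allI impI borel_measurable_continuous_onI borel_integrable_compact)
     (auto intro: continuous_on_subset[OF assms] assms)

text \<open>The positive and the negative part of g are densities of two measures that agree, with
  finite values, on boxes, hence everywhere. By uniqueness of densities \<open>ennreal (g x)\<close>
  and \<open>ennreal (- g x)\<close> agree almost everywhere; as \<open>ennreal\<close> maps
  negative numbers to 0, this forces g x = 0.\<close>

lemma AE_eq_0_if_box_integrals_eq_0:
  fixes g :: "real ^ 'n::finite \<Rightarrow> real"
  assumes g: "locally_integrable g"
    and box: "\<And>a b. (LINT x|lborel. g x * indicator (box a b) x) = 0"
  shows "AE x in lborel. g x = 0"
proof -
  have [measurable]: "g \<in> borel_measurable borel" using g by (rule locally_integrable_measurable)
  let ?P = "density lborel (\<lambda>x. ennreal (g x))" and ?M = "density lborel (\<lambda>x. ennreal (- g x))"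
  have box_fin: "emeasure ?P (box a b) \<noteq> \<infinity>" and box_eq: "emeasure ?P (box a b) = emeasure ?M (box a b)" for a b
  proof -
    obtain R where "\<And>x. x \<in> box a b \<Longrightarrow> norm x \<le> R" using bounded_box[of a b] by (auto simp: bounded_iff)
    then have int: "integrable lborel (\<lambda>x. g x * indicator (box a b) x)"
      by (intro integrable_mult_bounded_support[OF g, of _ 1 R]) (auto simp: indicator_def not_le[symmetric])
    have "emeasure ?P (box a b) = (\<integral>\<^sup>+x. ennreal (g x * indicator (box a b) x) \<partial>lborel)"
      by (auto simp: emeasure_density indicator_def intro!: nn_integral_cong)
    moreover have "emeasure ?M (box a b) = (\<integral>\<^sup>+x. ennreal (- (g x * indicator (box a b) x)) \<partial>lborel)"
      by (auto simp: emeasure_density indicator_def intro!: nn_integral_cong)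
    moreover have "(\<integral>\<^sup>+x. ennreal (g x * indicator (box a b) x) \<partial>lborel) \<noteq> \<infinity>"
      "(\<integral>\<^sup>+x. ennreal (- (g x * indicator (box a b) x)) \<partial>lborel) \<noteq> \<infinity>"
      using int by (auto simp: real_integrable_def)
    moreover have "enn2real (\<integral>\<^sup>+x. ennreal (g x * indicator (box a b) x) \<partial>lborel)
        = enn2real (\<integral>\<^sup>+x. ennreal (- (g x * indicator (box a b) x)) \<partial>lborel)"
      using box[of a b] real_lebesgue_integral_def[OF int] by simp
    ultimately show "emeasure ?P (box a b) \<noteq> \<infinity>" "emeasure ?P (box a b) = emeasure ?M (box a b)"
      by (auto simp: less_top) (metis ennreal_enn2real)
  qed
  have "?P = ?M"
  proof (rule measure_eqI_generator_eq)
    let ?E = "range (\<lambda>(a, b). box a b::(real^'n) set)"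
    show "Int_stable ?E" by (auto simp: Int_stable_def box_Int_box)
    show "?E \<subseteq> Pow UNIV" "sets ?P = sigma_sets UNIV ?E" "sets ?M = sigma_sets UNIV ?E"
      by (simp_all add: borel_eq_box)
    let ?A = "\<lambda>n::nat. box (- (real n *\<^sub>R One)) (real n *\<^sub>R One) :: (real^'n) set"
    show "range ?A \<subseteq> ?E" "(\<Union>i. ?A i) = UNIV" unfolding UN_box_eq_UNIV by auto
    show "emeasure ?P (?A i) \<noteq> \<infinity>" for i by (rule box_fin)
    show "emeasure ?P X = emeasure ?M X" if "X \<in> ?E" for X using that box_eq by auto
  qed
  moreover have "sigma_finite_measure ?P"
    by (subst sigma_finite_measure.sigma_finite_iff_density_finite[OF sigma_finite_lborel]) auto
  ultimately have "AE x in lborel. ennreal (g x) = ennreal (- g x)"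
    by (subst sigma_finite_density_unique[symmetric]) auto
  moreover have "g x = 0" if "ennreal (g x) = ennreal (- g x)" for x
    using that by (cases "g x" "0::real" rule: linorder_cases) (auto simp: ennreal_neg dest: sym)
  ultimately show ?thesis by auto
qed

lemma fundamental_lemma_variations:
  fixes g :: "real ^ 'n::finite \<Rightarrow> real"
  assumes g: "locally_integrable g"
    and zero: "\<And>\<phi>. \<phi> \<in> test_functions \<Longrightarrow> (LINT x|lborel. g x * \<phi> x) = 0"
  shows "AE x in lborel. g x = 0"
proof (rule AE_eq_0_if_box_integrals_eq_0[OF g])
  fix a b :: "real ^ 'n"
  have gm [measurable]: "g \<in> borel_measurable borel" using g by (rule locally_integrable_measurable)
  obtain \<phi> where \<phi>: "\<And>n. \<phi> n \<in> test_functions" "\<And>n x. \<bar>\<phi> n x\<bar> \<le> indicator (cbox a b) x"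
    "\<And>x. (\<lambda>n. \<phi> n x) \<longlonglongrightarrow> indicator (box a b) x"
    using test_functions_approx_box by blast
  have [measurable]: "\<phi> n \<in> borel_measurable borel" for n
    using \<phi>(1) by (auto intro: smooth_measurable test_functions_smooth)
  obtain R where "\<And>x. x \<in> cbox a b \<Longrightarrow> norm x \<le> R" using bounded_cbox[of a b] by (auto simp: bounded_iff)
  then have int: "integrable lborel (\<lambda>x. g x * indicator (cbox a b) x)"
    by (intro integrable_mult_bounded_support[OF g, of _ 1 R]) (auto simp: indicator_def not_le[symmetric])
  have "(\<lambda>n. LINT x|lborel. g x * \<phi> n x) \<longlonglongrightarrow> (LINT x|lborel. g x * indicator (box a b) x)"
  proof (rule integral_dominated_convergence[where w="\<lambda>x. \<bar>g x * indicator (cbox a b) x\<bar>"])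
    show "AE x in lborel. (\<lambda>n. g x * \<phi> n x) \<longlonglongrightarrow> g x * indicator (box a b) x"
      by (intro AE_I2 tendsto_intros \<phi>)
    show "AE x in lborel. norm (g x * \<phi> n x) \<le> \<bar>g x * indicator (cbox a b) x\<bar>" for n
      using \<phi>(2) by (intro AE_I2) (auto simp: abs_mult intro!: mult_left_mono)
  qed (use int in auto)
  then show "(LINT x|lborel. g x * indicator (box a b) x) = 0"
    using zero[OF \<phi>(1)] by (simp add: LIMSEQ_const_iff)
qed

section \<open>Uniqueness and calculus of weak derivatives\<close>

lemma has_weak_deriv_unique:
  assumes "has_weak_deriv \<alpha> u v" "has_weak_deriv \<alpha> u v'"
  shows "AE x in lborel. v x = v' x"
proof -
  have l: "locally_integrable v" "locally_integrable v'" using assms by (auto simp: has_weak_deriv_def)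
  have "AE x in lborel. v x - v' x = 0"
  proof (rule fundamental_lemma_variations)
    show "locally_integrable (\<lambda>x. v x - v' x)" using locally_integrable_lincomb[OF l, of 1 "-1"] by simp
    fix \<phi> :: "real ^ 'a \<Rightarrow> real" assume \<phi>: "\<phi> \<in> test_functions"
    have "(-1) ^ mi_order \<alpha> * (LINT x|lborel. v x * \<phi> x) = (-1) ^ mi_order \<alpha> * (LINT x|lborel. v' x * \<phi> x)"
      using assms \<phi> by (simp add: has_weak_deriv_def)
    then show "(LINT x|lborel. (v x - v' x) * \<phi> x) = 0"
      using integrable_mult_test_function[OF l(1) \<phi>] integrable_mult_test_function[OF l(2) \<phi>]
      by (simp add: left_diff_distrib)
  qed
  then show ?thesis by simp
qed

lemma has_weak_deriv_weak_deriv: "has_weak_deriv \<alpha> u v \<Longrightarrow> has_weak_deriv \<alpha> u (weak_deriv \<alpha> u)"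
  unfolding weak_deriv_def by (rule someI[of "has_weak_deriv \<alpha> u"])

lemma weak_deriv_AE_eq:
  "has_weak_deriv \<alpha> u v \<Longrightarrow> AE x in lborel. weak_deriv \<alpha> u x = v x"
  using has_weak_deriv_unique has_weak_deriv_weak_deriv by blast

lemma has_weak_deriv_measurable: "has_weak_deriv \<alpha> u v \<Longrightarrow> v \<in> borel_measurable borel"
  by (simp add: has_weak_deriv_def locally_integrable_def)

lemma has_weak_deriv_lincomb:
  assumes "has_weak_deriv \<alpha> u v" "has_weak_deriv \<alpha> u' v'"
  shows "has_weak_deriv \<alpha> (\<lambda>x. a * u x + b * u' x) (\<lambda>x. a * v x + b * v' x)"
  unfolding has_weak_deriv_def
proof (intro conjI ballI)
  have l: "locally_integrable u" "locally_integrable u'" "locally_integrable v" "locally_integrable v'"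
    using assms by (auto simp: has_weak_deriv_def)
  show "locally_integrable (\<lambda>x. a * u x + b * u' x)" "locally_integrable (\<lambda>x. a * v x + b * v' x)"
    using l by (auto intro: locally_integrable_lincomb)
  fix \<phi> :: "real ^ 'a \<Rightarrow> real" assume \<phi>: "\<phi> \<in> test_functions"
  let ?I = "\<lambda>u \<phi>. LINT x|lborel. u x * \<phi> x"
  have lin: "?I (\<lambda>x. a * w x + b * w' x) \<psi> = a * ?I w \<psi> + b * ?I w' \<psi>"
    if "locally_integrable w" "locally_integrable w'" "\<psi> \<in> test_functions" for w w' \<psi> :: "real ^ 'a \<Rightarrow> real"
  proof -
    have "?I (\<lambda>x. a * w x + b * w' x) \<psi> = (LINT x|lborel. a * (w x * \<psi> x) + b * (w' x * \<psi> x))"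
      by (intro Bochner_Integration.integral_cong) (auto simp: algebra_simps)
    then show ?thesis using that by (simp add: integrable_mult_test_function)
  qed
  show "?I (\<lambda>x. a * u x + b * u' x) (mi_partial \<alpha> \<phi>) = (- 1) ^ mi_order \<alpha> * ?I (\<lambda>x. a * v x + b * v' x) \<phi>"
  proof -
    have "?I u (mi_partial \<alpha> \<phi>) = (- 1) ^ mi_order \<alpha> * ?I v \<phi>" "?I u' (mi_partial \<alpha> \<phi>) = (- 1) ^ mi_order \<alpha> * ?I v' \<phi>"
      using assms \<phi> by (auto simp: has_weak_deriv_def)
    then show ?thesis
      unfolding lin[OF l(1,2) test_functions_mi_partial[OF \<phi>]] lin[OF l(3,4) \<phi>] by (simp only: algebra_simps)
  qed
qed

lemma has_weak_deriv_sum: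
  assumes "finite I" "I \<noteq> {}" "\<And>i. i \<in> I \<Longrightarrow> has_weak_deriv \<alpha> (u i) (v i)"
  shows "has_weak_deriv \<alpha> (\<lambda>x. \<Sum>i\<in>I. u i x) (\<lambda>x. \<Sum>i\<in>I. v i x)"
  using assms
proof (induction I rule: finite_ne_induct)
  case (insert i I)
  then have "has_weak_deriv \<alpha> (\<lambda>x. 1 * u i x + 1 * (\<Sum>i\<in>I. u i x)) (\<lambda>x. 1 * v i x + 1 * (\<Sum>i\<in>I. v i x))"
    by (intro has_weak_deriv_lincomb) auto
  then show ?case using insert by simp
qed simp

lemma has_weak_deriv_test_function:
  assumes "\<phi> \<in> test_functions"
  shows "has_weak_deriv \<alpha> \<phi> (mi_partial \<alpha> \<phi>)"
  using assms
  by (auto simp: has_weak_deriv_def integral_by_parts_mi_partial[OF test_functions_smooth[OF assms]]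
      intro!: locally_integrable_continuous smooth_continuous_on test_functions_smooth test_functions_mi_partial)

text \<open>Functions of the form b * h (t + c x) with h smooth are an invariant class; the factor b
  collects the powers of c.\<close>

lemma partials_affine:
  fixes f :: "real ^ 'n::finite \<Rightarrow> real"
  assumes "smooth f"
  shows "partials is (\<lambda>x. f (t + c *\<^sub>R x)) = (\<lambda>x. c ^ length is * partials is f (t + c *\<^sub>R x))"
    and "smooth (\<lambda>x. f (t + c *\<^sub>R x))"
proof -
  have diff: "(\<lambda>x. b * h (t + c *\<^sub>R x)) differentiable (at x)" if "smooth h" for h :: "real ^ 'n \<Rightarrow> real" and b x
  proof (rule differentiable_mult[OF differentiable_const differentiable_compose[of h]])
    show "h differentiable at (t + c *\<^sub>R x)" using that by (rule smooth_differentiable)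
    show "(\<lambda>x. t + c *\<^sub>R x) differentiable (at x)" by (intro derivative_intros)
  qed
  have part: "partial i (\<lambda>x. b * h (t + c *\<^sub>R x)) = (\<lambda>x. (b * c) * partial i h (t + c *\<^sub>R x))"
    if "smooth h" for h :: "real ^ 'n \<Rightarrow> real" and b i
  proof (rule partial_eqI[OF diff[OF that]])
    show "has_partial i (\<lambda>x. b * h (t + c *\<^sub>R x)) (\<lambda>x. (b * c) * partial i h (t + c *\<^sub>R x))"
      unfolding has_partial_def
    proof
      fix x
      have "((\<lambda>s. h (t + c *\<^sub>R x + (c * s) *\<^sub>R axis i 1)) has_real_derivative partial i h (t + c *\<^sub>R x) * c) (at 0)"
        using has_partial_line[OF smooth_has_partial[OF that], of "t + c *\<^sub>R x" i "c * 0"]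
        by (intro DERIV_chain2[where f="\<lambda>s. h (t + c *\<^sub>R x + s *\<^sub>R axis i 1)"]) (auto intro!: derivative_eq_intros)
      then show "((\<lambda>s. b * h (t + c *\<^sub>R (x + s *\<^sub>R axis i 1))) has_real_derivative b * c * partial i h (t + c *\<^sub>R x)) (at 0)"
        by (auto intro!: derivative_eq_intros simp: algebra_simps)
    qed
  qed
  show "partials is (\<lambda>x. f (t + c *\<^sub>R x)) = (\<lambda>x. c ^ length is * partials is f (t + c *\<^sub>R x))"
  proof (induction "is")
    case (Cons i "is")
    then show ?case using part[OF smooth_partials[OF assms]] by (simp add: mult.commute)
  qed simp
  have "\<exists>b h. (\<lambda>x. f (t + c *\<^sub>R x)) = (\<lambda>x. b * h (t + c *\<^sub>R x)) \<and> smooth h"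
    using assms by (intro exI[of _ 1] exI[of _ f]) auto
  then show "smooth (\<lambda>x. f (t + c *\<^sub>R x))"
  proof (rule smooth_coinduct[where P="\<lambda>g. \<exists>b h. g = (\<lambda>x. b * h (t + c *\<^sub>R x)) \<and> smooth h"], elim exE conjE, intro conjI allI)
    fix g b h x i assume g: "g = (\<lambda>x. b * h (t + c *\<^sub>R x))" "smooth h"
    show "g differentiable (at x)" unfolding g(1) by (rule diff[OF g(2)])
    show "\<exists>b h. partial i g = (\<lambda>x. b * h (t + c *\<^sub>R x)) \<and> smooth h"
      unfolding g(1) part[OF g(2)] using smooth_partial[OF g(2)] by blast
  qed
qed

lemma test_functions_affine:
  fixes \<phi> :: "real ^ 'n::finite \<Rightarrow> real"
  assumes "\<phi> \<in> test_functions" "c > 0"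
  shows "(\<lambda>x. \<phi> (t + c *\<^sub>R x)) \<in> test_functions"
proof -
  obtain R where R: "\<And>x. norm x > R \<Longrightarrow> \<phi> x = 0" using assms by (auto simp: test_functions_iff)
  have "\<phi> (t + c *\<^sub>R x) = 0" if "norm x > (R + norm t) / c" for x
  proof (rule R)
    have "R + norm t < norm (c *\<^sub>R x)" using that assms by (simp add: pos_divide_less_eq mult.commute)
    then show "R < norm (t + c *\<^sub>R x)" using norm_diff_ineq[of "c *\<^sub>R x" t] by (simp add: add.commute)
  qed
  then show ?thesis
    using partials_affine(2)[OF test_functions_smooth[OF assms(1)], of t c] unfolding test_functions_iff
    by (intro conjI exI[of _ "(R + norm t) / c"]) auto
qed

text \<open>The inverse affine map is transferred to the test function. The Jacobian factor is the
  same on both sides, and the power of c stems from differentiating the transformed test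
  function.\<close>

lemma has_weak_deriv_affine:
  fixes u v :: "real ^ 'n::finite \<Rightarrow> real"
  assumes w: "has_weak_deriv \<alpha> u v" and c: "c > 0"
  shows "has_weak_deriv \<alpha> (\<lambda>x. u (t + c *\<^sub>R x)) (\<lambda>x. c ^ mi_order \<alpha> * v (t + c *\<^sub>R x))"
  unfolding has_weak_deriv_def
proof (intro conjI ballI)
  have l: "locally_integrable u" "locally_integrable v" using w by (auto simp: has_weak_deriv_def)
  have [measurable]: "u \<in> borel_measurable borel" "v \<in> borel_measurable borel"
    using l by (auto intro: locally_integrable_measurable)
  show "locally_integrable (\<lambda>x. u (t + c *\<^sub>R x))" using l(1) c by (rule locally_integrable_affine)
  show "locally_integrable (\<lambda>x. c ^ mi_order \<alpha> * v (t + c *\<^sub>R x))"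
    using locally_integrable_lincomb[OF locally_integrable_affine[OF l(2) c, of t] locally_integrable_affine[OF l(2) c, of t],
      of "c ^ mi_order \<alpha>" 0] by simp
  fix \<phi> :: "real ^ 'n \<Rightarrow> real" assume \<phi>: "\<phi> \<in> test_functions"
  define \<psi> where "\<psi> x = \<phi> (- (1/c) *\<^sub>R t + (1/c) *\<^sub>R x)" for x
  have \<psi>: "\<psi> \<in> test_functions" unfolding \<psi>_def[abs_def] using \<phi> c by (intro test_functions_affine) auto
  have inv: "- (1/c) *\<^sub>R t + (1/c) *\<^sub>R (t + c *\<^sub>R x) = x" for x using c by (simp add: scaleR_add_right)
  have \<psi>_inv: "\<psi> (t + c *\<^sub>R x) = \<phi> x" for x unfolding \<psi>_def inv ..
  have d\<psi>: "mi_partial \<alpha> \<phi> x = c ^ mi_order \<alpha> * mi_partial \<alpha> \<psi> (t + c *\<^sub>R x)" for x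
    unfolding \<psi>_def[abs_def] mi_partial_eq partials_affine(1)[OF test_functions_smooth[OF \<phi>]]
    using c inv by (simp add: length_mi_list power_divide)
  have [measurable]: "\<psi> \<in> borel_measurable borel" "mi_partial \<alpha> \<psi> \<in> borel_measurable borel"
    using \<psi> by (auto intro: smooth_measurable test_functions_smooth test_functions_mi_partial)
  have "(LINT x|lborel. u (t + c *\<^sub>R x) * mi_partial \<alpha> \<phi> x)
      = c ^ mi_order \<alpha> * (LINT x|lborel. u (t + c *\<^sub>R x) * mi_partial \<alpha> \<psi> (t + c *\<^sub>R x))"
    by (subst integral_mult_right_zero[symmetric]) (simp only: d\<psi> mult_ac)
  also have "\<dots> = c ^ mi_order \<alpha> * ((LINT x|lborel. u x * mi_partial \<alpha> \<psi> x) / c ^ CARD('n))"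
    using integral_lborel_affine[OF c, of "\<lambda>x. u x * mi_partial \<alpha> \<psi> x" t] by simp
  also have "(LINT x|lborel. u x * mi_partial \<alpha> \<psi> x) = (-1) ^ mi_order \<alpha> * (LINT x|lborel. v x * \<psi> x)"
    using w \<psi> by (simp add: has_weak_deriv_def)
  also have "c ^ mi_order \<alpha> * ((-1) ^ mi_order \<alpha> * (LINT x|lborel. v x * \<psi> x) / c ^ CARD('n))
      = (-1) ^ mi_order \<alpha> * (c ^ mi_order \<alpha> * ((LINT x|lborel. v x * \<psi> x) / c ^ CARD('n)))" by simp
  also have "(LINT x|lborel. v x * \<psi> x) / c ^ CARD('n) = (LINT x|lborel. v (t + c *\<^sub>R x) * \<phi> x)"
    using integral_lborel_affine[OF c, of "\<lambda>x. v x * \<psi> x" t] \<psi>_inv by simp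
  finally show "(LINT x|lborel. u (t + c *\<^sub>R x) * mi_partial \<alpha> \<phi> x)
      = (-1) ^ mi_order \<alpha> * (LINT x|lborel. c ^ mi_order \<alpha> * v (t + c *\<^sub>R x) * \<phi> x)"
    by (simp add: mult.assoc)
qed

section \<open>Intermediate derivatives in homogeneous Sobolev spaces\<close>

lemma powr_add_le:
  fixes a b r :: real
  assumes "r \<ge> 0"
  shows "\<bar>a + b\<bar> powr r \<le> 2 powr r * (\<bar>a\<bar> powr r + \<bar>b\<bar> powr r)"
proof -
  have "\<bar>a + b\<bar> powr r \<le> (2 * max \<bar>a\<bar> \<bar>b\<bar>) powr r"
    using assms by (intro powr_mono2) auto
  also have "\<dots> = 2 powr r * max \<bar>a\<bar> \<bar>b\<bar> powr r" by (simp add: powr_mult)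
  also have "\<dots> \<le> 2 powr r * (\<bar>a\<bar> powr r + \<bar>b\<bar> powr r)"
    by (intro mult_left_mono) (auto simp: max_def)
  finally show ?thesis .
qed

lemma Lp_mass_cong_AE:
  assumes "AE x in lborel. f x = g x"
  shows "Lp_mass q f = Lp_mass q g"
  unfolding Lp_mass_def by (rule nn_integral_cong_AE) (use assms in auto)

lemma Lp_mass_add_le:
  assumes [measurable]: "f \<in> borel_measurable borel" "g \<in> borel_measurable borel" and "r \<ge> 0"
  shows "Lp_mass r (\<lambda>x. f x + g x) \<le> ennreal (2 powr r) * (Lp_mass r f + Lp_mass r g)"
proof -
  have "Lp_mass r (\<lambda>x. f x + g x)
    \<le> (\<integral>\<^sup>+x. ennreal (2 powr r) * (ennreal (\<bar>f x\<bar> powr r) + ennreal (\<bar>g x\<bar> powr r)) \<partial>lborel)"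
    unfolding Lp_mass_def
    by (intro nn_integral_mono) (simp add: powr_add_le assms ennreal_leI flip: ennreal_mult ennreal_plus)
  also have "\<dots> = ennreal (2 powr r) * (Lp_mass r f + Lp_mass r g)"
    by (simp add: nn_integral_cmult nn_integral_add Lp_mass_def)
  finally show ?thesis .
qed

lemma Lp_mass_diff_le:
  assumes [measurable]: "f \<in> borel_measurable borel" "g \<in> borel_measurable borel" and "r \<ge> 0"
  shows "Lp_mass r (\<lambda>x. f x - g x) \<le> ennreal (2 powr r) * (Lp_mass r f + Lp_mass r g)"
  using Lp_mass_add_le[of f "\<lambda>x. - g x" r] assms by (simp add: Lp_mass_def)

lemma Lp_mass_minus_commute: "Lp_mass r (\<lambda>x. f x - g x) = Lp_mass r (\<lambda>x. g x - f x)"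
  by (simp add: Lp_mass_def abs_minus_commute)

text \<open>The weights 2^(kr) in G turn the masses 4^(-kr) into the summable bounds 2^(-kr), so G
  is finite almost everywhere. Where it is finite, the k-th difference is at most g 2^(-k) with g =
  G^(1/r). Hence the sequence converges at a geometric rate, and the r-th power of the error is at
  most a null sequence times the integrable function G.\<close>

lemma Lp_limit_of_rapid_Cauchy:
  fixes f :: "nat \<Rightarrow> real ^ 'n::finite \<Rightarrow> real"
  assumes [measurable]: "\<And>k. f k \<in> borel_measurable borel" and r: "r > 0"
    and rapid: "\<And>k. Lp_mass r (\<lambda>x. f (Suc k) x - f k x) \<le> ennreal ((1 / 4 powr r) ^ k)"
  obtains h where "h \<in> borel_measurable borel" "(\<lambda>k. Lp_mass r (\<lambda>x. f k x - h x)) \<longlonglongrightarrow> 0"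
proof -
  define d where "d k x = f (Suc k) x - f k x" for k x
  define G where "G x = (\<Sum>k. ennreal ((2 ^ k * \<bar>d k x\<bar>) powr r))" for x
  have [measurable]: "d k \<in> borel_measurable borel" for k unfolding d_def[abs_def] by measurable
  have [measurable]: "G \<in> borel_measurable borel" unfolding G_def[abs_def] by measurable
  have pw: "(2 ^ k) powr r = (2 powr r) ^ k" for k :: nat
    by (simp add: powr_powr powr_power mult.commute flip: powr_realpow)
  have q: "1 / 2 powr r < 1" using r by simp
  have "(\<integral>\<^sup>+x. G x \<partial>lborel) = (\<Sum>k. ennreal ((2 powr r) ^ k) * Lp_mass r (d k))"
    unfolding G_def
    by (simp add: nn_integral_suminf powr_mult pw ennreal_mult nn_integral_cmult Lp_mass_def)
  also have "\<dots> \<le> (\<Sum>k. ennreal ((1 / 2 powr r) ^ k))"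
  proof (rule suminf_le)
    fix k
    have "ennreal ((2 powr r) ^ k) * Lp_mass r (d k) \<le> ennreal ((2 powr r) ^ k) * ennreal ((1 / 4 powr r) ^ k)"
      using rapid[of k] unfolding d_def by (rule mult_left_mono) simp
    also have "\<dots> = ennreal ((2 powr r * (1 / 4 powr r)) ^ k)"
      by (simp only: power_mult_distrib ennreal_mult' powr_ge_zero zero_le_power)
    also have "2 powr r * (1 / 4 powr r) = 1 / 2 powr r"
      using powr_mult[of 2 2 r] by simp
    finally show "ennreal ((2 powr r) ^ k) * Lp_mass r (d k) \<le> ennreal ((1 / 2 powr r) ^ k)" .
  qed auto
  also have "\<dots> < \<infinity>"
    by (subst suminf_ennreal2) (use q in \<open>auto intro!: summable_geometric\<close>)
  finally have G_fin: "(\<integral>\<^sup>+x. G x \<partial>lborel) < \<infinity>" .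
  define g where "g x = enn2real (G x) powr (1 / r)" for x
  have g0: "g x \<ge> 0" for x by (simp add: g_def)
  have [measurable]: "g \<in> borel_measurable borel" unfolding g_def[abs_def] by measurable
  \<comment> \<open>Where the sequence diverges, \<open>lim\<close> is an arbitrary value; this
    happens only inside the null set on which G is infinite.\<close>
  define h where "h x = lim (\<lambda>k. f k x)" for x
  have h_meas [measurable]: "h \<in> borel_measurable borel"
    unfolding h_def[abs_def] by (rule borel_measurable_lim_metric) simp
  have close: "\<bar>f k x - h x\<bar> \<le> 2 * (1/2) ^ k * g x" if fin: "G x < \<infinity>" for k x
  proof -
    have dk: "\<bar>d k x\<bar> \<le> g x * (1/2) ^ k" for k
    proof -
      define t where "t k = ennreal ((2 ^ k * \<bar>d k x\<bar>) powr r)" for k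
      have "sum t {k} \<le> suminf t" by (rule sum_le_suminf) auto
      moreover have "suminf t = G x" unfolding t_def G_def ..
      ultimately have le: "ennreal ((2 ^ k * \<bar>d k x\<bar>) powr r) \<le> G x" by (simp add: t_def)
      obtain c where c: "G x = ennreal c" "c \<ge> 0" using fin by (cases "G x") auto
      have "(2 ^ k * \<bar>d k x\<bar>) powr r \<le> enn2real (G x)"
        using le c by simp
      then have "((2 ^ k * \<bar>d k x\<bar>) powr r) powr (1/r) \<le> g x"
        unfolding g_def using r by (intro powr_mono2) auto
      then have "2 ^ k * \<bar>d k x\<bar> \<le> g x" using r by (simp add: powr_powr)
      then show ?thesis by (simp add: field_simps power_divide)
    qed
    have "summable (\<lambda>k. g x * (1/2::real) ^ k)" by (intro summable_mult summable_geometric) simp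
    then have sum_d: "summable (\<lambda>k. \<bar>d k x\<bar>)"
      by (rule summable_comparison_test[rotated]) (use dk in auto)
    then have sd: "summable (\<lambda>k. d k x)" by (rule summable_rabs_cancel)
    have tele: "(\<Sum>i<k. d i x) = f k x - f 0 x" for k
      unfolding d_def by (rule sum_lessThan_telescope)
    have "(\<lambda>k. \<Sum>i<k. d i x) \<longlonglongrightarrow> (\<Sum>i. d i x)" using sd by (rule summable_LIMSEQ)
    then have "(\<lambda>k. f k x - f 0 x + f 0 x) \<longlonglongrightarrow> (\<Sum>i. d i x) + f 0 x"
      unfolding tele by (intro tendsto_intros)
    then have hx: "h x = (\<Sum>i. d i x) + f 0 x" unfolding h_def by (intro limI) simp
    have "h x - f k x = (\<Sum>i. d (i + k) x)"
      using suminf_split_initial_segment[OF sd, of k] by (simp add: hx tele)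
    also have "\<bar>\<dots>\<bar> \<le> (\<Sum>i. \<bar>d (i + k) x\<bar>)"
      by (rule summable_rabs) (use sum_d in \<open>simp add: summable_iff_shift[of "\<lambda>k. \<bar>d k x\<bar>"]\<close>)
    also have "\<dots> \<le> (\<Sum>i. g x * (1/2) ^ k * (1/2) ^ i)"
    proof (rule suminf_le)
      show "\<bar>d (i + k) x\<bar> \<le> g x * (1/2) ^ k * (1/2) ^ i" for i
        using dk[of "i + k"] by (simp only: power_add mult_ac)
      show "summable (\<lambda>i. \<bar>d (i + k) x\<bar>)" using sum_d by (simp add: summable_iff_shift[of "\<lambda>k. \<bar>d k x\<bar>"])
      show "summable (\<lambda>i. g x * (1/2) ^ k * (1/2) ^ i)" by (intro summable_mult summable_geometric) simp
    qed
    also have "\<dots> = g x * (1/2) ^ k * 2"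
      by (subst suminf_mult) (auto simp: suminf_geometric summable_geometric)
    finally show ?thesis by (simp add: abs_minus_commute mult_ac)
  qed
  have AE_fin: "AE x in lborel. G x < \<infinity>"
    using nn_integral_PInf_AE[of G lborel] G_fin by (auto simp: less_top)
  have mass: "Lp_mass r (\<lambda>x. f k x - h x) \<le> ennreal (2 powr r * (1 / 2 powr r) ^ k) * (\<integral>\<^sup>+x. G x \<partial>lborel)" for k
  proof -
    have "Lp_mass r (\<lambda>x. f k x - h x) \<le> (\<integral>\<^sup>+x. ennreal (2 powr r * (1 / 2 powr r) ^ k) * G x \<partial>lborel)"
      unfolding Lp_mass_def
    proof (rule nn_integral_mono_AE, use AE_fin in eventually_elim)
      fix x assume fin: "G x < \<infinity>"
      have "\<bar>f k x - h x\<bar> powr r \<le> (2 * (1/2) ^ k * g x) powr r"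
        using r close[OF fin] by (intro powr_mono2) auto
      also have "\<dots> = 2 powr r * (1 / 2 powr r) ^ k * enn2real (G x)"
      proof -
        have "((1/2) ^ k) powr r = (1 / 2 powr r) ^ k"
          using pw[of k] by (simp add: power_divide powr_divide)
        moreover have "g x powr r = enn2real (G x)" using r by (simp add: g_def powr_powr)
        ultimately show ?thesis using g0[of x] by (simp add: powr_mult)
      qed
      finally have "ennreal (\<bar>f k x - h x\<bar> powr r) \<le> ennreal (2 powr r * (1 / 2 powr r) ^ k * enn2real (G x))"
        by (rule ennreal_leI)
      also have "\<dots> = ennreal (2 powr r * (1 / 2 powr r) ^ k) * G x"
        using fin by (subst ennreal_mult) auto
      finally show "ennreal (\<bar>f k x - h x\<bar> powr r) \<le> ennreal (2 powr r * (1 / 2 powr r) ^ k) * G x" .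
    qed
    then show ?thesis by (simp add: nn_integral_cmult)
  qed
  obtain I where I: "(\<integral>\<^sup>+x. G x \<partial>lborel) = ennreal I" "I \<ge> 0"
    using G_fin by (cases "\<integral>\<^sup>+x. G x \<partial>lborel") auto
  have "(\<lambda>k. (1 / 2 powr r) ^ k) \<longlonglongrightarrow> 0" by (rule LIMSEQ_realpow_zero[OF _ q]) simp
  then have "(\<lambda>k. ennreal (2 powr r * (1 / 2 powr r) ^ k * I)) \<longlonglongrightarrow> ennreal (2 powr r * 0 * I)"
    by (intro tendsto_ennrealI tendsto_mult tendsto_const)
  then have "(\<lambda>k. ennreal (2 powr r * (1 / 2 powr r) ^ k * I)) \<longlonglongrightarrow> 0" by simp
  then have "(\<lambda>k. Lp_mass r (\<lambda>x. f k x - h x)) \<longlonglongrightarrow> 0"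
    by (rule tendsto_sandwich[OF _ _ tendsto_const, rotated 2])
       (use mass I in \<open>auto simp: ennreal_mult intro!: always_eventually\<close>)
  then show ?thesis using that h_meas by blast
qed

lemma Lp_limit_of_Cauchy:
  fixes f :: "nat \<Rightarrow> real ^ 'n::finite \<Rightarrow> real"
  assumes [measurable]: "\<And>k. f k \<in> borel_measurable borel" and r: "r > 0"
    and Cauchy: "\<And>\<epsilon>. \<epsilon> > 0 \<Longrightarrow> \<exists>K. \<forall>k\<ge>K. \<forall>l\<ge>K. Lp_mass r (\<lambda>x. f k x - f l x) \<le> ennreal \<epsilon>"
  obtains h s where "h \<in> borel_measurable borel" "strict_mono (s :: nat \<Rightarrow> nat)"
    "(\<lambda>k. Lp_mass r (\<lambda>x. f (s k) x - h x)) \<longlonglongrightarrow> 0"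
proof -
  have "\<exists>K. \<forall>k\<ge>K. \<forall>l\<ge>K. Lp_mass r (\<lambda>x. f k x - f l x) \<le> ennreal ((1 / 4 powr r) ^ i)" for i :: nat
    by (rule Cauchy) simp
  then obtain K where K: "\<And>i k l. k \<ge> K i \<Longrightarrow> l \<ge> K i \<Longrightarrow>
      Lp_mass r (\<lambda>x. f k x - f l x) \<le> ennreal ((1 / 4 powr r) ^ i)"
    by metis
  \<comment> \<open>The first entry of the maximum makes s strictly increasing; the second keeps s i
    beyond K i, from where on all differences have mass at most 4^(-ri).\<close>
  define s where "s = rec_nat (K 0) (\<lambda>i si. max (Suc si) (K (Suc i)))"
  have s: "s (Suc i) = max (Suc (s i)) (K (Suc i))" "s 0 = K 0" for i by (auto simp: s_def)
  have mono: "strict_mono s" by (rule strict_mono_Suc_iff[THEN iffD2]) (auto simp: s)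
  have sK: "s i \<ge> K i" for i by (cases i) (auto simp: s)
  have "Lp_mass r (\<lambda>x. f (s (Suc i)) x - f (s i) x) \<le> ennreal ((1 / 4 powr r) ^ i)" for i
    using sK[of i] s(1)[of i] by (intro K) auto
  then obtain h where "h \<in> borel_measurable borel" "(\<lambda>k. Lp_mass r (\<lambda>x. f (s k) x - h x)) \<longlonglongrightarrow> 0"
    using Lp_limit_of_rapid_Cauchy[of "\<lambda>k. f (s k)" r] r by auto
  then show ?thesis using that mono by blast
qed

lemma locally_integrable_if_Lp_mass_finite:
  fixes f :: "real ^ 'n::finite \<Rightarrow> real"
  assumes [measurable]: "f \<in> borel_measurable borel" and r: "r \<ge> 1" and fin: "Lp_mass r f < \<infinity>"
  shows "locally_integrable f"
  unfolding locally_integrable_def set_integrable_def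
proof (intro conjI allI impI)
  fix K :: "(real ^ 'n) set" assume K: "compact K"
  then have [measurable]: "K \<in> sets borel" by (rule borel_compact)
  have "integrable lborel (\<lambda>x. \<bar>f x\<bar> powr r)"
    using fin by (intro integrableI_nonneg) (auto simp: Lp_mass_def)
  moreover have "integrable lborel (indicator K :: real ^ 'n \<Rightarrow> real)"
    using K emeasure_compact_finite[OF K] by (intro integrable_real_indicator) (auto simp: less_top)
  ultimately have int: "integrable lborel (\<lambda>x. indicator K x + \<bar>f x\<bar> powr r)" by (intro Bochner_Integration.integrable_add)
  have "\<bar>f x\<bar> \<le> 1 + \<bar>f x\<bar> powr r" for x
  proof (cases "\<bar>f x\<bar> \<le> 1")
    case False
    then have "\<bar>f x\<bar> powr 1 \<le> \<bar>f x\<bar> powr r" using r by (intro powr_mono) auto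
    then show ?thesis using False by simp
  qed (simp add: add_increasing2)
  then have ae: "AE x in lborel. norm (indicator K x *\<^sub>R f x) \<le> norm (indicator K x + \<bar>f x\<bar> powr r)"
    by (intro AE_I2) (auto simp: indicator_def)
  show "integrable lborel (\<lambda>x. indicator K x *\<^sub>R f x)"
    by (rule Bochner_Integration.integrable_bound[OF int _ ae]) measurable
qed simp

text \<open>Replaces Hoelder's inequality on bounded sets: values up to \<epsilon> contribute at
  most \<epsilon> times the volume, and larger ones are controlled by the r-th power.\<close>

lemma abs_le_powr_split:
  fixes t \<epsilon> r :: real
  assumes "\<epsilon> > 0" "r \<ge> 1"
  shows "\<bar>t\<bar> \<le> \<epsilon> + \<epsilon> powr (1 - r) * \<bar>t\<bar> powr r"
proof (cases "\<bar>t\<bar> \<le> \<epsilon>")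
  case False
  then have "\<bar>t\<bar> = \<bar>t\<bar> powr (1 - r) * \<bar>t\<bar> powr r" using assms by (simp flip: powr_add)
  also have "\<dots> \<le> \<epsilon> powr (1 - r) * \<bar>t\<bar> powr r"
    using assms False by (intro mult_right_mono powr_mono2') auto
  finally show ?thesis using assms by linarith
qed (simp add: add_increasing2)

text \<open>Convergence in L^r implies convergence in L^1 on the bounded set where \<psi> may be
  nonzero, and \<psi> is bounded.\<close>

lemma tendsto_integral_test_function:
  fixes f :: "nat \<Rightarrow> real ^ 'n::finite \<Rightarrow> real"
  assumes f: "\<And>k. locally_integrable (f k)" and h: "locally_integrable h"
    and r: "r \<ge> 1" and lim: "(\<lambda>k. Lp_mass r (\<lambda>x. f k x - h x)) \<longlonglongrightarrow> 0"
    and \<psi>: "\<psi> \<in> test_functions"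
  shows "(\<lambda>k. LINT x|lborel. f k x * \<psi> x) \<longlonglongrightarrow> (LINT x|lborel. h x * \<psi> x)"
proof -
  have [measurable]: "f k \<in> borel_measurable borel" "h \<in> borel_measurable borel" "\<psi> \<in> borel_measurable borel" for k
    using f h \<psi> by (auto intro: locally_integrable_measurable smooth_measurable test_functions_smooth)
  obtain B0 where B0: "\<And>x. \<bar>\<psi> x\<bar> \<le> B0" using test_functions_bounded[OF \<psi>] by blast
  define B where "B = max B0 1"
  have B: "B > 0" "\<And>x. \<bar>\<psi> x\<bar> \<le> B" using B0 by (auto simp: B_def intro: le_max_iff_disj[THEN iffD2])
  obtain R where R: "\<And>x. norm x > R \<Longrightarrow> \<psi> x = 0" using \<psi> by (auto simp: test_functions_iff)
  have [measurable]: "cball (0 :: real ^ 'n) R \<in> sets borel" by simp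
  define V where "V = measure lborel (cball (0 :: real ^ 'n) R)"
  have V: "emeasure lborel (cball (0 :: real ^ 'n) R) = ennreal V" "V \<ge> 0"
    unfolding V_def using emeasure_lborel_cball_finite[of "0 :: real ^ 'n" R]
    by (auto intro!: emeasure_eq_ennreal_measure)
  have "(\<lambda>k. (LINT x|lborel. f k x * \<psi> x) - (LINT x|lborel. h x * \<psi> x)) \<longlonglongrightarrow> 0"
  proof (rule LIMSEQ_I)
    fix e :: real assume e: "e > 0"
    \<comment> \<open>First \<epsilon> is fixed by the volume V, so that the small values contribute
      at most e/4; then \<eta> is chosen against the possibly large factor \<epsilon>^(1-r). Adding
      1 to V avoids division by 0.\<close>
    define \<epsilon> where "\<epsilon> = e / (4 * B * (V + 1))"
    have \<epsilon>: "\<epsilon> > 0" "B * (\<epsilon> * V) \<le> e / 4" using e B V by (auto simp: \<epsilon>_def field_simps add_pos_nonneg)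
    define \<eta> where "\<eta> = e / (4 * B * \<epsilon> powr (1 - r))"
    have \<eta>: "\<eta> > 0" "B * (\<epsilon> powr (1 - r) * \<eta>) = e / 4" using e B \<epsilon> by (auto simp: \<eta>_def)
    have "\<forall>\<^sub>F k in sequentially. Lp_mass r (\<lambda>x. f k x - h x) < ennreal \<eta>"
      using lim by (rule order_tendstoD) (use \<eta> in simp)
    then obtain K where K: "\<And>k. k \<ge> K \<Longrightarrow> Lp_mass r (\<lambda>x. f k x - h x) < ennreal \<eta>"
      unfolding eventually_sequentially by blast
    have "norm ((LINT x|lborel. f k x * \<psi> x) - (LINT x|lborel. h x * \<psi> x) - 0) < e" if "k \<ge> K" for k
    proof -
      have int: "integrable lborel (\<lambda>x. f k x * \<psi> x)" "integrable lborel (\<lambda>x. h x * \<psi> x)"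
        using f h \<psi> by (auto intro: integrable_mult_test_function)
      have eq: "(LINT x|lborel. f k x * \<psi> x) - (LINT x|lborel. h x * \<psi> x) = (LINT x|lborel. (f k x - h x) * \<psi> x)"
        using int by (simp add: left_diff_distrib)
      have "integrable lborel (\<lambda>x. (f k x - h x) * \<psi> x)" using int by (simp add: left_diff_distrib)
      from integral_norm_bound_ennreal[OF this]
      have "ennreal (norm (LINT x|lborel. (f k x - h x) * \<psi> x)) \<le> (\<integral>\<^sup>+x. ennreal (norm ((f k x - h x) * \<psi> x)) \<partial>lborel)" .
      also have "\<dots> \<le> (\<integral>\<^sup>+x. ennreal (B * \<epsilon>) * indicator (cball 0 R) x
            + ennreal (B * \<epsilon> powr (1 - r)) * ennreal (\<bar>f k x - h x\<bar> powr r) \<partial>lborel)"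
      proof (rule nn_integral_mono)
        fix x :: "real ^ 'n"
        show "ennreal (norm ((f k x - h x) * \<psi> x)) \<le> ennreal (B * \<epsilon>) * indicator (cball 0 R) x
            + ennreal (B * \<epsilon> powr (1 - r)) * ennreal (\<bar>f k x - h x\<bar> powr r)"
        proof (cases "norm x > R")
          case False
          have "norm ((f k x - h x) * \<psi> x) \<le> \<bar>f k x - h x\<bar> * B"
            by (simp add: abs_mult B mult_left_mono)
          also have "\<dots> \<le> (\<epsilon> + \<epsilon> powr (1 - r) * \<bar>f k x - h x\<bar> powr r) * B"
            using B \<epsilon> r by (intro mult_right_mono abs_le_powr_split) auto
          finally show ?thesis using False B \<epsilon>
            by (simp add: ennreal_leI algebra_simps flip: ennreal_mult ennreal_plus)
        qed (simp add: R)
      qed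
      also have "\<dots> = ennreal (B * \<epsilon>) * ennreal V + ennreal (B * \<epsilon> powr (1 - r)) * Lp_mass r (\<lambda>x. f k x - h x)"
        by (subst nn_integral_add; (measurable)?) (simp_all add: nn_integral_cmult Lp_mass_def nn_integral_cmult_indicator V)
      also have "\<dots> \<le> ennreal (B * \<epsilon>) * ennreal V + ennreal (B * \<epsilon> powr (1 - r)) * ennreal \<eta>"
        using K[OF that] by (intro add_left_mono mult_left_mono) auto
      also have "\<dots> = ennreal (B * (\<epsilon> * V) + B * (\<epsilon> powr (1 - r) * \<eta>))"
        using B \<epsilon> V \<eta>(1) by (simp add: mult_ac flip: ennreal_mult ennreal_plus)
      finally have "norm (LINT x|lborel. (f k x - h x) * \<psi> x) \<le> B * (\<epsilon> * V) + B * (\<epsilon> powr (1 - r) * \<eta>)"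
        using B \<epsilon> V \<eta>(1) by (subst (asm) ennreal_le_iff) auto
      then show ?thesis unfolding eq using \<epsilon> \<eta> e by simp
    qed
    then show "\<exists>K. \<forall>k\<ge>K. norm ((LINT x|lborel. f k x * \<psi> x) - (LINT x|lborel. h x * \<psi> x) - 0) < e" by blast
  qed
  then show ?thesis by (simp add: LIM_zero_iff)
qed

section \<open>Critical exponents and derivatives of intermediate order\<close>

lemma pstar_0: "N > 0 \<Longrightarrow> pstar N p 0 = p"
  by (simp add: pstar_def)

lemma pstar_gt_1:
  assumes "1 < p" "real s * p < real N"
  shows "pstar N p s > 1"
proof -
  have "real s * p \<ge> 0" using assms by simp
  then have N: "real N > 0" "real N - real s * p \<le> real N" using assms by linarith+
  note N(2)
  also have "\<dots> < p * real N" using mult_strict_right_mono[OF assms(1) N(1)] by simp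
  finally show ?thesis using assms by (simp add: pstar_def)
qed

text \<open>Since 1/p*_s = 1/p - s/N, passing from s to s + 1 is exactly the change of exponent in
  one application of the Gagliardo-Nirenberg inequality.\<close>

lemma pstar_Suc:
  assumes "1 < p" "real (Suc s) * p < real N"
  shows "pstar N p s < real N" "pstar N p s * real N / (real N - pstar N p s) = pstar N p (Suc s)"
proof -
  have D: "real N - real s * p > p" using assms by (simp add: algebra_simps)
  moreover have "real s * p \<ge> 0" using assms by simp
  ultimately have "real N > 0" using assms by linarith
  then have "N > 0" by simp
  then show "pstar N p s < real N" using D assms by (simp add: pstar_def pos_divide_less_eq mult.commute)
  define E where "E = real N - real s * p"
  have E: "E > p" "E > 0" using D assms by (auto simp: E_def)
  have "real N - p * real N / E = real N * (E - p) / E"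
    using E by (simp add: field_simps)
  moreover have "pstar N p (Suc s) = p * real N / (E - p)"
    by (simp add: pstar_def E_def algebra_simps)
  moreover have "pstar N p s = p * real N / E" by (simp add: pstar_def E_def)
  ultimately show "pstar N p s * real N / (real N - pstar N p s) = pstar N p (Suc s)"
    using E \<open>N > 0\<close> by simp
qed

text \<open>Induction on the number s of orders given up: the first partial derivatives of a
  derivative of order m - (s + 1) have order m - s, so \<open>gagliardo_nirenberg\<close> composes
  with the induction hypothesis.\<close>

lemma sobolev_test_functions:
  fixes p :: real
  assumes p: "1 < p" "real m * p < real CARD('n::finite)" and "s \<le> m" "\<epsilon> > 0"
  shows "\<exists>\<delta>>0. \<forall>\<phi>::real^'n \<Rightarrow> real. \<phi> \<in> test_functions \<longrightarrow>
    (\<forall>\<alpha>. mi_order \<alpha> = m \<longrightarrow> Lp_mass p (mi_partial \<alpha> \<phi>) \<le> ennreal \<delta>) \<longrightarrow>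
    (\<forall>\<beta>. mi_order \<beta> = m - s \<longrightarrow> Lp_mass (pstar CARD('n) p s) (mi_partial \<beta> \<phi>) \<le> ennreal \<epsilon>)"
  using assms(3,4)
proof (induction s arbitrary: \<epsilon>)
  case 0
  then show ?case using pstar_0[of "CARD('n)" p] by (intro exI[of _ \<epsilon>]) auto
next
  case (Suc s)
  have "real (Suc s) * p \<le> real m * p" using Suc.prems p by (intro mult_right_mono) auto
  then have sp: "real (Suc s) * p < real CARD('n)" using p by linarith
  have "1 < pstar CARD('n) p s" using sp p by (intro pstar_gt_1) (auto simp: algebra_simps)
  from gagliardo_nirenberg[OF this pstar_Suc(1)[OF p(1) sp] \<open>\<epsilon> > 0\<close>]
  obtain \<delta>' where \<delta>': "\<delta>' > 0" "\<And>f::real^'n \<Rightarrow> real. f \<in> test_functions \<Longrightarrow>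
      (\<And>i. Lp_mass (pstar CARD('n) p s) (partial i f) \<le> ennreal \<delta>') \<Longrightarrow>
      Lp_mass (pstar CARD('n) p (Suc s)) f \<le> ennreal \<epsilon>"
    unfolding pstar_Suc(2)[OF p(1) sp] by blast
  obtain \<delta> where \<delta>: "\<delta> > 0" "\<And>(\<phi>::real^'n \<Rightarrow> real) \<beta>. \<phi> \<in> test_functions \<Longrightarrow>
    (\<forall>\<alpha>. mi_order \<alpha> = m \<longrightarrow> Lp_mass p (mi_partial \<alpha> \<phi>) \<le> ennreal \<delta>) \<Longrightarrow>
    mi_order \<beta> = m - s \<Longrightarrow> Lp_mass (pstar CARD('n) p s) (mi_partial \<beta> \<phi>) \<le> ennreal \<delta>'"
    using Suc.IH[of \<delta>'] Suc.prems \<delta>' by auto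
  show ?case
  proof (intro exI[of _ \<delta>] conjI allI impI \<delta>)
    fix \<phi> :: "real^'n \<Rightarrow> real" and \<beta> :: "'n \<Rightarrow> nat"
    assume \<phi>: "\<phi> \<in> test_functions" "\<forall>\<alpha>. mi_order \<alpha> = m \<longrightarrow> Lp_mass p (mi_partial \<alpha> \<phi>) \<le> ennreal \<delta>"
      and \<beta>: "mi_order \<beta> = m - Suc s"
    show "Lp_mass (pstar CARD('n) p (Suc s)) (mi_partial \<beta> \<phi>) \<le> ennreal \<epsilon>"
    proof (rule \<delta>'(2))
      show "mi_partial \<beta> \<phi> \<in> test_functions" using \<phi>(1) by (rule test_functions_mi_partial)
      fix i
      show "Lp_mass (pstar CARD('n) p s) (partial i (mi_partial \<beta> \<phi>)) \<le> ennreal \<delta>'"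
        unfolding partial_mi_partial[OF test_functions_smooth[OF \<phi>(1)]]
        using \<phi> \<beta> Suc.prems by (intro \<delta>) (auto simp: mi_order_upd_Suc)
    qed
  qed
qed

lemma Lp_norm_UNIV: "Lp_norm p UNIV f = enn_powr (Lp_mass p f) (1 / p)"
  by (simp add: Lp_norm_def Lp_mass_def)

lemma Lp_mass_le_Wdot_norm:
  fixes u :: "real ^ 'n::finite \<Rightarrow> real"
  assumes "mi_order \<alpha> = k" "q > 0"
  shows "Lp_mass q (weak_deriv \<alpha> u) \<le> enn_powr (Wdot_norm k q UNIV u) q"
proof -
  have "Lp_mass q (weak_deriv \<alpha> u) \<le> (\<Sum>\<alpha> | mi_order \<alpha> = k. Lp_mass q (weak_deriv \<alpha> u))"
    using assms by (intro member_le_sum finite_mi_order) auto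
  also have "\<dots> = enn_powr (Wdot_norm k q UNIV u) q"
    using assms by (simp add: Wdot_norm_def enn_powr_powr Lp_norm_UNIV)
  finally show ?thesis .
qed

lemma enn_powr_tendsto_0:
  assumes "a \<longlonglongrightarrow> 0" "q > 0"
  shows "(\<lambda>k. enn_powr (a k) q) \<longlonglongrightarrow> 0"
proof (rule order_tendstoI)
  fix y :: ennreal assume "0 < y"
  then obtain e where e: "e > 0" "ennreal e < y" by (metis ennreal_less_zero_iff ennreal_rat_dense)
  have "\<forall>\<^sub>F k in sequentially. a k < ennreal (e powr (1/q))"
    using assms(1) by (rule order_tendstoD) (use e in simp)
  then show "\<forall>\<^sub>F k in sequentially. enn_powr (a k) q < y"
  proof eventually_elim
    case (elim k)
    have "enn_powr (a k) q \<le> enn_powr (ennreal (e powr (1/q))) q"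
      using elim assms by (intro enn_powr_mono) auto
    also have "\<dots> = ennreal e" using e assms by (simp add: powr_powr)
    finally show ?case using e by simp
  qed
qed simp

lemma mi_partial_diff:
  assumes "smooth f" "smooth g"
  shows "mi_partial \<alpha> (\<lambda>x. f x - g x) = (\<lambda>x. mi_partial \<alpha> f x - mi_partial \<alpha> g x)"
  using partials_lincomb[OF assms, of "mi_list \<alpha>" 1 "-1"] by (simp add: mi_partial_eq)

lemma ex_mi_order: "\<exists>\<alpha> :: 'n::finite \<Rightarrow> nat. mi_order \<alpha> = m"
proof
  fix i :: 'n
  show "mi_order ((\<lambda>_. 0)(i := m)) = m" by (simp add: mi_order_def sum.remove[of UNIV i])
qed

text \<open>The \<beta>-derivatives of the approximating test functions form a Cauchy sequence in
  L^q, and a subsequence has a limit h there. The integration by parts formula passes to the limit: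
  its left side by convergence of the functions in the critical Lebesgue space, its right side by
  convergence of the derivatives in L^q.\<close>

lemma Wdot_has_weak_deriv:
  fixes u :: "real ^ 'n::finite \<Rightarrow> real"
  assumes p: "1 < p" "real m * p < real CARD('n)" and u: "u \<in> Wdot m p" and \<beta>: "mi_order \<beta> \<le> m"
  obtains v where "has_weak_deriv \<beta> u v" "Lp_mass (pstar CARD('n) p (m - mi_order \<beta>)) v < \<infinity>"
proof -
  define q where "q = pstar CARD('n) p (m - mi_order \<beta>)"
  define ps where "ps = pstar CARD('n) p m"
  have "real (m - mi_order \<beta>) * p \<le> real m * p" using p by (intro mult_right_mono) auto
  then have "real (m - mi_order \<beta>) * p < real CARD('n)" using p by linarith
  then have q: "q > 1" using p unfolding q_def by (intro pstar_gt_1)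
  have ps: "ps > 1" using p unfolding ps_def by (intro pstar_gt_1) auto
  obtain \<phi> where \<phi>: "\<And>k. \<phi> k \<in> test_functions"
    "(\<lambda>k. Wdot_norm m p UNIV (\<lambda>x. u x - \<phi> k x)) \<longlonglongrightarrow> 0" "(\<lambda>k. Lp_norm ps UNIV (\<lambda>x. u x - \<phi> k x)) \<longlonglongrightarrow> 0"
    using u unfolding Wdot_def ps_def by blast
  define v where "v \<alpha> = weak_deriv \<alpha> u" for \<alpha>
  have v: "has_weak_deriv \<alpha> u (v \<alpha>)" if "mi_order \<alpha> = m" for \<alpha>
    using u that has_weak_deriv_weak_deriv unfolding Wdot_def v_def by blast
  have u_loc: "locally_integrable u" using v ex_mi_order[where 'n='n, of m] by (auto simp: has_weak_deriv_def)
  have v_meas: "v \<alpha> \<in> borel_measurable borel" if "mi_order \<alpha> = m" for \<alpha>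
    using v[OF that] by (rule has_weak_deriv_measurable)
  have \<phi>_meas: "mi_partial \<alpha> (\<phi> k) \<in> borel_measurable borel" for \<alpha> k
    using \<phi>(1) by (intro smooth_measurable test_functions_smooth test_functions_mi_partial)
  have lim_v: "(\<lambda>k. Lp_mass p (\<lambda>x. v \<alpha> x - mi_partial \<alpha> (\<phi> k) x)) \<longlonglongrightarrow> 0" if \<alpha>: "mi_order \<alpha> = m" for \<alpha>
  proof (rule tendsto_sandwich[OF _ _ tendsto_const])
    show "(\<lambda>k. enn_powr (Wdot_norm m p UNIV (\<lambda>x. u x - \<phi> k x)) p) \<longlonglongrightarrow> 0"
      using \<phi>(2) p by (intro enn_powr_tendsto_0) auto
    have "has_weak_deriv \<alpha> (\<lambda>x. u x - \<phi> k x) (\<lambda>x. v \<alpha> x - mi_partial \<alpha> (\<phi> k) x)" for k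
      using has_weak_deriv_lincomb[OF v[OF \<alpha>] has_weak_deriv_test_function[OF \<phi>(1)], of 1 "-1"] by simp
    then have "Lp_mass p (\<lambda>x. v \<alpha> x - mi_partial \<alpha> (\<phi> k) x) = Lp_mass p (weak_deriv \<alpha> (\<lambda>x. u x - \<phi> k x))" for k
      by (intro Lp_mass_cong_AE[OF weak_deriv_AE_eq, symmetric])
    then show "\<forall>\<^sub>F k in sequentially. Lp_mass p (\<lambda>x. v \<alpha> x - mi_partial \<alpha> (\<phi> k) x)
        \<le> enn_powr (Wdot_norm m p UNIV (\<lambda>x. u x - \<phi> k x)) p"
      using Lp_mass_le_Wdot_norm[OF \<alpha>, of p] p by simp
  qed simp
  have Cauchy: "\<exists>K. \<forall>k\<ge>K. \<forall>l\<ge>K. Lp_mass q (\<lambda>x. mi_partial \<beta> (\<phi> k) x - mi_partial \<beta> (\<phi> l) x) \<le> ennreal \<epsilon>"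
    if eps: "\<epsilon> > 0" for \<epsilon>
  proof -
    have "mi_order \<beta> = m - (m - mi_order \<beta>)" using \<beta> by simp
    then obtain \<delta> where \<delta>: "\<delta> > 0" "\<And>\<phi>::real^'n \<Rightarrow> real. \<phi> \<in> test_functions \<Longrightarrow>
      (\<And>\<alpha>. mi_order \<alpha> = m \<Longrightarrow> Lp_mass p (mi_partial \<alpha> \<phi>) \<le> ennreal \<delta>) \<Longrightarrow>
      Lp_mass q (mi_partial \<beta> \<phi>) \<le> ennreal \<epsilon>"
      using sobolev_test_functions[OF p diff_le_self eps, of "mi_order \<beta>"] unfolding q_def by metis
    \<comment> \<open>Two errors of mass \<eta>, one for each of the functions \<phi> k and \<phi> l
      compared with v, combine to \<delta> in \<open>Lp_mass_diff_le\<close>.\<close>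
    define \<eta> where "\<eta> = \<delta> / (2 * 2 powr p)"
    have \<eta>: "\<eta> > 0" "2 powr p * (\<eta> + \<eta>) = \<delta>" using \<delta>(1) by (auto simp: \<eta>_def)
    have "\<forall>\<^sub>F k in sequentially. \<forall>\<alpha>\<in>{\<alpha>. mi_order \<alpha> = m}. Lp_mass p (\<lambda>x. v \<alpha> x - mi_partial \<alpha> (\<phi> k) x) < ennreal \<eta>"
      using \<eta> by (intro eventually_ball_finite finite_mi_order ballI order_tendstoD(2)[OF lim_v]) auto
    then obtain K where K: "\<And>k \<alpha>. k \<ge> K \<Longrightarrow> mi_order \<alpha> = m \<Longrightarrow> Lp_mass p (\<lambda>x. v \<alpha> x - mi_partial \<alpha> (\<phi> k) x) < ennreal \<eta>"
      unfolding eventually_sequentially by auto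
    have "Lp_mass q (\<lambda>x. mi_partial \<beta> (\<phi> k) x - mi_partial \<beta> (\<phi> l) x) \<le> ennreal \<epsilon>" if "k \<ge> K" "l \<ge> K" for k l
    proof -
      have "(\<lambda>x. \<phi> k x - \<phi> l x) \<in> test_functions" using test_functions_lincomb[OF \<phi>(1) \<phi>(1), of 1 k "-1" l] by simp
      then have "Lp_mass q (mi_partial \<beta> (\<lambda>x. \<phi> k x - \<phi> l x)) \<le> ennreal \<epsilon>"
      proof (rule \<delta>(2))
        fix \<alpha> :: "'n \<Rightarrow> nat" assume \<alpha>: "mi_order \<alpha> = m"
        have "mi_partial \<alpha> (\<lambda>x. \<phi> k x - \<phi> l x)
            = (\<lambda>x. (v \<alpha> x - mi_partial \<alpha> (\<phi> l) x) - (v \<alpha> x - mi_partial \<alpha> (\<phi> k) x))"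
          using \<phi>(1) by (simp add: mi_partial_diff test_functions_smooth)
        then have "Lp_mass p (mi_partial \<alpha> (\<lambda>x. \<phi> k x - \<phi> l x))
          \<le> ennreal (2 powr p) * (Lp_mass p (\<lambda>x. v \<alpha> x - mi_partial \<alpha> (\<phi> l) x) + Lp_mass p (\<lambda>x. v \<alpha> x - mi_partial \<alpha> (\<phi> k) x))"
          using v_meas[OF \<alpha>] \<phi>_meas p by (simp only:) (intro Lp_mass_diff_le borel_measurable_diff, auto)
        also have "\<dots> \<le> ennreal (2 powr p) * (ennreal \<eta> + ennreal \<eta>)"
          using K[OF _ \<alpha>] that by (intro mult_left_mono add_mono) (auto intro: less_imp_le)
        also have "\<dots> = ennreal \<delta>" using \<eta> by (simp flip: ennreal_plus ennreal_mult)
        finally show "Lp_mass p (mi_partial \<alpha> (\<lambda>x. \<phi> k x - \<phi> l x)) \<le> ennreal \<delta>" .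
      qed
      then show ?thesis using \<phi>(1) by (simp add: mi_partial_diff test_functions_smooth)
    qed
    then show ?thesis by blast
  qed
  obtain h s where h: "h \<in> borel_measurable borel" "strict_mono (s :: nat \<Rightarrow> nat)"
    "(\<lambda>k. Lp_mass q (\<lambda>x. mi_partial \<beta> (\<phi> (s k)) x - h x)) \<longlonglongrightarrow> 0"
    using Lp_limit_of_Cauchy[of "\<lambda>k. mi_partial \<beta> (\<phi> k)" q, OF \<phi>_meas _ Cauchy] q by auto
  have h_fin: "Lp_mass q h < \<infinity>"
  proof -
    have "\<forall>\<^sub>F k in sequentially. Lp_mass q (\<lambda>x. mi_partial \<beta> (\<phi> (s k)) x - h x) < 1"
      using h(3) by (rule order_tendstoD) simp
    then obtain k where k: "Lp_mass q (\<lambda>x. mi_partial \<beta> (\<phi> (s k)) x - h x) < 1"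
      by (meson eventually_happens sequentially_bot)
    have "Lp_mass q h = Lp_mass q (\<lambda>x. mi_partial \<beta> (\<phi> (s k)) x - (mi_partial \<beta> (\<phi> (s k)) x - h x))" by simp
    also have "\<dots> \<le> ennreal (2 powr q) * (Lp_mass q (mi_partial \<beta> (\<phi> (s k))) + Lp_mass q (\<lambda>x. mi_partial \<beta> (\<phi> (s k)) x - h x))"
      using \<phi>_meas h q by (intro Lp_mass_diff_le borel_measurable_diff) auto
    also have "\<dots> < \<infinity>"
      using k Lp_mass_test_functions_finite[OF test_functions_mi_partial[OF \<phi>(1)], of q \<beta> "s k"] q
      by (auto simp: ennreal_mult_less_top intro: less_trans)
    finally show ?thesis .
  qed
  have h_loc: "locally_integrable h" using h q h_fin by (intro locally_integrable_if_Lp_mass_finite) auto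
  have "has_weak_deriv \<beta> u h"
    unfolding has_weak_deriv_def
  proof (intro conjI ballI u_loc h_loc)
    fix \<psi> :: "real ^ 'n \<Rightarrow> real" assume \<psi>: "\<psi> \<in> test_functions"
    have \<phi>_loc: "locally_integrable (\<phi> k)" "locally_integrable (mi_partial \<beta> (\<phi> k))" for k
      using \<phi>(1) by (auto intro!: locally_integrable_continuous smooth_continuous_on test_functions_smooth test_functions_mi_partial)
    have "(\<lambda>k. enn_powr (Lp_norm ps UNIV (\<lambda>x. u x - \<phi> k x)) ps) \<longlonglongrightarrow> 0"
      using \<phi>(3) ps by (intro enn_powr_tendsto_0) auto
    then have "(\<lambda>k. Lp_mass ps (\<lambda>x. \<phi> k x - u x)) \<longlonglongrightarrow> 0"
      using ps by (simp add: Lp_norm_UNIV enn_powr_powr Lp_mass_minus_commute[of ps u])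
    then have "(\<lambda>k. Lp_mass ps (\<lambda>x. \<phi> (s k) x - u x)) \<longlonglongrightarrow> 0"
      using LIMSEQ_subseq_LIMSEQ[OF _ h(2)] by (fastforce simp: o_def)
    then have lim_u: "(\<lambda>k. LINT x|lborel. \<phi> (s k) x * mi_partial \<beta> \<psi> x) \<longlonglongrightarrow> (LINT x|lborel. u x * mi_partial \<beta> \<psi> x)"
      using ps by (intro tendsto_integral_test_function[where r=ps] \<phi>_loc u_loc test_functions_mi_partial \<psi>) auto
    have parts: "(LINT x|lborel. \<phi> (s k) x * mi_partial \<beta> \<psi> x)
        = (- 1) ^ mi_order \<beta> * (LINT x|lborel. mi_partial \<beta> (\<phi> (s k)) x * \<psi> x)" for k
      using \<phi>(1) \<psi> by (intro integral_by_parts_mi_partial test_functions_smooth)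
    have lim_h: "(\<lambda>k. (- 1) ^ mi_order \<beta> * (LINT x|lborel. mi_partial \<beta> (\<phi> (s k)) x * \<psi> x))
        \<longlonglongrightarrow> (- 1) ^ mi_order \<beta> * (LINT x|lborel. h x * \<psi> x)"
      using q by (intro tendsto_mult tendsto_const tendsto_integral_test_function[where r=q] \<phi>_loc h_loc h(3) \<psi>) auto
    show "(LINT x|lborel. u x * mi_partial \<beta> \<psi> x) = (- 1) ^ mi_order \<beta> * (LINT x|lborel. h x * \<psi> x)"
      using lim_u lim_h unfolding parts by (rule LIMSEQ_unique)
  qed
  then show ?thesis using that h_fin by (auto simp: q_def)
qed

section \<open>Rescaled profiles\<close>

text \<open>\<open>dilate\<close> with the exponent as a parameter: the \<alpha>-derivative of a
  dilated profile is the \<alpha>-derivative of the profile rescaled with q in place of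
  p*_m.\<close>

definition rescale :: "real \<Rightarrow> int \<Rightarrow> real ^ 'n \<Rightarrow> (real ^ 'n \<Rightarrow> real) \<Rightarrow> real ^ 'n \<Rightarrow> real" where
  "rescale q j y W x = 2 powr (real_of_int j * real CARD('n) / q) * W ((2 powr real_of_int j) *\<^sub>R (x - y))"

lemma dilate_eq_rescale: "dilate m p j y w = rescale (pstar CARD('n) p m) j y w"
  for y :: "real ^ 'n"
  by (simp add: fun_eq_iff dilate_def rescale_def)

lemma rescale_affine:
  "rescale q j y W x = 2 powr (real_of_int j * real CARD('n) / q)
     * W (- ((2 powr real_of_int j) *\<^sub>R y) + (2 powr real_of_int j) *\<^sub>R x)"
  for y :: "real ^ 'n"
  by (simp add: rescale_def algebra_simps)

lemma measurable_rescale [measurable]: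
  assumes [measurable]: "W \<in> borel_measurable borel"
  shows "rescale q j y W \<in> borel_measurable borel"
proof -
  have "(\<lambda>x. W ((2 powr real_of_int j) *\<^sub>R (x - y))) \<in> borel_measurable borel" by measurable
  then show ?thesis unfolding rescale_def[abs_def] by (intro borel_measurable_times borel_measurable_const)
qed

lemma scale_power_card:
  "(2 powr real_of_int j) ^ n = 2 powr (real_of_int j * real n)"
  by (simp add: powr_power mult.commute)

lemma Lp_mass_rescale:
  fixes W :: "real ^ 'n::finite \<Rightarrow> real"
  assumes [measurable]: "W \<in> borel_measurable borel" and q: "q > 0"
  shows "Lp_mass q (rescale q j y W) = Lp_mass q W"
proof -
  let ?a = "2 powr (real_of_int j * real CARD('n))"
  have "Lp_mass q (rescale q j y W) = ennreal ?a *
      (\<integral>\<^sup>+x. ennreal (\<bar>W (- ((2 powr real_of_int j) *\<^sub>R y) + (2 powr real_of_int j) *\<^sub>R x)\<bar> powr q) \<partial>lborel)"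
    using q by (simp add: Lp_mass_def rescale_affine abs_mult powr_mult powr_powr ennreal_mult nn_integral_cmult)
  also have "\<dots> = ennreal ?a * (ennreal (1 / ?a) * Lp_mass q W)"
    by (subst nn_integral_lborel_affine[where f="\<lambda>x. ennreal (\<bar>W x\<bar> powr q)"])
       (simp_all add: Lp_mass_def scale_power_card)
  also have "\<dots> = Lp_mass q W"
    by (simp add: mult.assoc[symmetric] flip: ennreal_mult)
  finally show ?thesis .
qed

text \<open>Each derivative contributes a factor 2^j, and N/p*_s = N/p - s, so N/p*_m + |\<alpha>|
  is N/p*_{m-|\<alpha>|}.\<close>

lemma has_weak_deriv_dilate:
  fixes w v :: "real ^ 'n::finite \<Rightarrow> real"
  assumes w: "has_weak_deriv \<alpha> w v" and p: "p > 0" and \<alpha>: "mi_order \<alpha> \<le> m"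
  shows "has_weak_deriv \<alpha> (dilate m p j y w) (rescale (pstar CARD('n) p (m - mi_order \<alpha>)) j y v)"
proof -
  let ?N = "real CARD('n)"
  have inv: "?N / pstar CARD('n) p s = ?N / p - real s" for s
    using p by (simp add: pstar_def field_simps)
  have "real_of_int j * ?N / pstar CARD('n) p m + real_of_int j * real (mi_order \<alpha>)
      = real_of_int j * ?N / pstar CARD('n) p (m - mi_order \<alpha>)"
    using \<alpha> by (simp add: inv of_nat_diff right_diff_distrib flip: times_divide_eq_right)
  then have e: "2 powr (real_of_int j * ?N / pstar CARD('n) p m) * (2 powr real_of_int j) ^ mi_order \<alpha>
      = 2 powr (real_of_int j * ?N / pstar CARD('n) p (m - mi_order \<alpha>))"
    unfolding scale_power_card by (simp flip: powr_add)
  have "has_weak_deriv \<alpha> (\<lambda>x. w (- ((2 powr real_of_int j) *\<^sub>R y) + (2 powr real_of_int j) *\<^sub>R x))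
     (\<lambda>x. (2 powr real_of_int j) ^ mi_order \<alpha> * v (- ((2 powr real_of_int j) *\<^sub>R y) + (2 powr real_of_int j) *\<^sub>R x))"
    using w by (rule has_weak_deriv_affine) simp
  from has_weak_deriv_lincomb[OF this this, of "2 powr (real_of_int j * ?N / pstar CARD('n) p m)" 0]
  show ?thesis
    unfolding dilate_eq_rescale rescale_affine[abs_def] by (simp add: mult.assoc[symmetric] e)
qed

section \<open>Overlap of profiles that drift apart\<close>

lemma Lp_mass_truncation:
  fixes W :: "real ^ 'n::finite \<Rightarrow> real"
  assumes [measurable]: "W \<in> borel_measurable borel" and fin: "Lp_mass q W < \<infinity>"
  shows "(\<lambda>n. Lp_mass q (\<lambda>x. if norm x \<le> real n \<and> \<bar>W x\<bar> \<le> real n then 0 else W x)) \<longlonglongrightarrow> 0"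
proof -
  let ?B = "\<lambda>n x. if norm x \<le> real n \<and> \<bar>W x\<bar> \<le> real n then 0 else W x"
  have "(\<lambda>n. \<integral>\<^sup>+x. ennreal (\<bar>?B n x\<bar> powr q) \<partial>lborel) \<longlonglongrightarrow> (\<integral>\<^sup>+x. 0 \<partial>(lborel :: (real ^ 'n) measure))"
  proof (rule nn_integral_dominated_convergence[where w="\<lambda>x. ennreal (\<bar>W x\<bar> powr q)"])
    show "AE x in lborel. (\<lambda>n. ennreal (\<bar>?B n x\<bar> powr q)) \<longlonglongrightarrow> 0"
    proof (intro AE_I2 tendsto_eventually)
      fix x
      obtain n0 where "max (norm x) \<bar>W x\<bar> \<le> real n0" using real_arch_simple by blast
      then show "\<forall>\<^sub>F n in sequentially. ennreal (\<bar>?B n x\<bar> powr q) = 0"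
        by (intro eventually_sequentiallyI[of n0]) (auto simp: of_nat_le_iff[symmetric] simp del: of_nat_le_iff)
    qed
  qed (use fin in \<open>auto simp: Lp_mass_def\<close>)
  then show ?thesis by (simp add: Lp_mass_def)
qed

text \<open>The minimum, unlike a product of powers, is dominated by either function alone.
  Truncating both functions therefore costs only the sum of the masses cut off.\<close>

definition overlap_mass :: "real \<Rightarrow> (real ^ 'n \<Rightarrow> real) \<Rightarrow> (real ^ 'n \<Rightarrow> real) \<Rightarrow> ennreal" where
  "overlap_mass q f g = (\<integral>\<^sup>+x. ennreal ((min \<bar>f x\<bar> \<bar>g x\<bar>) powr q) \<partial>lborel)"

lemma emeasure_rescaled_ball:
  fixes y :: "real ^ 'n::finite"
  shows "emeasure lborel (cball y (2 powr (- real_of_int j) * R))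
    = ennreal (2 powr (- real_of_int j * real CARD('n))) * emeasure lborel (cball (0 :: real ^ 'n) R)"
proof -
  let ?c = "2 powr real_of_int j"
  have [measurable]: "cball (0 :: real ^ 'n) R \<in> sets borel" by simp
  have "emeasure lborel (cball y (2 powr (- real_of_int j) * R))
      = (\<integral>\<^sup>+x. indicator (cball 0 R) (- (?c *\<^sub>R y) + ?c *\<^sub>R x) \<partial>lborel)"
  proof (subst nn_integral_indicator[symmetric], simp, intro nn_integral_cong)
    fix x
    have "norm (- (?c *\<^sub>R y) + ?c *\<^sub>R x) = ?c * dist y x"
      by (simp add: dist_norm norm_minus_commute flip: scaleR_diff_right norm_scaleR[of ?c, simplified])
    then show "indicator (cball y (2 powr (- real_of_int j) * R)) x
        = (indicator (cball 0 R) (- (?c *\<^sub>R y) + ?c *\<^sub>R x) :: ennreal)"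
      by (simp add: indicator_def powr_minus field_simps)
  qed
  also have "\<dots> = ennreal (1 / ?c ^ CARD('n)) * emeasure lborel (cball (0 :: real ^ 'n) R)"
    by (subst nn_integral_lborel_affine[where f="indicator (cball 0 R)"]) auto
  also have "1 / ?c ^ CARD('n) = 2 powr (- real_of_int j * real CARD('n))"
    by (simp add: scale_power_card powr_minus_divide)
  finally show ?thesis .
qed

text \<open>Of two pieces at different scales, the coarser one is low and the finer one has a
  support of small volume; height times volume decays with the gap between the scales. If the
  centres are far apart compared with both radii, the supports are disjoint.\<close>

lemma overlap_mass_bounded_pieces:
  fixes A A' :: "real ^ 'n::finite \<Rightarrow> real"
  assumes q: "q > 0" and R: "R \<ge> 0"
    and A: "\<And>x. \<bar>A x\<bar> \<le> R" "\<And>x. norm x > R \<Longrightarrow> A x = 0"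
    and A': "\<And>x. \<bar>A' x\<bar> \<le> R" "\<And>x. norm x > R \<Longrightarrow> A' x = 0"
  shows "overlap_mass q (rescale q j y A) (rescale q j' y' A')
    \<le> ennreal (R powr q * 2 powr (- \<bar>real_of_int (j - j')\<bar> * real CARD('n))) * emeasure lborel (cball (0 :: real ^ 'n) R)"
    and "2 powr real_of_int j' * norm (y - y') > R * (1 + 2 powr \<bar>real_of_int (j - j')\<bar>) \<Longrightarrow>
      overlap_mass q (rescale q j y A) (rescale q j' y' A') = 0"
proof -
  have supp: "rescale q j y A x = 0" if "x \<notin> cball y (2 powr (- real_of_int j) * R)" "\<And>x. norm x > R \<Longrightarrow> A x = 0"
    for A x j and y :: "real ^ 'n"
  proof -
    have "2 powr real_of_int j * dist y x > R" using that(1) by (simp add: powr_minus field_simps not_le)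
    then have "norm ((2 powr real_of_int j) *\<^sub>R (x - y)) > R" by (simp add: dist_norm norm_minus_commute)
    then show ?thesis using that(2) by (simp add: rescale_def)
  qed
  have bd: "\<bar>rescale q j y A x\<bar> powr q \<le> R powr q * 2 powr (real_of_int j * real CARD('n))" if "\<And>x. \<bar>A x\<bar> \<le> R"
    for A x j and y :: "real ^ 'n"
  proof -
    have "\<bar>rescale q j y A x\<bar> powr q \<le> (2 powr (real_of_int j * real CARD('n) / q) * R) powr q"
      unfolding rescale_def using that q by (intro powr_mono2) (auto simp: abs_mult intro!: mult_left_mono)
    then show ?thesis using q R by (simp add: powr_mult powr_powr mult.commute)
  qed
  define D D' where "D = rescale q j y A" and "D' = rescale q j' y' A'"
  let ?V = "emeasure lborel (cball (0 :: real ^ 'n) R)"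
  \<comment> \<open>Here i selects the function that supplies the height and i' the one that
    supplies the support.\<close>
  have le: "ennreal ((min \<bar>D x\<bar> \<bar>D' x\<bar>) powr q)
      \<le> ennreal (R powr q * 2 powr (real_of_int i * real CARD('n))) * indicator (cball z (2 powr (- real_of_int i') * R)) x"
    if "(i = j \<or> i = j')" "(i' = j \<and> z = y \<or> i' = j' \<and> z = y')" for i i' z x
  proof (cases "x \<in> cball z (2 powr (- real_of_int i') * R)")
    case True
    have "(min \<bar>D x\<bar> \<bar>D' x\<bar>) powr q \<le> \<bar>D x\<bar> powr q" "(min \<bar>D x\<bar> \<bar>D' x\<bar>) powr q \<le> \<bar>D' x\<bar> powr q"
      using q by (auto intro!: powr_mono2)
    moreover have "\<bar>D x\<bar> powr q \<le> R powr q * 2 powr (real_of_int j * real CARD('n))"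
      "\<bar>D' x\<bar> powr q \<le> R powr q * 2 powr (real_of_int j' * real CARD('n))"
      unfolding D_def D'_def using A A' by (auto intro: bd)
    ultimately show ?thesis using True that by (auto intro!: ennreal_leI)
  next
    case False
    then have "D x = 0 \<or> D' x = 0" using supp that(2) A(2) A'(2) unfolding D_def D'_def by metis
    then have "(min \<bar>D x\<bar> \<bar>D' x\<bar>) powr q = 0" using q by auto
    then show ?thesis by simp
  qed
  have int: "overlap_mass q D D'
    \<le> ennreal (R powr q * 2 powr (real_of_int i * real CARD('n))) * (ennreal (2 powr (- real_of_int i' * real CARD('n))) * ?V)"
    if "(i = j \<or> i = j')" "(i' = j \<and> z = y \<or> i' = j' \<and> z = y')" for i i' z
  proof -
    have "overlap_mass q D D' \<le> (\<integral>\<^sup>+x. ennreal (R powr q * 2 powr (real_of_int i * real CARD('n)))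
        * indicator (cball z (2 powr (- real_of_int i') * R)) x \<partial>lborel)"
      unfolding overlap_mass_def by (intro nn_integral_mono le that)
    also have "\<dots> = ennreal (R powr q * 2 powr (real_of_int i * real CARD('n))) * emeasure lborel (cball z (2 powr (- real_of_int i') * R))"
      by (rule nn_integral_cmult_indicator) simp
    finally show ?thesis by (simp only: emeasure_rescaled_ball)
  qed
  have comb: "ennreal (R powr q * 2 powr (real_of_int i * real CARD('n))) * (ennreal (2 powr (- real_of_int i' * real CARD('n))) * ?V)
      = ennreal (R powr q * 2 powr (- \<bar>real_of_int (i - i')\<bar> * real CARD('n))) * ?V" if "i \<le> i'" for i i'
  proof -
    have "2 powr (real_of_int i * real CARD('n)) * 2 powr (- real_of_int i' * real CARD('n))
        = 2 powr (- \<bar>real_of_int (i - i')\<bar> * real CARD('n))"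
      using that by (simp add: algebra_simps flip: powr_add)
    then have "ennreal (R powr q * 2 powr (real_of_int i * real CARD('n))) * ennreal (2 powr (- real_of_int i' * real CARD('n)))
        = ennreal (R powr q * 2 powr (- \<bar>real_of_int (i - i')\<bar> * real CARD('n)))"
      by (simp add: mult.assoc flip: ennreal_mult)
    then show ?thesis by (simp add: mult.assoc[symmetric])
  qed
  show "overlap_mass q (rescale q j y A) (rescale q j' y' A')
    \<le> ennreal (R powr q * 2 powr (- \<bar>real_of_int (j - j')\<bar> * real CARD('n))) * ?V"
  proof (cases "j \<le> j'")
    case True
    then show ?thesis using int[of j j' y'] comb[of j j'] by (simp add: D_def D'_def)
  next
    case False
    then have "j' \<le> j" by simp
    moreover have "\<bar>real_of_int (j' - j)\<bar> = \<bar>real_of_int (j - j')\<bar>" by simp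
    ultimately show ?thesis using int[of j' j y] comb[of j' j] unfolding D_def[symmetric] D'_def[symmetric] by metis
  qed
  assume far: "2 powr real_of_int j' * norm (y - y') > R * (1 + 2 powr \<bar>real_of_int (j - j')\<bar>)"
  have "D x = 0 \<or> D' x = 0" for x
  proof (rule ccontr)
    assume "\<not> ?thesis"
    then have "x \<in> cball y (2 powr (- real_of_int j) * R)" "x \<in> cball y' (2 powr (- real_of_int j') * R)"
      using supp A(2) A'(2) unfolding D_def D'_def by blast+
    then have "norm (y - y') \<le> 2 powr (- real_of_int j) * R + 2 powr (- real_of_int j') * R"
      using dist_triangle2[of y y' x] by (simp add: dist_norm)
    then have "2 powr real_of_int j' * norm (y - y')
        \<le> 2 powr real_of_int j' * (2 powr (- real_of_int j) * R + 2 powr (- real_of_int j') * R)"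
      by (rule mult_left_mono) simp
    also have "\<dots> = R * (2 powr (real_of_int j' - real_of_int j) + 1)"
      by (simp add: algebra_simps flip: powr_add)
    also have "\<dots> \<le> R * (2 powr \<bar>real_of_int (j - j')\<bar> + 1)"
      using R by (intro mult_left_mono add_right_mono powr_mono) auto
    finally show False using far by (simp add: add.commute)
  qed
  then have "(min \<bar>D x\<bar> \<bar>D' x\<bar>) powr q = 0" for x by (metis abs_ge_zero abs_zero min.absorb1 min.absorb2 powr_zero_eq_one powr_eq_0_iff)
  then show "overlap_mass q (rescale q j y A) (rescale q j' y' A') = 0"
    by (simp add: overlap_mass_def D_def D'_def)
qed

text \<open>Each function is split into a bounded core of bounded support and a rest of small mass.
  As only a sum is known to diverge, for large n either the scales or the centres are far apart, and
  the respective estimate for the cores applies.\<close>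

lemma overlap_mass_tendsto_0:
  fixes V W :: "real ^ 'n::finite \<Rightarrow> real"
  assumes [measurable]: "V \<in> borel_measurable borel" "W \<in> borel_measurable borel" and q: "q > 0"
    and fin: "Lp_mass q V < \<infinity>" "Lp_mass q W < \<infinity>"
    and sep: "filterlim (\<lambda>n. \<bar>real_of_int (j n - j' n)\<bar> + 2 powr real_of_int (j' n) * norm (y n - y' n)) at_top sequentially"
  shows "(\<lambda>n. overlap_mass q (rescale q (j n) (y n) V) (rescale q (j' n) (y' n) W)) \<longlonglongrightarrow> 0"
proof (rule order_tendstoI)
  fix \<epsilon> :: ennreal assume "0 < \<epsilon>"
  then obtain e where e: "e > 0" "ennreal e < \<epsilon>" by (metis ennreal_less_zero_iff ennreal_rat_dense)
  define \<eta> where "\<eta> = e / 3"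
  have \<eta>: "\<eta> > 0" using e by (simp add: \<eta>_def)
  have "\<forall>\<^sub>F k in sequentially. Lp_mass q (\<lambda>x. if norm x \<le> real k \<and> \<bar>V x\<bar> \<le> real k then 0 else V x) < ennreal \<eta>
      \<and> Lp_mass q (\<lambda>x. if norm x \<le> real k \<and> \<bar>W x\<bar> \<le> real k then 0 else W x) < ennreal \<eta>"
    using \<eta> fin by (intro eventually_conj order_tendstoD(2)[OF Lp_mass_truncation]) auto
  from eventually_happens'[OF sequentially_bot this]
  obtain k where k: "Lp_mass q (\<lambda>x. if norm x \<le> real k \<and> \<bar>V x\<bar> \<le> real k then 0 else V x) < ennreal \<eta>"
      "Lp_mass q (\<lambda>x. if norm x \<le> real k \<and> \<bar>W x\<bar> \<le> real k then 0 else W x) < ennreal \<eta>"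
    by blast
  define R where "R = real k"
  define core rest where "core U x = (if norm x \<le> R \<and> \<bar>U x\<bar> \<le> R then U x else 0)"
    and "rest U x = (if norm x \<le> R \<and> \<bar>U x\<bar> \<le> R then 0 else U x)" for U :: "real ^ 'n \<Rightarrow> real" and x
  have [measurable]: "core U \<in> borel_measurable borel" "rest U \<in> borel_measurable borel" if [measurable]: "U \<in> borel_measurable borel" for U
    unfolding core_def[abs_def] rest_def[abs_def] by measurable
  have rest: "Lp_mass q (rest V) < ennreal \<eta>" "Lp_mass q (rest W) < ennreal \<eta>"
    using k by (simp_all add: rest_def[abs_def] R_def)
  have "R \<ge> 0" by (simp add: R_def)
  have split: "overlap_mass q (rescale q i z V) (rescale q i' z' W)
      \<le> overlap_mass q (rescale q i z (core V)) (rescale q i' z' (core W)) + Lp_mass q (rest V) + Lp_mass q (rest W)" for i i' z z'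
  proof -
    have cr: "rescale q i z U x = rescale q i z (core U) x \<or> rescale q i z U x = rescale q i z (rest U) x" for i z U x
      by (simp add: rescale_def core_def rest_def)
    have pt: "(min \<bar>rescale q i z V x\<bar> \<bar>rescale q i' z' W x\<bar>) powr q
        \<le> (min \<bar>rescale q i z (core V) x\<bar> \<bar>rescale q i' z' (core W) x\<bar>) powr q
          + (\<bar>rescale q i z (rest V) x\<bar> powr q + \<bar>rescale q i' z' (rest W) x\<bar> powr q)" for x
    proof -
      have "(min \<bar>rescale q i z V x\<bar> \<bar>rescale q i' z' W x\<bar>) powr q \<le> \<bar>rescale q i z V x\<bar> powr q"
        "(min \<bar>rescale q i z V x\<bar> \<bar>rescale q i' z' W x\<bar>) powr q \<le> \<bar>rescale q i' z' W x\<bar> powr q"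
        using q by (auto intro!: powr_mono2)
      then show ?thesis using cr[of i z V x] cr[of i' z' W x]
        by (smt (verit) powr_ge_zero)
    qed
    have "overlap_mass q (rescale q i z V) (rescale q i' z' W)
        \<le> (\<integral>\<^sup>+x. ennreal ((min \<bar>rescale q i z (core V) x\<bar> \<bar>rescale q i' z' (core W) x\<bar>) powr q)
          + (ennreal (\<bar>rescale q i z (rest V) x\<bar> powr q) + ennreal (\<bar>rescale q i' z' (rest W) x\<bar> powr q)) \<partial>lborel)"
      unfolding overlap_mass_def by (intro nn_integral_mono) (simp add: ennreal_leI pt flip: ennreal_plus)
    also have "\<dots> = overlap_mass q (rescale q i z (core V)) (rescale q i' z' (core W))
        + (Lp_mass q (rescale q i z (rest V)) + Lp_mass q (rescale q i' z' (rest W)))"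
      by (simp add: nn_integral_add overlap_mass_def Lp_mass_def)
    finally show ?thesis using q by (simp add: Lp_mass_rescale add.assoc)
  qed
  obtain v where v: "emeasure lborel (cball (0 :: real ^ 'n) R) = ennreal v" "v \<ge> 0"
    using emeasure_lborel_cball_finite[of "0 :: real ^ 'n" R] by (cases "emeasure lborel (cball (0 :: real ^ 'n) R)") auto
  define C where "C = R powr q * v"
  have C: "C \<ge> 0" using v by (simp add: C_def)
  \<comment> \<open>A scale gap of at least D makes the core overlap smaller than \<eta>. If the gap
    is below D, the threshold D + R (1 + 2^D) used next leaves more than R (1 + 2^D) for the
    distance of the centres.\<close>
  obtain D :: real where D: "C * 2 powr (- D * real CARD('n)) < \<eta>"
  proof -
    obtain i where i: "(1/2) ^ i < \<eta> / (C + 1)"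
      using real_arch_pow_inv[of "\<eta> / (C + 1)" "1/2"] \<eta> C by auto
    have "real CARD('n) \<ge> 1" by (simp add: Suc_leI)
    then have "real i * 1 \<le> real i * real CARD('n)" by (intro mult_left_mono) auto
    then have "2 powr (- real i * real CARD('n)) \<le> 2 powr (- real i)"
      by (intro powr_mono) auto
    also have "\<dots> = (1/2) ^ i" by (simp add: powr_minus powr_realpow power_divide inverse_eq_divide)
    finally have "C * 2 powr (- real i * real CARD('n)) \<le> C * (1/2) ^ i" using C by (rule mult_left_mono)
    also have "\<dots> \<le> C * (\<eta> / (C + 1))" using i C by (intro mult_left_mono) auto
    also have "\<dots> < \<eta>" using C \<eta> by (simp add: field_simps)
    finally show ?thesis by (rule that)
  qed
  have "\<forall>\<^sub>F n in sequentially. D + R * (1 + 2 powr D) < \<bar>real_of_int (j n - j' n)\<bar> + 2 powr real_of_int (j' n) * norm (y n - y' n)"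
    using sep by (simp add: filterlim_at_top_dense)
  then show "\<forall>\<^sub>F n in sequentially. overlap_mass q (rescale q (j n) (y n) V) (rescale q (j' n) (y' n) W) < \<epsilon>"
  proof eventually_elim
    case (elim n)
    have core: "\<bar>core U x\<bar> \<le> R" "norm x > R \<Longrightarrow> core U x = 0" for U x
      using \<open>R \<ge> 0\<close> by (auto simp: core_def)
    have "overlap_mass q (rescale q (j n) (y n) (core V)) (rescale q (j' n) (y' n) (core W)) \<le> ennreal \<eta>"
    proof (cases "\<bar>real_of_int (j n - j' n)\<bar> \<ge> D")
      case True
      have "overlap_mass q (rescale q (j n) (y n) (core V)) (rescale q (j' n) (y' n) (core W))
        \<le> ennreal (R powr q * 2 powr (- \<bar>real_of_int (j n - j' n)\<bar> * real CARD('n))) * ennreal v"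
        unfolding v(1)[symmetric] using q \<open>R \<ge> 0\<close> core by (intro overlap_mass_bounded_pieces(1))
      also have "\<dots> = ennreal (C * 2 powr (- \<bar>real_of_int (j n - j' n)\<bar> * real CARD('n)))"
        using v by (simp add: C_def mult_ac flip: ennreal_mult)
      also have "\<dots> \<le> ennreal (C * 2 powr (- D * real CARD('n)))"
        using C True by (intro ennreal_leI mult_left_mono powr_mono) auto
      also have "\<dots> \<le> ennreal \<eta>" using D by (intro ennreal_leI) simp
      finally show ?thesis .
    next
      case False
      have "R * (1 + 2 powr \<bar>real_of_int (j n - j' n)\<bar>) \<le> R * (1 + 2 powr D)"
        using False \<open>R \<ge> 0\<close> by (intro mult_left_mono add_left_mono powr_mono) auto
      then have "2 powr real_of_int (j' n) * norm (y n - y' n) > R * (1 + 2 powr \<bar>real_of_int (j n - j' n)\<bar>)"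
        using elim False by linarith
      then have "overlap_mass q (rescale q (j n) (y n) (core V)) (rescale q (j' n) (y' n) (core W)) = 0"
        using q \<open>R \<ge> 0\<close> core by (intro overlap_mass_bounded_pieces(2))
      then show ?thesis by simp
    qed
    then have "overlap_mass q (rescale q (j n) (y n) V) (rescale q (j' n) (y' n) W) \<le> ennreal \<eta> + ennreal \<eta> + ennreal \<eta>"
      using split[of "j n" "y n" "j' n" "y' n"] rest by (meson add_mono less_imp_le order_trans)
    also have "\<dots> = ennreal e" using \<eta> by (simp add: \<eta>_def flip: ennreal_plus)
    finally show ?case using e by simp
  qed
qed simp

section \<open>Convergence of the integrals\<close>

lemma sum_powr_le:
  fixes t :: "'a \<Rightarrow> real"
  assumes "finite I" "\<And>i. i \<in> I \<Longrightarrow> t i \<ge> 0" "q \<ge> 0"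
  shows "(\<Sum>i\<in>I. t i) powr q \<le> real (card I) powr q * (\<Sum>i\<in>I. t i powr q)"
proof (cases "I = {}")
  case False
  define M where "M = Max (t ` I)"
  have M: "M \<in> t ` I" "\<And>i. i \<in> I \<Longrightarrow> t i \<le> M" using assms False by (auto simp: M_def)
  then have "(\<Sum>i\<in>I. t i) powr q \<le> (real (card I) * M) powr q"
    using assms by (intro powr_mono2 sum_bounded_above sum_nonneg) auto
  also have "\<dots> = real (card I) powr q * M powr q" by (simp add: powr_mult)
  also have "M powr q \<le> (\<Sum>i\<in>I. t i powr q)"
    using M(1) assms by (auto intro: member_le_sum)
  finally show ?thesis by (simp add: mult_left_mono)
qed simp

lemma Lp_mass_sum_le:
  fixes f :: "'a \<Rightarrow> real ^ 'n::finite \<Rightarrow> real"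
  assumes I: "finite I" and [measurable]: "\<And>i. i \<in> I \<Longrightarrow> f i \<in> borel_measurable borel" and q: "q \<ge> 0"
  shows "Lp_mass q (\<lambda>x. \<Sum>i\<in>I. f i x) \<le> ennreal (real (card I) powr q) * (\<Sum>i\<in>I. Lp_mass q (f i))"
proof -
  have pt: "\<bar>\<Sum>i\<in>I. f i x\<bar> powr q \<le> real (card I) powr q * (\<Sum>i\<in>I. \<bar>f i x\<bar> powr q)" for x
    by (rule order_trans[OF powr_mono2[OF q abs_ge_zero sum_abs] sum_powr_le[OF I _ q]]) simp
  have "Lp_mass q (\<lambda>x. \<Sum>i\<in>I. f i x)
      \<le> (\<integral>\<^sup>+x. ennreal (real (card I) powr q) * (\<Sum>i\<in>I. ennreal (\<bar>f i x\<bar> powr q)) \<partial>lborel)"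
    unfolding Lp_mass_def
    by (intro nn_integral_mono) (simp add: ennreal_leI pt sum_nonneg flip: ennreal_mult)
  also have "\<dots> = ennreal (real (card I) powr q) * (\<Sum>i\<in>I. Lp_mass q (f i))"
    by (simp add: nn_integral_cmult nn_integral_sum Lp_mass_def del: sum_ennreal)
  finally show ?thesis .
qed

text \<open>Truncation of absolute values at the level |g| is subadditive; the q-th power of the
  resulting finite sum costs the constant.\<close>

lemma overlap_mass_sum_le:
  fixes f :: "'a \<Rightarrow> real ^ 'n::finite \<Rightarrow> real"
  assumes I: "finite I" and [measurable]: "\<And>i. i \<in> I \<Longrightarrow> f i \<in> borel_measurable borel"
    and [measurable]: "g \<in> borel_measurable borel" and q: "q \<ge> 0"
  shows "overlap_mass q (\<lambda>x. \<Sum>i\<in>I. f i x) g \<le> ennreal (real (card I) powr q) * (\<Sum>i\<in>I. overlap_mass q (f i) g)"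
proof -
  have min_sum: "min \<bar>\<Sum>i\<in>I. f i x\<bar> b \<le> (\<Sum>i\<in>I. min \<bar>f i x\<bar> b)" if "b \<ge> 0" for b x
    using I
  proof (induction I rule: finite_induct)
    case (insert i I)
    have "0 \<le> (\<Sum>i\<in>I. min \<bar>f i x\<bar> b)" using that by (intro sum_nonneg) auto
    then show ?case using insert that by (auto simp: min_def split: if_splits)
  qed (use that in simp)
  have pt: "(min \<bar>\<Sum>i\<in>I. f i x\<bar> \<bar>g x\<bar>) powr q \<le> real (card I) powr q * (\<Sum>i\<in>I. (min \<bar>f i x\<bar> \<bar>g x\<bar>) powr q)" for x
    by (rule order_trans[OF powr_mono2[OF q _ min_sum] sum_powr_le[OF I _ q]]) auto
  have "overlap_mass q (\<lambda>x. \<Sum>i\<in>I. f i x) g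
      \<le> (\<integral>\<^sup>+x. ennreal (real (card I) powr q) * (\<Sum>i\<in>I. ennreal ((min \<bar>f i x\<bar> \<bar>g x\<bar>) powr q)) \<partial>lborel)"
    unfolding overlap_mass_def
    by (intro nn_integral_mono) (simp add: ennreal_leI pt sum_nonneg flip: ennreal_mult)
  also have "\<dots> = ennreal (real (card I) powr q) * (\<Sum>i\<in>I. overlap_mass q (f i) g)"
    by (simp add: nn_integral_cmult nn_integral_sum overlap_mass_def del: sum_ennreal)
  finally show ?thesis .
qed

context homogeneous
begin

lemma F_measurable [measurable]: "F \<in> borel_measurable borel"
  using cont by (rule borel_measurable_continuous_onI)

lemma integrable_F_comp:
  fixes f :: "real ^ 'n::finite \<Rightarrow> real"
  assumes [measurable]: "f \<in> borel_measurable borel" and fin: "Lp_mass q f < \<infinity>"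
  shows "integrable lborel (\<lambda>x. F (f x))"
proof -
  obtain C where C: "\<And>a. \<bar>F a\<bar> \<le> C * \<bar>a\<bar> powr q" using growth_bound by blast
  have "integrable lborel (\<lambda>x. \<bar>f x\<bar> powr q)"
    using fin by (intro integrableI_nonneg) (auto simp: Lp_mass_def)
  then have int: "integrable lborel (\<lambda>x. C * \<bar>f x\<bar> powr q)" by simp
  have ae: "AE x in lborel. norm (F (f x)) \<le> norm (C * \<bar>f x\<bar> powr q)"
    using C by (intro AE_I2) (auto intro: order_trans[OF _ abs_ge_self])
  show ?thesis by (rule Bochner_Integration.integrable_bound[OF int _ ae]) measurable
qed

text \<open>C is obtained before the functions and their bounds, so \<eta> may later be chosen in
  terms of C.\<close>

lemma integral_increment_bound:
  assumes "\<epsilon> > 0"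
  obtains C where "C \<ge> 0" "\<And>(f :: real ^ 'n::finite \<Rightarrow> real) g K \<eta>. f \<in> borel_measurable borel \<Longrightarrow> g \<in> borel_measurable borel \<Longrightarrow>
      K \<ge> 0 \<Longrightarrow> \<eta> \<ge> 0 \<Longrightarrow> Lp_mass q f \<le> ennreal K \<Longrightarrow> Lp_mass q g \<le> ennreal \<eta> \<Longrightarrow>
      \<bar>(LINT x|lborel. F (f x + g x)) - (LINT x|lborel. F (f x))\<bar> \<le> \<epsilon> * K + C * \<eta>"
proof -
  obtain C where C: "C \<ge> 0" "\<And>a b. \<bar>F (a + b) - F a\<bar> \<le> \<epsilon> * \<bar>a\<bar> powr q + C * \<bar>b\<bar> powr q"
    using increment_bound[OF assms] by blast
  have "\<bar>(LINT x|lborel. F (f x + g x)) - (LINT x|lborel. F (f x))\<bar> \<le> \<epsilon> * K + C * \<eta>"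
    if [measurable]: "f \<in> borel_measurable borel" "g \<in> borel_measurable borel"
      and K: "K \<ge> 0" "\<eta> \<ge> 0" "Lp_mass q f \<le> ennreal K" "Lp_mass q g \<le> ennreal \<eta>"
    for f g :: "real ^ 'n \<Rightarrow> real" and K \<eta>
  proof -
    have fin: "Lp_mass q f < \<infinity>" "Lp_mass q g < \<infinity>" using K(3,4) by (auto intro: le_less_trans)
    have "Lp_mass q (\<lambda>x. f x + g x) \<le> ennreal (2 powr q) * (Lp_mass q f + Lp_mass q g)"
      using q_pos by (intro Lp_mass_add_le) auto
    also have "\<dots> < \<infinity>" using fin by (simp add: ennreal_mult_less_top)
    finally have int: "integrable lborel (\<lambda>x. F (f x + g x))" "integrable lborel (\<lambda>x. F (f x))"
      using fin by (auto intro!: integrable_F_comp)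
    have "ennreal \<bar>LINT x|lborel. F (f x + g x) - F (f x)\<bar> \<le> (\<integral>\<^sup>+x. ennreal \<bar>F (f x + g x) - F (f x)\<bar> \<partial>lborel)"
      using integral_norm_bound_ennreal[OF Bochner_Integration.integrable_diff[OF int]] by simp
    also have "\<dots> \<le> (\<integral>\<^sup>+x. ennreal \<epsilon> * ennreal (\<bar>f x\<bar> powr q) + ennreal C * ennreal (\<bar>g x\<bar> powr q) \<partial>lborel)"
      using assms C by (intro nn_integral_mono) (simp add: ennreal_leI flip: ennreal_mult ennreal_plus)
    also have "\<dots> = ennreal \<epsilon> * Lp_mass q f + ennreal C * Lp_mass q g"
      by (simp add: nn_integral_add nn_integral_cmult Lp_mass_def)
    also have "\<dots> \<le> ennreal \<epsilon> * ennreal K + ennreal C * ennreal \<eta>"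
      by (intro add_mono mult_left_mono K) auto
    also have "\<dots> = ennreal (\<epsilon> * K + C * \<eta>)" using assms C K by (simp flip: ennreal_mult ennreal_plus)
    finally show ?thesis using int assms C K by (subst (asm) ennreal_le_iff) auto
  qed
  then show ?thesis using C that by blast
qed

lemma integral_superposition_bound:
  assumes "\<epsilon> > 0"
  obtains C where "C \<ge> 0" "\<And>(f :: real ^ 'n::finite \<Rightarrow> real) g K \<eta>. f \<in> borel_measurable borel \<Longrightarrow> g \<in> borel_measurable borel \<Longrightarrow>
      K \<ge> 0 \<Longrightarrow> \<eta> \<ge> 0 \<Longrightarrow> Lp_mass q f + Lp_mass q g \<le> ennreal K \<Longrightarrow> overlap_mass q f g \<le> ennreal \<eta> \<Longrightarrow>
      \<bar>(LINT x|lborel. F (f x + g x)) - (LINT x|lborel. F (f x)) - (LINT x|lborel. F (g x))\<bar> \<le> \<epsilon> * K + C * \<eta>"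
proof -
  obtain C where C: "C \<ge> 0" "\<And>a b. \<bar>F (a + b) - F a - F b\<bar>
      \<le> \<epsilon> * (\<bar>a\<bar> powr q + \<bar>b\<bar> powr q) + C * (min \<bar>a\<bar> \<bar>b\<bar>) powr q"
    using superposition_bound[OF assms] by blast
  have "\<bar>(LINT x|lborel. F (f x + g x)) - (LINT x|lborel. F (f x)) - (LINT x|lborel. F (g x))\<bar> \<le> \<epsilon> * K + C * \<eta>"
    if [measurable]: "f \<in> borel_measurable borel" "g \<in> borel_measurable borel"
      and K: "K \<ge> 0" "\<eta> \<ge> 0" "Lp_mass q f + Lp_mass q g \<le> ennreal K" "overlap_mass q f g \<le> ennreal \<eta>"
    for f g :: "real ^ 'n \<Rightarrow> real" and K \<eta>
  proof -
    have fin': "Lp_mass q f + Lp_mass q g < \<infinity>" using le_less_trans[OF K(3) ennreal_less_top] by simp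
    then have fin: "Lp_mass q f < \<infinity>" "Lp_mass q g < \<infinity>" by auto
    have "Lp_mass q (\<lambda>x. f x + g x) \<le> ennreal (2 powr q) * (Lp_mass q f + Lp_mass q g)"
      using q_pos by (intro Lp_mass_add_le) auto
    also have "\<dots> < \<infinity>" using fin by (simp add: ennreal_mult_less_top)
    finally have int: "integrable lborel (\<lambda>x. F (f x + g x))" "integrable lborel (\<lambda>x. F (f x))" "integrable lborel (\<lambda>x. F (g x))"
      using fin by (auto intro!: integrable_F_comp)
    have "ennreal \<bar>LINT x|lborel. F (f x + g x) - F (f x) - F (g x)\<bar>
        \<le> (\<integral>\<^sup>+x. ennreal \<bar>F (f x + g x) - F (f x) - F (g x)\<bar> \<partial>lborel)"
      using integral_norm_bound_ennreal[OF Bochner_Integration.integrable_diff[OF Bochner_Integration.integrable_diff[OF int(1,2)] int(3)]] by simp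
    also have "\<dots> \<le> (\<integral>\<^sup>+x. ennreal \<epsilon> * (ennreal (\<bar>f x\<bar> powr q) + ennreal (\<bar>g x\<bar> powr q))
        + ennreal C * ennreal ((min \<bar>f x\<bar> \<bar>g x\<bar>) powr q) \<partial>lborel)"
      using assms C by (intro nn_integral_mono) (simp add: ennreal_leI flip: ennreal_mult ennreal_plus)
    also have "\<dots> = ennreal \<epsilon> * (Lp_mass q f + Lp_mass q g) + ennreal C * overlap_mass q f g"
      by (simp add: nn_integral_add nn_integral_cmult Lp_mass_def overlap_mass_def)
    also have "\<dots> \<le> ennreal \<epsilon> * ennreal K + ennreal C * ennreal \<eta>"
      by (intro add_mono mult_left_mono K) auto
    also have "\<dots> = ennreal (\<epsilon> * K + C * \<eta>)" using assms C K by (simp flip: ennreal_mult ennreal_plus)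
    finally show ?thesis using int assms C K by (subst (asm) ennreal_le_iff) auto
  qed
  then show ?thesis using C that by blast
qed

end

text \<open>The factor 2^(jN) released by the scaling law of F cancels the Jacobian of the change of
  variables.\<close>

lemma integral_F_rescale:
  fixes W :: "real ^ 'n::finite \<Rightarrow> real"
  assumes "homogeneous F (real CARD('n)) q" and [measurable]: "W \<in> borel_measurable borel"
  shows "(LINT x|lborel. F (rescale q j y W x)) = (LINT x|lborel. F (W x))"
proof -
  interpret homogeneous F "real CARD('n)" q by fact
  have "(LINT x|lborel. F (rescale q j y W x)) = 2 powr (real_of_int j * real CARD('n)) *
      (LINT x|lborel. F (W (- ((2 powr real_of_int j) *\<^sub>R y) + (2 powr real_of_int j) *\<^sub>R x)))"
    unfolding rescale_affine hom by (rule integral_mult_right_zero)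
  also have "\<dots> = (LINT x|lborel. F (W x))"
    by (subst integral_lborel_affine[where f="\<lambda>x. F (W x)"]) (simp_all add: scale_power_card)
  finally show ?thesis .
qed

text \<open>Induction on L, splitting off the last profile: its overlap with the sum of the others
  is bounded by a fixed multiple of the sum of the pairwise overlaps, and the total mass is bounded
  in n because rescaling preserves mass.\<close>

lemma integral_F_sum_profiles_tendsto:
  fixes W :: "nat \<Rightarrow> real ^ 'n::finite \<Rightarrow> real"
  assumes homog: "homogeneous F (real CARD('n)) q"
    and W: "\<And>l. l \<le> L \<Longrightarrow> W l \<in> borel_measurable borel" "\<And>l. l \<le> L \<Longrightarrow> Lp_mass q (W l) < \<infinity>"
    and sep: "\<And>l k. l \<le> L \<Longrightarrow> k \<le> L \<Longrightarrow> l \<noteq> k \<Longrightarrow>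
      filterlim (\<lambda>n. \<bar>real_of_int (j l n - j k n)\<bar> + 2 powr real_of_int (j k n) * norm (y l n - y k n)) at_top sequentially"
  shows "(\<lambda>n. LINT x|lborel. F (\<Sum>l\<le>L. rescale q (j l n) (y l n) (W l) x)) \<longlonglongrightarrow> (\<Sum>l\<le>L. LINT x|lborel. F (W l x))"
  using W sep
proof (induction L)
  case 0
  then show ?case using integral_F_rescale[OF homog, of "W 0"] by simp
next
  case (Suc L)
  interpret homogeneous F "real CARD('n)" q by (rule homog)
  let ?D = "\<lambda>l n. rescale q (j l n) (y l n) (W l)"
  let ?G = "\<lambda>n x. \<Sum>l\<le>L. ?D l n x"
  let ?I = "\<lambda>f. LINT x|lborel. F (f x)"
  have IH: "(\<lambda>n. ?I (?G n)) \<longlonglongrightarrow> (\<Sum>l\<le>L. ?I (W l))" using Suc.prems by (intro Suc.IH) auto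
  have D_meas: "?D l n \<in> borel_measurable borel" if "l \<le> Suc L" for l n using Suc.prems(1)[OF that] by measurable
  have G_meas: "?G n \<in> borel_measurable borel" for n using D_meas by (intro borel_measurable_sum) auto
  define K0 where "K0 = ennreal (real (card {..L}) powr q) * (\<Sum>l\<le>L. Lp_mass q (W l)) + Lp_mass q (W (Suc L))"
  have "(\<Sum>l\<le>L. Lp_mass q (W l)) < \<infinity>" using Suc.prems(2) by (simp add: less_top[symmetric])
  then have "K0 < \<infinity>" using Suc.prems(2)[of "Suc L"] unfolding K0_def by (simp add: ennreal_mult_less_top)
  then obtain K where K: "K0 = ennreal K" "K \<ge> 0" by (cases K0) auto
  have mass: "Lp_mass q (?G n) + Lp_mass q (?D (Suc L) n) \<le> ennreal K" for n
  proof -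
    have "Lp_mass q (?G n) \<le> ennreal (real (card {..L}) powr q) * (\<Sum>l\<le>L. Lp_mass q (?D l n))"
      using D_meas q_pos by (intro Lp_mass_sum_le) auto
    then show ?thesis using Suc.prems(1) q_pos unfolding K(1)[symmetric] K0_def
      by (simp add: Lp_mass_rescale add_right_mono)
  qed
  have over: "(\<lambda>n. overlap_mass q (?G n) (?D (Suc L) n)) \<longlonglongrightarrow> 0"
  proof (rule tendsto_sandwich[OF _ _ tendsto_const])
    have "(\<lambda>n. \<Sum>l\<le>L. overlap_mass q (?D l n) (?D (Suc L) n)) \<longlonglongrightarrow> (\<Sum>l\<le>L. 0)"
      using Suc.prems q_pos by (intro tendsto_sum overlap_mass_tendsto_0) auto
    then show "(\<lambda>n. ennreal (real (card {..L}) powr q) * (\<Sum>l\<le>L. overlap_mass q (?D l n) (?D (Suc L) n))) \<longlonglongrightarrow> 0"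
      using ennreal_tendsto_cmult[of "ennreal (real (card {..L}) powr q)"] by fastforce
    show "\<forall>\<^sub>F n in sequentially. overlap_mass q (?G n) (?D (Suc L) n)
        \<le> ennreal (real (card {..L}) powr q) * (\<Sum>l\<le>L. overlap_mass q (?D l n) (?D (Suc L) n))"
      using D_meas q_pos by (intro always_eventually allI overlap_mass_sum_le) auto
  qed simp
  have "(\<lambda>n. ?I (\<lambda>x. ?G n x + ?D (Suc L) n x) - ?I (?G n) - ?I (W (Suc L))) \<longlonglongrightarrow> 0"
  proof (rule LIMSEQ_I)
    fix e :: real assume e: "e > 0"
    define \<epsilon> where "\<epsilon> = e / (4 * (K + 1))"
    have \<epsilon>: "\<epsilon> > 0" "\<epsilon> * K \<le> e / 4" using e K by (auto simp: \<epsilon>_def field_simps)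
    obtain C where C: "C \<ge> 0" "\<And>(f :: real ^ 'n \<Rightarrow> real) g K \<eta>. f \<in> borel_measurable borel \<Longrightarrow> g \<in> borel_measurable borel \<Longrightarrow>
      K \<ge> 0 \<Longrightarrow> \<eta> \<ge> 0 \<Longrightarrow> Lp_mass q f + Lp_mass q g \<le> ennreal K \<Longrightarrow> overlap_mass q f g \<le> ennreal \<eta> \<Longrightarrow>
      \<bar>?I (\<lambda>x. f x + g x) - ?I f - ?I g\<bar> \<le> \<epsilon> * K + C * \<eta>"
      using integral_superposition_bound[OF \<epsilon>(1)] by blast
    define \<eta> where "\<eta> = e / (4 * (C + 1))"
    have \<eta>: "\<eta> > 0" "C * \<eta> \<le> e / 4" using e C(1) by (auto simp: \<eta>_def field_simps)
    have "\<forall>\<^sub>F n in sequentially. overlap_mass q (?G n) (?D (Suc L) n) < ennreal \<eta>"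
      using over by (rule order_tendstoD) (use \<eta> in simp)
    then obtain n0 where n0: "\<And>n. n \<ge> n0 \<Longrightarrow> overlap_mass q (?G n) (?D (Suc L) n) < ennreal \<eta>"
      unfolding eventually_sequentially by blast
    have "norm (?I (\<lambda>x. ?G n x + ?D (Suc L) n x) - ?I (?G n) - ?I (W (Suc L)) - 0) < e" if "n \<ge> n0" for n
    proof -
      have "\<bar>?I (\<lambda>x. ?G n x + ?D (Suc L) n x) - ?I (?G n) - ?I (?D (Suc L) n)\<bar> \<le> \<epsilon> * K + C * \<eta>"
        using n0[OF that] \<eta> by (intro C(2) G_meas D_meas K(2) mass) auto
      then show ?thesis using \<epsilon> \<eta> e integral_F_rescale[OF homog Suc.prems(1)[of "Suc L"]] by simp
    qed
    then show "\<exists>n0. \<forall>n\<ge>n0. norm (?I (\<lambda>x. ?G n x + ?D (Suc L) n x) - ?I (?G n) - ?I (W (Suc L)) - 0) < e" by blast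
  qed
  from tendsto_add[OF tendsto_add[OF this IH] tendsto_const[of "?I (W (Suc L))"]]
  show ?case by (simp add: add.commute)
qed

section \<open>Limits up to \<Lambda>\<close>

text \<open>Gives both meanings of the limit a common form. For finite \<Lambda> the index L0 is
  \<Lambda> itself, which then is the only admissible L.\<close>

lemma limsup_tendsto_upto_0D:
  assumes "tendsto_upto \<Lambda> (\<lambda>L. limsup (a L)) (0 :: ennreal)" "\<eta> > 0"
  obtains L0 where "enat L0 \<le> \<Lambda>" "\<And>L. L \<ge> L0 \<Longrightarrow> enat L \<le> \<Lambda> \<Longrightarrow> \<forall>\<^sub>F n in sequentially. a L n < \<eta>"
proof (cases \<Lambda>)
  case (enat K)
  then have "limsup (a K) < \<eta>" using assms by (simp add: tendsto_upto_def)
  then have "\<forall>\<^sub>F n in sequentially. a K n < \<eta>" by (rule Limsup_lessD)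
  then show ?thesis using that[of K] enat by (metis enat_ord_simps(1) order_antisym order_refl)
next
  case infinity
  then have "(\<lambda>L. limsup (a L)) \<longlonglongrightarrow> 0" using assms by (simp add: tendsto_upto_def)
  then have "\<forall>\<^sub>F L in sequentially. limsup (a L) < \<eta>" using assms(2) by (rule order_tendstoD)
  then obtain L0 where "\<And>L. L \<ge> L0 \<Longrightarrow> limsup (a L) < \<eta>" unfolding eventually_sequentially by blast
  then show ?thesis using that[of L0] infinity Limsup_lessD by fastforce
qed

text \<open>For infinite \<Lambda>, two values of S with large index are both close to one and the
  same a n, so S is Cauchy, and a inherits its limit. For finite \<Lambda> the value of S at
  \<Lambda> is approximated to every accuracy.\<close>

lemma tendsto_upto_common_limit:
  fixes a S :: "nat \<Rightarrow> real"
  assumes approx: "\<And>e. e > 0 \<Longrightarrow> \<exists>L0. enat L0 \<le> \<Lambda> \<and>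
      (\<forall>L\<ge>L0. enat L \<le> \<Lambda> \<longrightarrow> (\<forall>\<^sub>F n in sequentially. \<bar>a n - S L\<bar> \<le> e))"
  shows "\<exists>s. tendsto_upto \<Lambda> S s \<and> a \<longlonglongrightarrow> s"
proof (cases \<Lambda>)
  case (enat K)
  have "a \<longlonglongrightarrow> S K"
  proof (rule tendstoI)
    fix e :: real assume e: "e > 0"
    then obtain L0 where L0: "enat L0 \<le> \<Lambda>" "\<And>L. L \<ge> L0 \<Longrightarrow> enat L \<le> \<Lambda> \<Longrightarrow> \<forall>\<^sub>F n in sequentially. \<bar>a n - S L\<bar> \<le> e / 2"
      using approx[of "e / 2"] by auto
    then have "\<forall>\<^sub>F n in sequentially. \<bar>a n - S K\<bar> \<le> e / 2" using enat by auto
    then show "\<forall>\<^sub>F n in sequentially. dist (a n) (S K) < e"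
      by eventually_elim (use e in \<open>simp add: dist_real_def\<close>)
  qed
  then show ?thesis using enat by (auto simp: tendsto_upto_def)
next
  case infinity
  have appr: "\<exists>L0. \<forall>L\<ge>L0. \<forall>\<^sub>F n in sequentially. \<bar>a n - S L\<bar> \<le> e" if "e > 0" for e
    using approx[OF that] infinity by auto
  have "Cauchy S"
  proof (rule metric_CauchyI)
    fix e :: real assume e: "e > 0"
    then obtain L0 where L0: "\<And>L. L \<ge> L0 \<Longrightarrow> \<forall>\<^sub>F n in sequentially. \<bar>a n - S L\<bar> \<le> e / 3"
      using appr[of "e / 3"] by auto
    have "dist (S L) (S L') < e" if "L \<ge> L0" "L' \<ge> L0" for L L'
    proof -
      have "\<forall>\<^sub>F n in sequentially. \<bar>a n - S L\<bar> \<le> e / 3 \<and> \<bar>a n - S L'\<bar> \<le> e / 3"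
        using L0 that by (simp add: eventually_conj)
      from eventually_happens'[OF sequentially_bot this]
      obtain n where "\<bar>a n - S L\<bar> \<le> e / 3" "\<bar>a n - S L'\<bar> \<le> e / 3" by blast
      then show ?thesis unfolding dist_real_def using e by linarith
    qed
    then show "\<exists>M. \<forall>m\<ge>M. \<forall>n\<ge>M. dist (S m) (S n) < e" by blast
  qed
  then obtain s where s: "S \<longlonglongrightarrow> s" using Cauchy_convergent_iff convergent_def by blast
  have "a \<longlonglongrightarrow> s"
  proof (rule tendstoI)
    fix e :: real assume e: "e > 0"
    then obtain L0 where L0: "\<And>L. L \<ge> L0 \<Longrightarrow> \<forall>\<^sub>F n in sequentially. \<bar>a n - S L\<bar> \<le> e / 3"
      using appr[of "e / 3"] by auto
    have "\<forall>\<^sub>F L in sequentially. dist (S L) s < e / 3" using s by (rule tendstoD) (use e in simp)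
    then have "\<forall>\<^sub>F L in sequentially. dist (S L) s < e / 3 \<and> L \<ge> L0"
      using eventually_ge_at_top by (rule eventually_conj)
    from eventually_happens'[OF sequentially_bot this]
    obtain L where L: "dist (S L) s < e / 3" "L \<ge> L0" by blast
    from L0[OF L(2)] show "\<forall>\<^sub>F n in sequentially. dist (a n) s < e"
    proof eventually_elim
      case (elim n)
      then show ?case using L(1) unfolding dist_real_def by linarith
    qed
  qed
  then show ?thesis using infinity s by (auto simp: tendsto_upto_def)
qed

lemma locally_lipschitz_continuous_on:
  assumes "locally_lipschitz F"
  shows "continuous_on UNIV F"
  unfolding continuous_on_eq_continuous_at[OF open_UNIV]
proof
  fix s :: real
  obtain e C where e: "e > 0" "C-lipschitz_on (cball s e) F"
    using assms unfolding locally_lipschitz_def by blast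
  then have "continuous_on (cball s e) F" by (intro lipschitz_on_continuous_on)
  moreover have "s \<in> interior (cball s e)" using e by (simp add: interior_cball)
  ultimately show "isCont F s" using continuous_on_interior by blast
qed

theorem theorem3p1:
  fixes m :: nat and p :: real
    and u :: "nat \<Rightarrow> real ^ 'n \<Rightarrow> real"
    and \<sigma> :: "nat \<Rightarrow> nat"
    and w :: "nat \<Rightarrow> real ^ 'n \<Rightarrow> real"
    and y :: "nat \<Rightarrow> nat \<Rightarrow> real ^ 'n"
    and j :: "nat \<Rightarrow> nat \<Rightarrow> int"
    and \<Lambda> :: enat
    and \<alpha> :: "'n \<Rightarrow> nat"
    and F :: "real \<Rightarrow> real"
  assumes "m \<ge> 1" and "1 < p" and "p < real CARD('n) / real m"
    and "\<And>n. u n \<in> Wdot m p"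
    and "\<exists>C::real. \<forall>n. Wdot_norm m p UNIV (u n) \<le> ennreal C"
    and "strict_mono \<sigma>"
    and "profile_decomposition m p (\<lambda>n. u (\<sigma> n)) w y j \<Lambda>"
    and "mi_order \<alpha> < m"
    and "locally_lipschitz F"
    and "\<And>(s::real) (i::int).
           F (2 powr (real_of_int i * real CARD('n) / pstar CARD('n) p (m - mi_order \<alpha>)) * s)
             = 2 powr (real_of_int i * real CARD('n)) * F s"
  shows "(\<forall>n. integrable lborel (\<lambda>x. F (weak_deriv \<alpha> (u (\<sigma> n)) x))) \<and>
    (\<forall>l. enat l \<le> \<Lambda> \<longrightarrow> integrable lborel (\<lambda>x. F (weak_deriv \<alpha> (w l) x))) \<and>
    (\<exists>S::real.
       tendsto_upto \<Lambda> (\<lambda>L. \<Sum>l\<le>L. LINT x|lborel. F (weak_deriv \<alpha> (w l) x)) S \<and>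
       (\<lambda>n. LINT x|lborel. F (weak_deriv \<alpha> (u (\<sigma> n)) x)) \<longlonglongrightarrow> S)"
proof -
  define q where "q = pstar CARD('n) p (m - mi_order \<alpha>)"
  have mp: "real m * p < real CARD('n)" using assms(1,3) by (simp add: pos_less_divide_eq mult.commute)
  have "real (m - mi_order \<alpha>) * p \<le> real m * p" using assms(2) by (intro mult_right_mono) auto
  then have "real (m - mi_order \<alpha>) * p < real CARD('n)" using mp by linarith
  then have q: "q > 1" unfolding q_def by (intro pstar_gt_1 assms(2))
  have homog: "homogeneous F (real CARD('n)) q"
    using q assms(10) by unfold_locales (auto simp: q_def intro: locally_lipschitz_continuous_on assms(9))
  interpret homogeneous F "real CARD('n)" q by (rule homog)
  define r where "r = residual m p (\<lambda>n. u (\<sigma> n)) w y j"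
  have w: "w l \<in> Wdot m p" if "enat l \<le> \<Lambda>" for l
    using assms(7) that unfolding profile_decomposition_def Let_def by blast
  have sep: "filterlim (\<lambda>n. \<bar>real_of_int (j l n - j k n)\<bar> + 2 powr real_of_int (j k n) * norm (y l n - y k n)) at_top sequentially"
    if "enat l \<le> \<Lambda>" "enat k \<le> \<Lambda>" "l \<noteq> k" for l k
    using assms(7) that unfolding profile_decomposition_def Let_def by blast
  \<comment> \<open>Condition (8) for the order k = |\<alpha>|, where the exponent p*_{m-k} is
    q.\<close>
  have small: "tendsto_upto \<Lambda> (\<lambda>L. limsup (\<lambda>n. Wdot_norm (mi_order \<alpha>) q UNIV (r L n))) 0"
    using assms(7,8) unfolding profile_decomposition_def Let_def q_def r_def by blast
  define U where "U n = weak_deriv \<alpha> (u (\<sigma> n))" for n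
  define W where "W l = weak_deriv \<alpha> (w l)" for l
  have deriv: "has_weak_deriv \<alpha> v (weak_deriv \<alpha> v) \<and> Lp_mass q (weak_deriv \<alpha> v) < \<infinity>" if v: "v \<in> Wdot m p" for v
  proof -
    obtain v' where v': "has_weak_deriv \<alpha> v v'" "Lp_mass q v' < \<infinity>"
      using Wdot_has_weak_deriv[OF assms(2) mp v, of \<alpha>] assms(8) unfolding q_def by auto
    then show ?thesis
      using has_weak_deriv_weak_deriv Lp_mass_cong_AE[OF weak_deriv_AE_eq[OF v'(1)], of q] by auto
  qed
  have U: "has_weak_deriv \<alpha> (u (\<sigma> n)) (U n)" "Lp_mass q (U n) < \<infinity>" "U n \<in> borel_measurable borel" for n
    using deriv[OF assms(4)] by (auto simp: U_def intro: has_weak_deriv_measurable)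
  have W: "has_weak_deriv \<alpha> (w l) (W l)" "Lp_mass q (W l) < \<infinity>" "W l \<in> borel_measurable borel" if "enat l \<le> \<Lambda>" for l
    using deriv[OF w[OF that]] by (auto simp: W_def intro: has_weak_deriv_measurable)
  define D where "D l n = rescale q (j l n) (y l n) (W l)" for l n
  define G where "G L n x = (\<Sum>l\<le>L. D l n x)" for L n x
  have D_meas: "D l n \<in> borel_measurable borel" if "enat l \<le> \<Lambda>" for l n
    unfolding D_def using W(3)[OF that] by (rule measurable_rescale)
  have le_trans: "enat l \<le> \<Lambda>" if "l \<le> L" "enat L \<le> \<Lambda>" for l L
    using that by (meson enat_ord_simps(1) order_trans)
  have G_meas: "G L n \<in> borel_measurable borel" if "enat L \<le> \<Lambda>" for L n
    unfolding G_def[abs_def] using D_meas le_trans[OF _ that] by (intro borel_measurable_sum) auto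
  \<comment> \<open>By linearity U n - G L n is a weak \<alpha>-derivative of the residual, and it
    agrees almost everywhere with the chosen one.\<close>
  have rest: "Lp_mass q (\<lambda>x. U n x - G L n x) \<le> enn_powr (Wdot_norm (mi_order \<alpha>) q UNIV (r L n)) q"
    if L: "enat L \<le> \<Lambda>" for L n
  proof -
    have "has_weak_deriv \<alpha> (\<lambda>x. \<Sum>l\<le>L. dilate m p (j l n) (y l n) (w l) x) (G L n)"
      unfolding G_def[abs_def] D_def q_def
      using W(1) le_trans[OF _ L] assms(2,8) by (intro has_weak_deriv_sum has_weak_deriv_dilate) auto
    from has_weak_deriv_lincomb[OF U(1) this, of 1 n "-1"]
    have "has_weak_deriv \<alpha> (r L n) (\<lambda>x. U n x - G L n x)"
      by (simp add: r_def residual_def)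
    from Lp_mass_cong_AE[OF weak_deriv_AE_eq[OF this], of q]
    show ?thesis using Lp_mass_le_Wdot_norm[of \<alpha> "mi_order \<alpha>" q "r L n"] q by simp
  qed
  have rest_small: "\<exists>L0. enat L0 \<le> \<Lambda> \<and> (\<forall>L\<ge>L0. enat L \<le> \<Lambda> \<longrightarrow>
      (\<forall>\<^sub>F n in sequentially. Lp_mass q (\<lambda>x. U n x - G L n x) \<le> ennreal \<eta>))" if \<eta>: "\<eta> > 0" for \<eta>
  proof -
    have "ennreal (\<eta> powr (1/q)) > 0" using \<eta> by simp
    from limsup_tendsto_upto_0D[OF small this]
    obtain L0 where L0: "enat L0 \<le> \<Lambda>" "\<And>L. L \<ge> L0 \<Longrightarrow> enat L \<le> \<Lambda> \<Longrightarrow>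
      \<forall>\<^sub>F n in sequentially. Wdot_norm (mi_order \<alpha>) q UNIV (r L n) < ennreal (\<eta> powr (1/q))"
      by blast
    have "\<forall>\<^sub>F n in sequentially. Lp_mass q (\<lambda>x. U n x - G L n x) \<le> ennreal \<eta>" if L: "L \<ge> L0" "enat L \<le> \<Lambda>" for L
      using L0(2)[OF L]
    proof eventually_elim
      case (elim n)
      have "Lp_mass q (\<lambda>x. U n x - G L n x) \<le> enn_powr (ennreal (\<eta> powr (1/q))) q"
        using elim q by (intro order_trans[OF rest[OF L(2)]] enn_powr_mono) auto
      then show ?case using \<eta> q by (simp add: powr_powr)
    qed
    then show ?thesis using L0(1) by blast
  qed
  \<comment> \<open>One L with residual mass at most 1 fixes K before e and the later values of L
    enter; otherwise \<epsilon> would depend on L.\<close>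
  obtain K where K: "K \<ge> 0" "\<forall>\<^sub>F n in sequentially. Lp_mass q (U n) \<le> ennreal K"
  proof -
    obtain L where L: "enat L \<le> \<Lambda>" "\<forall>\<^sub>F n in sequentially. Lp_mass q (\<lambda>x. U n x - G L n x) \<le> ennreal 1"
      using rest_small[of 1] by auto
    define K0 where "K0 = ennreal (2 powr q) * (ennreal 1 + ennreal (real (card {..L}) powr q) * (\<Sum>l\<le>L. Lp_mass q (W l)))"
    have "(\<Sum>l\<le>L. Lp_mass q (W l)) < \<infinity>" using W(2) le_trans[OF _ L(1)] by (simp add: less_top[symmetric])
    then have "K0 < \<infinity>" unfolding K0_def by (simp add: ennreal_mult_less_top)
    then obtain K where K: "K0 = ennreal K" "K \<ge> 0" by (cases K0) auto
    from L(2) have "\<forall>\<^sub>F n in sequentially. Lp_mass q (U n) \<le> ennreal K"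
    proof eventually_elim
      case (elim n)
      have "Lp_mass q (G L n) \<le> ennreal (real (card {..L}) powr q) * (\<Sum>l\<le>L. Lp_mass q (D l n))"
        unfolding G_def[abs_def] using q D_meas le_trans[OF _ L(1)] by (intro Lp_mass_sum_le) auto
      also have "(\<Sum>l\<le>L. Lp_mass q (D l n)) = (\<Sum>l\<le>L. Lp_mass q (W l))"
        unfolding D_def using q W(3) le_trans[OF _ L(1)] by (intro sum.cong Lp_mass_rescale) auto
      finally have G_le: "Lp_mass q (G L n) \<le> ennreal (real (card {..L}) powr q) * (\<Sum>l\<le>L. Lp_mass q (W l))" .
      have "Lp_mass q (U n) = Lp_mass q (\<lambda>x. (U n x - G L n x) + G L n x)" by simp
      also have "\<dots> \<le> ennreal (2 powr q) * (Lp_mass q (\<lambda>x. U n x - G L n x) + Lp_mass q (G L n))"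
        using q U(3) G_meas[OF L(1)] by (intro Lp_mass_add_le borel_measurable_diff) auto
      also have "\<dots> \<le> K0" unfolding K0_def using elim G_le by (intro mult_left_mono add_mono) auto
      finally show ?case using K by simp
    qed
    then show ?thesis using that K(2) by blast
  qed
  have "\<exists>L0. enat L0 \<le> \<Lambda> \<and> (\<forall>L\<ge>L0. enat L \<le> \<Lambda> \<longrightarrow> (\<forall>\<^sub>F n in sequentially.
      \<bar>(LINT x|lborel. F (U n x)) - (\<Sum>l\<le>L. LINT x|lborel. F (W l x))\<bar> \<le> e))" if e: "e > 0" for e
  proof -
    \<comment> \<open>The error e consists of three parts e/3: \<epsilon> K from the mass of U n, C
      \<eta> from the residual, and the distance of the integral of F over the profile sum from its
      limit.\<close>
    define \<epsilon> where "\<epsilon> = e / (3 * (K + 1))"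
    have \<epsilon>: "\<epsilon> > 0" "\<epsilon> * K \<le> e / 3" using e K(1) by (auto simp: \<epsilon>_def field_simps)
    obtain C where C: "C \<ge> 0" "\<And>(f :: real ^ 'n \<Rightarrow> real) g K \<eta>. f \<in> borel_measurable borel \<Longrightarrow> g \<in> borel_measurable borel \<Longrightarrow>
      K \<ge> 0 \<Longrightarrow> \<eta> \<ge> 0 \<Longrightarrow> Lp_mass q f \<le> ennreal K \<Longrightarrow> Lp_mass q g \<le> ennreal \<eta> \<Longrightarrow>
      \<bar>(LINT x|lborel. F (f x + g x)) - (LINT x|lborel. F (f x))\<bar> \<le> \<epsilon> * K + C * \<eta>"
      using integral_increment_bound[OF \<epsilon>(1)] by blast
    define \<eta> where "\<eta> = e / (3 * (C + 1))"
    have \<eta>: "\<eta> > 0" "C * \<eta> \<le> e / 3" using e C(1) by (auto simp: \<eta>_def field_simps)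
    obtain L0 where L0: "enat L0 \<le> \<Lambda>" "\<And>L. L \<ge> L0 \<Longrightarrow> enat L \<le> \<Lambda> \<Longrightarrow>
      \<forall>\<^sub>F n in sequentially. Lp_mass q (\<lambda>x. U n x - G L n x) \<le> ennreal \<eta>"
      using rest_small[OF \<eta>(1)] by auto
    have "\<forall>\<^sub>F n in sequentially. \<bar>(LINT x|lborel. F (U n x)) - (\<Sum>l\<le>L. LINT x|lborel. F (W l x))\<bar> \<le> e"
      if L: "L \<ge> L0" "enat L \<le> \<Lambda>" for L
    proof -
      have "(\<lambda>n. LINT x|lborel. F (G L n x)) \<longlonglongrightarrow> (\<Sum>l\<le>L. LINT x|lborel. F (W l x))"
        unfolding G_def D_def using le_trans[OF _ L(2)] W sep
        by (intro integral_F_sum_profiles_tendsto[OF homog]) auto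
      then have "\<forall>\<^sub>F n in sequentially. dist (LINT x|lborel. F (G L n x)) (\<Sum>l\<le>L. LINT x|lborel. F (W l x)) < e / 3"
        by (rule tendstoD) (use e in simp)
      with K(2) L0(2)[OF L] show ?thesis
      proof eventually_elim
        case (elim n)
        have "Lp_mass q (\<lambda>x. G L n x - U n x) \<le> ennreal \<eta>"
          using elim(2) by (simp add: Lp_mass_minus_commute[of q "G L n"])
        \<comment> \<open>The increment starts at U n, whose mass bound is independent of L, and
          leads to G L n.\<close>
        then have "\<bar>(LINT x|lborel. F (U n x + (G L n x - U n x))) - (LINT x|lborel. F (U n x))\<bar> \<le> \<epsilon> * K + C * \<eta>"
          using elim(1) K(1) \<eta>(1) U(3) G_meas[OF L(2)] by (intro C(2) borel_measurable_diff) auto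
        then have "\<bar>(LINT x|lborel. F (G L n x)) - (LINT x|lborel. F (U n x))\<bar> \<le> \<epsilon> * K + C * \<eta>" by simp
        then show ?case using elim(3) \<epsilon>(2) \<eta>(2) unfolding dist_real_def by linarith
      qed
    qed
    then show ?thesis using L0(1) by blast
  qed
  then have "\<exists>S. tendsto_upto \<Lambda> (\<lambda>L. \<Sum>l\<le>L. LINT x|lborel. F (W l x)) S \<and> (\<lambda>n. LINT x|lborel. F (U n x)) \<longlonglongrightarrow> S"
    by (rule tendsto_upto_common_limit)
  then show ?thesis
    using integrable_F_comp[OF U(3,2)] integrable_F_comp[OF W(3,2)] unfolding U_def W_def by blast
qed

end
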